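(* Let $\varphi:\mathbb{R}^n\to(-\infty,\infty]$ be proper and lower semicontinuous, let $\varphi$ be $C^2$-strictly $u$-decomposable at $\bar x$ for $\bar\lambda\in\mathcal Q$ with decomposition pair $(\sigma_{\mathcal Q},F)$, and set $\bar v=DF(\bar x)^\top\bar\lambda$. Then the following statements are equivalent: (i) $\mathrm{d}^2_s\varphi(\bar x\,|\,\bar v)(h)>0$ for all $h\in\mathbb{R}^n\setminus\{0\}$, i.e., $\langle\bar\lambda,D^2F(\bar x)[h,h]\rangle>0$ for all $h\in\mathrm{aff}(\mathcal C(\bar x,\bar v))\setminus\{0\}$. (ii) There are neighborhoods $U$ of $\bar x$ and $V$ of $\bar v$ and $\sigma>0$ such that $$\varphi(x')\ge\varphi(x)+\langle v,x'-x\rangle+\frac\sigma2\|x-x'\|^2\qquad\forall\,(x,v)\in\mathrm{gph}(\partial\varphi)\cap(U\times V),\ \forall\,x'\in U.$$ (iii) The mapping $\partial\varphi$ is strongly metrically regular at $\bar x$ for $\bar v$, and $\bar x$ is a local minimizer of the mapping $\varphi-\langle\bar v,\cdot\rangle$.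
   Context: $\partial$ is the limiting subdifferential, $\sigma_{\mathcal Q}$ the support function, $T_{\mathcal Q}$, $N_{\mathcal Q}$ the tangent and normal cones of a convex set, $\mathrm{aff}$ the affine hull, $\mathrm{lin}(K)=K\cap(-K)$. Set convergence is in the Painlevé–Kuratowski sense. $\partial\varphi$ is strongly metrically regular at $\bar x$ for $\bar v$ if $(\partial\varphi)^{-1}$ has a single-valued Lipschitz continuous localization around $\bar v$ for $\bar x$. Decomposability: $\varphi$ is $C^\ell$-decomposable at $\bar x\in\mathrm{dom}(\varphi)$ with decomposition pair $(\varphi_d,F)$ if there is an open neighborhood $U$ of $\bar x$ with $\varphi(x)=\varphi(\bar x)+\varphi_d(F(x))$ for all $x\in U$, where (i) $F:U\to\mathbb{R}^m$ is $\ell$-times continuously differentiable and $F(\bar x)=0$; (ii) $\varphi_d=\sigma_{\mathcal Q}:\mathbb{R}^m\to(-\infty,\infty]$ for some nonempty closed convex set $\mathcal Q\subseteq\mathbb{R}^m$; (iii) $0\in\mathrm{int}\{DF(\bar x)\mathbb{R}^n-\mathrm{dom}(\varphi_d)\}$. It is $C^\ell$-strictly decomposable at $\bar x$ for $\bar\lambda\in\mathcal Q$ if in addition $DF(\bar x)\mathbb{R}^n-N_{\mathcal Q}(\bar\lambda)=\mathbb{R}^m$. Uniform second-order tangent path ($\mathcal{UTP}$-)property: a closed convex set $\mathcal Q$ has it at $\bar\lambda\in\mathcal Q$ if there are constants $\delta>0$, $M>0$ and a neighborhood $V$ of $\bar\lambda$ such that for all $\lambda\in\mathcal Q\cap V$: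 (i) one can select a linear subspace $S(\lambda)\subseteq\mathrm{lin}(T_{\mathcal Q}(\lambda))$ such that $S(\lambda)\to\mathrm{lin}(T_{\mathcal Q}(\bar\lambda))$ as $\lambda\to\bar\lambda$; (ii) for all $v\in S(\lambda)$ with $\|v\|=1$ there is a path $\xi:[0,\delta]\to\mathcal Q$ with $\xi(t)=\lambda+tv+\frac12t^2r(t)$ and $\|r(t)\|\le M$ for all $t\in[0,\delta]$. $\varphi$ is $C^2$-strictly $u$-decomposable at $\bar x$ for $\bar\lambda$ if it is $C^2$-strictly decomposable at $\bar x$ for $\bar\lambda$ and $\mathcal Q$ has the $\mathcal{UTP}$-property at $\bar\lambda$. Critical cone: $\mathcal C(\bar x,\bar v)=\{h:\mathrm{d}\varphi(\bar x)(h)=\langle\bar v,h\rangle\}$, where $\mathrm{d}\varphi(x)(h)=\liminf_{t\downarrow0,\tilde h\to h}\frac{\varphi(x+t\tilde h)-\varphi(x)}{t}$; here it equals $\{h:DF(\bar x)h\in N_{\mathcal Q}(\bar\lambda)\}$. Strict second subderivative: with $\Delta_t^2\varphi(x|v)(h):=\frac{\varphi(x+th)-\varphi(x)-t\langle v,h\rangle}{\frac12t^2}$, $$\mathrm{d}^2_s\varphi(\bar x|\bar v)(h):=\liminf_{t\downarrow0,\ \tilde h\to h,\ \varphi(x)\to\varphi(\bar x),\ \mathrm{gph}(\partial\varphi)\ni(x,v)\to(\bar x,\bar v)}\Delta_t^2\varphi(x|v)(\tilde h).$$ *)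

theory Defs
  imports "HOL-Analysis.Analysis"
begin

subsection \<open>Extended-real-valued functions and subdifferentials\<close>

definition proper_fun :: "('a \<Rightarrow> ereal) \<Rightarrow> bool" where
  "proper_fun \<phi> \<longleftrightarrow> (\<forall>x. \<phi> x \<noteq> -\<infinity>) \<and> (\<exists>x. \<phi> x < \<infinity>)"

definition lsc_fun :: "('a::topological_space \<Rightarrow> ereal) \<Rightarrow> bool" where
  "lsc_fun \<phi> \<longleftrightarrow> (\<forall>x. \<phi> x \<le> Liminf (nhds x) \<phi>)"

definition edom :: "('a \<Rightarrow> ereal) \<Rightarrow> 'a set" where
  "edom \<phi> = {x. \<phi> x < \<infinity>}"

definition regular_subdiff :: "('a::real_inner \<Rightarrow> ereal) \<Rightarrow> 'a \<Rightarrow> 'a set" where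
  "regular_subdiff \<phi> x = {v. \<bar>\<phi> x\<bar> \<noteq> \<infinity> \<and>
     Liminf (at x) (\<lambda>y. (\<phi> y - \<phi> x - ereal (v \<bullet> (y - x))) / ereal (norm (y - x))) \<ge> 0}"

definition limiting_subdiff :: "('a::real_inner \<Rightarrow> ereal) \<Rightarrow> 'a \<Rightarrow> 'a set" where
  "limiting_subdiff \<phi> x = {v. \<bar>\<phi> x\<bar> \<noteq> \<infinity> \<and>
     (\<exists>X W. X \<longlonglongrightarrow> x \<and> (\<lambda>k. \<phi> (X k)) \<longlonglongrightarrow> \<phi> x \<and>
            (\<forall>k. W k \<in> regular_subdiff \<phi> (X k)) \<and> W \<longlonglongrightarrow> v)}"

definition gph :: "('a \<Rightarrow> 'b set) \<Rightarrow> ('a \<times> 'b) set" where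
  "gph S = {(x, v). v \<in> S x}"

text \<open>The quotients below are formed in \<^typ>\<open>ereal\<close>; they are meaningful because \<open>\<phi> x\<close> is finite
  at the base points that occur (the given point of the domain, or points with nonempty
  subdifferential), and \<open>\<phi>\<close> never takes the value \<open>-\<infinity>\<close>.\<close>

definition subderiv :: "('a::real_normed_vector \<Rightarrow> ereal) \<Rightarrow> 'a \<Rightarrow> 'a \<Rightarrow> ereal" where
  "subderiv \<phi> x h =
     Liminf (at_right 0 \<times>\<^sub>F nhds h) (\<lambda>(t, h'). (\<phi> (x + t *\<^sub>R h') - \<phi> x) / ereal t)"

definition critical_cone :: "('a::real_inner \<Rightarrow> ereal) \<Rightarrow> 'a \<Rightarrow> 'a \<Rightarrow> 'a set" where
  "critical_cone \<phi> x v = {h. subderiv \<phi> x h = ereal (v \<bullet> h)}"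

definition second_quot ::
  "('a::real_inner \<Rightarrow> ereal) \<Rightarrow> real \<Rightarrow> 'a \<Rightarrow> 'a \<Rightarrow> 'a \<Rightarrow> ereal" where
  "second_quot \<phi> t x v h =
     (\<phi> (x + t *\<^sub>R h) - \<phi> x - ereal (t * (v \<bullet> h))) / ereal (t\<^sup>2 / 2)"

text \<open>The limit \<open>(x, v) \<rightarrow> (x0, v0)\<close> along the graph of the limiting subdifferential,
  with attentive convergence \<open>\<phi> x \<rightarrow> \<phi> x0\<close>; as usual for set limits in variational analysis,
  \<open>(x, v) = (x0, v0)\<close> is not excluded.\<close>

definition attentive_gph_filter ::
  "('a::real_inner \<Rightarrow> ereal) \<Rightarrow> 'a \<Rightarrow> 'a \<Rightarrow> ('a \<times> 'a) filter" where
  "attentive_gph_filter \<phi> x0 v0 =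
     inf (nhds (x0, v0))
      (inf (filtercomap (\<lambda>(x, v). \<phi> x) (nhds (\<phi> x0)))
           (principal (gph (limiting_subdiff \<phi>))))"

definition strict_second_subderiv ::
  "('a::real_inner \<Rightarrow> ereal) \<Rightarrow> 'a \<Rightarrow> 'a \<Rightarrow> 'a \<Rightarrow> ereal" where
  "strict_second_subderiv \<phi> x0 v0 h =
     Liminf (at_right 0 \<times>\<^sub>F (nhds h \<times>\<^sub>F attentive_gph_filter \<phi> x0 v0))
       (\<lambda>(t, h', x, v). second_quot \<phi> t x v h')"

definition local_minimizer :: "('a::topological_space \<Rightarrow> ereal) \<Rightarrow> 'a \<Rightarrow> bool" where
  "local_minimizer f x \<longleftrightarrow> (\<exists>U. open U \<and> x \<in> U \<and> (\<forall>y\<in>U. f x \<le> f y))"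

text \<open>Near the reference point the inverse \<open>v \<mapsto> {x. v \<in> S x}\<close> coincides with a single-valued
  Lipschitz continuous function \<open>g\<close>.\<close>

definition strongly_metrically_regular ::
  "('a::metric_space \<Rightarrow> 'b::metric_space set) \<Rightarrow> 'a \<Rightarrow> 'b \<Rightarrow> bool" where
  "strongly_metrically_regular S x0 v0 \<longleftrightarrow>
     v0 \<in> S x0 \<and>
     (\<exists>U V g L. open U \<and> x0 \<in> U \<and> open V \<and> v0 \<in> V \<and> L-lipschitz_on V g \<and>
        (\<forall>v\<in>V. {x \<in> U. v \<in> S x} = {g v}))"

subsection \<open>Convex sets\<close>

definition support_fun :: "'a::real_inner set \<Rightarrow> 'a \<Rightarrow> ereal" where
  "support_fun Q y = (SUP q\<in>Q. ereal (q \<bullet> y))"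

definition normal_cone :: "'a::real_inner set \<Rightarrow> 'a \<Rightarrow> 'a set" where
  "normal_cone Q l = (if l \<in> Q then {y. \<forall>q\<in>Q. y \<bullet> (q - l) \<le> 0} else {})"

definition tangent_cone :: "'a::real_normed_vector set \<Rightarrow> 'a \<Rightarrow> 'a set" where
  "tangent_cone Q l = {w. \<exists>T W. (\<forall>k. T k > (0::real)) \<and> T \<longlonglongrightarrow> 0 \<and> W \<longlonglongrightarrow> w \<and>
     (\<forall>k. l + T k *\<^sub>R W k \<in> Q)}"

definition lineality :: "'a::real_vector set \<Rightarrow> 'a set" where
  "lineality K = K \<inter> uminus ` K"

text \<open>Painleve--Kuratowski limits of \<open>S l\<close> as \<open>l \<rightarrow> l0\<close> within \<open>A\<close>; constant sequences
  \<open>l = l0\<close> are admitted.\<close>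

definition pk_limsup ::
  "('a::topological_space \<Rightarrow> 'b::topological_space set) \<Rightarrow> 'a set \<Rightarrow> 'a \<Rightarrow> 'b set" where
  "pk_limsup S A l0 = {y. \<exists>X Y. (\<forall>k. X k \<in> A) \<and> X \<longlonglongrightarrow> l0 \<and>
     (\<forall>k::nat. Y k \<in> S (X k)) \<and> Y \<longlonglongrightarrow> y}"

definition pk_liminf ::
  "('a::topological_space \<Rightarrow> 'b::topological_space set) \<Rightarrow> 'a set \<Rightarrow> 'a \<Rightarrow> 'b set" where
  "pk_liminf S A l0 = {y. \<forall>X. (\<forall>k. X k \<in> A) \<and> X \<longlonglongrightarrow> l0 \<longrightarrow>
     (\<exists>Y. (\<forall>\<^sub>F k in sequentially. Y k \<in> S (X k)) \<and> Y \<longlonglongrightarrow> y)}"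

definition pk_converges ::
  "('a::topological_space \<Rightarrow> 'b::topological_space set) \<Rightarrow> 'a set \<Rightarrow> 'a \<Rightarrow> 'b set \<Rightarrow> bool" where
  "pk_converges S A l0 L \<longleftrightarrow> pk_limsup S A l0 = L \<and> pk_liminf S A l0 = L"

text \<open>Uniform second-order tangent path property. Requiring continuity of the path \<open>\<xi>\<close> is no
  restriction: the projection of \<open>l + t v\<close> onto \<open>Q\<close> is continuous in \<open>t\<close> and its distance to
  \<open>l + t v\<close> is at most that of any point of \<open>Q\<close>.\<close>

definition UTP_property :: "'a::euclidean_space set \<Rightarrow> 'a \<Rightarrow> bool" where
  "UTP_property Q l0 \<longleftrightarrow>
     (\<exists>\<delta> M V S. \<delta> > 0 \<and> M > 0 \<and> open V \<and> l0 \<in> V \<and>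
        (\<forall>l\<in>Q \<inter> V. subspace (S l) \<and> S l \<subseteq> lineality (tangent_cone Q l)) \<and>
        pk_converges S (Q \<inter> V) l0 (lineality (tangent_cone Q l0)) \<and>
        (\<forall>l\<in>Q \<inter> V. \<forall>v\<in>S l. norm v = 1 \<longrightarrow>
           (\<exists>\<xi> r. continuous_on {0..\<delta>} \<xi> \<and>
              (\<forall>t\<in>{0..\<delta>}. \<xi> t \<in> Q \<and> \<xi> t = l + t *\<^sub>R v + (t\<^sup>2 / 2) *\<^sub>R r t \<and>
                 norm (r t) \<le> M))))"

subsection \<open>Decomposable functions\<close>

text \<open>The derivative as a map into bounded linear functions, so that it can be differentiated
  again; \<open>fderiv (fderiv F) x h k\<close> is \<open>D\<^sup>2F(x)[h, k]\<close>.\<close>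

definition fderiv ::
  "('a::real_normed_vector \<Rightarrow> 'b::real_normed_vector) \<Rightarrow> 'a \<Rightarrow> 'a \<Rightarrow>\<^sub>L 'b" where
  "fderiv F x = Blinfun (frechet_derivative F (at x))"

definition D2 ::
  "('a::real_normed_vector \<Rightarrow> 'b::real_normed_vector) \<Rightarrow> 'a \<Rightarrow> 'a \<Rightarrow> 'a \<Rightarrow> 'b" where
  "D2 F x h k = blinfun_apply (blinfun_apply (fderiv (fderiv F) x) h) k"

definition C2_on ::
  "('a::real_normed_vector \<Rightarrow> 'b::real_normed_vector) \<Rightarrow> 'a set \<Rightarrow> bool" where
  "C2_on F U \<longleftrightarrow>
     (\<forall>x\<in>U. F differentiable (at x)) \<and>
     (\<forall>x\<in>U. fderiv F differentiable (at x)) \<and>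
     continuous_on U (fderiv (fderiv F))"

text \<open>The map \<open>F\<close> is total here, but only its values on the open neighborhood \<open>U\<close> matter. The
  decomposition pair is \<open>(support_fun Q, F)\<close>.\<close>

definition C2_decomposable ::
  "('a::euclidean_space \<Rightarrow> ereal) \<Rightarrow> 'a \<Rightarrow> 'b::euclidean_space set \<Rightarrow> ('a \<Rightarrow> 'b) \<Rightarrow> bool" where
  "C2_decomposable \<phi> x0 Q F \<longleftrightarrow>
     \<bar>\<phi> x0\<bar> \<noteq> \<infinity> \<and> Q \<noteq> {} \<and> closed Q \<and> convex Q \<and>
     (\<exists>U. open U \<and> x0 \<in> U \<and> C2_on F U \<and>
        (\<forall>x\<in>U. \<phi> x = \<phi> x0 + support_fun Q (F x))) \<and>
     F x0 = 0 \<and>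
     0 \<in> interior {blinfun_apply (fderiv F x0) w - y | w y. y \<in> edom (support_fun Q)}"

definition C2_strictly_decomposable ::
  "('a::euclidean_space \<Rightarrow> ereal) \<Rightarrow> 'a \<Rightarrow> 'b::euclidean_space set \<Rightarrow> ('a \<Rightarrow> 'b) \<Rightarrow> 'b \<Rightarrow> bool" where
  "C2_strictly_decomposable \<phi> x0 Q F l \<longleftrightarrow>
     C2_decomposable \<phi> x0 Q F \<and> l \<in> Q \<and>
     {blinfun_apply (fderiv F x0) w - y | w y. y \<in> normal_cone Q l} = UNIV"

definition C2_strictly_u_decomposable ::
  "('a::euclidean_space \<Rightarrow> ereal) \<Rightarrow> 'a \<Rightarrow> 'b::euclidean_space set \<Rightarrow> ('a \<Rightarrow> 'b) \<Rightarrow> 'b \<Rightarrow> bool" where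
  "C2_strictly_u_decomposable \<phi> x0 Q F l \<longleftrightarrow>
     C2_strictly_decomposable \<phi> x0 Q F l \<and> UTP_property Q l"

end

theory Submission
  imports Defs
begin

text \<open>
  The qualification condition \<open>DF(xb) R\<^sup>n - N\<^sub>Q(lb) = R\<^sup>m\<close> gives
  \<open>norm (l - lb) \<le> \<kappa> * norm (DF(xb)\<^sup>T (l - lb))\<close> on \<open>Q\<close>, so the multipliers of subgradients near
  \<open>(xb, vb)\<close> exist and are close to \<open>lb\<close>. For a subgradient \<open>v\<close> at \<open>x\<close> with multiplier \<open>l\<close>,
  \<open>\<phi> x' - \<phi> x - v \<bullet> (x' - x)\<close> is the sum of \<open>\<sigma>\<^sub>Q (F x') - l \<bullet> F x' \<ge> 0\<close> and a term that is
  \<open>lb \<bullet> D\<^sup>2F(xb)[h, h] / 2\<close> to second order in the direction \<open>h\<close>. Along directions outside the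
  affine hull of the critical cone the first summand dominates every multiple of the second one,
  by the tangent paths in \<open>Q\<close>; along directions inside it vanishes for suitable base points \<open>x\<close> and
  \<open>x'\<close> with \<open>F x, F x' \<in> N\<^sub>Q(lb)\<close>, found by a fixed point argument. Hence positivity of the strict
  second subderivative is positivity of the curvature term, and by compactness of the unit sphere
  it is uniform quadratic growth. The latter is equivalent to strong metric regularity at a local
  minimizer by minimizing the tilted functions \<open>\<phi> - v\<close> over a fixed ball.
\<close>

subsection \<open>Support functions, normal cones and subgradients\<close>

text \<open>The base point \<open>x\<close>, the subgradient \<open>v\<close> and the multiplier
  \<open>l\<close> all move, and this shapes every estimate. Taylor remainders must be uniform in
  the base point, so they rest on strict differentiability of \<open>F\<close> and of
  \<open>fderiv F\<close> at \<open>xb\<close>. A tangent path has to start at \<open>l\<close>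
  rather than at \<open>lb\<close>: a direction in the lineality space of the tangent cone at
  \<open>l\<close> annihilates \<open>F x\<close>, which is normal at \<open>l\<close>, so the
  first-order change of \<open>F\<close> is gained in full. Hence path constants common to all
  \<open>l\<close> near \<open>lb\<close> are wanted. The affine hull, and not the critical cone
  itself, appears because an increment may join two points reached from \<open>xb\<close> along two
  different critical directions; both points keep the multiplier \<open>lb\<close>. The condition
  \<open>F x \<in> N\<close> is a cone constraint, so points fulfilling it come from Brouwer's
  theorem applied to a continuous solution map of the qualification condition; the same map bounds
  the multipliers. The chain rule cannot differentiate the support function, which is nonsmooth and
  may be infinite; it goes through smooth approximations, and compactness of the multipliers allows
  the limit.\<close>

lemma support_fun_ge: "q \<in> Q \<Longrightarrow> ereal (q \<bullet> y) \<le> support_fun Q y"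
  unfolding support_fun_def by (rule SUP_upper)

lemma support_fun_normal:
  assumes "y \<in> normal_cone Q l"
  shows "support_fun Q y = ereal (l \<bullet> y)"
proof (rule antisym)
  have l: "l \<in> Q" and n: "\<And>q. q \<in> Q \<Longrightarrow> y \<bullet> (q - l) \<le> 0"
    using assms by (auto simp: normal_cone_def split: if_splits)
  show "support_fun Q y \<le> ereal (l \<bullet> y)"
    unfolding support_fun_def using n
    by (intro SUP_least) (auto simp: inner_diff_right inner_commute)
  show "ereal (l \<bullet> y) \<le> support_fun Q y" using l by (rule support_fun_ge)
qed

lemma normal_coneI_support_fun:
  assumes "l \<in> Q" "support_fun Q y \<le> ereal (l \<bullet> y)"
  shows "y \<in> normal_cone Q l"
proof -
  have "y \<bullet> (q - l) \<le> 0" if "q \<in> Q" for q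
  proof -
    have "ereal (q \<bullet> y) \<le> ereal (l \<bullet> y)"
      using support_fun_ge[OF that, of y] assms(2) by (rule order_trans)
    then show ?thesis by (simp add: inner_diff_right inner_commute)
  qed
  then show ?thesis using assms(1) by (simp add: normal_cone_def)
qed

lemma normal_cone_le: "y \<in> normal_cone Q l \<Longrightarrow> q \<in> Q \<Longrightarrow> y \<bullet> (q - l) \<le> 0"
  by (auto simp: normal_cone_def split: if_splits)

lemma normal_cone_zero: "l \<in> Q \<Longrightarrow> 0 \<in> normal_cone Q l"
  by (auto simp: normal_cone_def)

lemma normal_cone_add: "x \<in> normal_cone Q l \<Longrightarrow> y \<in> normal_cone Q l \<Longrightarrow> x + y \<in> normal_cone Q l"
  by (fastforce simp: normal_cone_def inner_add_left split: if_splits)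

lemma normal_cone_scale: "x \<in> normal_cone Q l \<Longrightarrow> 0 \<le> (c::real) \<Longrightarrow> c *\<^sub>R x \<in> normal_cone Q l"
  by (auto simp: normal_cone_def mult_nonneg_nonpos split: if_splits)

lemma normal_cone_sum:
  "finite I \<Longrightarrow> l \<in> Q \<Longrightarrow> (\<And>i. i \<in> I \<Longrightarrow> f i \<in> normal_cone Q l) \<Longrightarrow> sum f I \<in> normal_cone Q l"
  by (induction I rule: finite_induct) (auto intro: normal_cone_zero normal_cone_add)

text \<open>Multiplying the quotient out removes the extended-real division. Including
  \<open>y = x\<close> is harmless, since the inequality then reads
  \<open>\<phi> x \<le> \<phi> x\<close>; the punctured neighbourhood thus becomes a full
  ball.\<close>

lemma regular_subdiff_iff:
  fixes x v :: "'a::real_inner"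
  shows "v \<in> regular_subdiff \<phi> x \<longleftrightarrow> \<bar>\<phi> x\<bar> \<noteq> \<infinity> \<and>
    (\<forall>e>0. \<exists>d>0. \<forall>y. dist y x < d \<longrightarrow>
      \<phi> x + ereal (v \<bullet> (y - x) - e * norm (y - x)) \<le> \<phi> y)"
proof (cases "\<bar>\<phi> x\<bar> \<noteq> \<infinity>")
  case True
  then obtain p where p: "\<phi> x = ereal p" by auto
  have quot: "- ereal e \<le> (\<phi> y - \<phi> x - ereal (v \<bullet> (y - x))) / ereal (norm (y - x)) \<longleftrightarrow>
      \<phi> x + ereal (v \<bullet> (y - x) - e * norm (y - x)) \<le> \<phi> y" if "y \<noteq> x" for e y
  proof -
    have n: "norm (y - x) > 0" using that by simp
    show ?thesis
      using n by (cases "\<phi> y") (auto simp: p field_simps)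
  qed
  have "0 \<le> Liminf (at x) (\<lambda>y. (\<phi> y - \<phi> x - ereal (v \<bullet> (y - x))) / ereal (norm (y - x))) \<longleftrightarrow>
    (\<forall>e>0. \<forall>\<^sub>F y in at x. - ereal e \<le> (\<phi> y - \<phi> x - ereal (v \<bullet> (y - x))) / ereal (norm (y - x)))"
    (is "0 \<le> Liminf _ ?q \<longleftrightarrow> _")
  proof
    assume L: "0 \<le> Liminf (at x) ?q"
    show "\<forall>e>0. \<forall>\<^sub>F y in at x. - ereal e \<le> ?q y"
    proof (intro allI impI)
      fix e :: real assume "e > 0"
      then have "- ereal e < 0" by simp
      then have "\<forall>\<^sub>F y in at x. - ereal e < ?q y" 
        by (rule iffD1[OF le_Liminf_iff L, rule_format])
      then show "\<forall>\<^sub>F y in at x. - ereal e \<le> ?q y" by eventually_elim simp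
    qed
  next
    assume R: "\<forall>e>0. \<forall>\<^sub>F y in at x. - ereal e \<le> ?q y"
    show "0 \<le> Liminf (at x) ?q"
      unfolding le_Liminf_iff
    proof (intro allI impI)
      fix z :: ereal assume z: "z < 0"
      \<comment> \<open>\<open>z\<close> may be \<open>-\<infinity>\<close>; the interpolated real
        value supplies the \<open>e\<close> for which the hypothesis is used.\<close>
      then obtain w where w: "z < w" "w < 0" using dense by blast
      then obtain r where r: "w = ereal r" by (cases w) auto
      have "- r > 0" using w(2) r by (simp add: zero_ereal_def)
      from R[rule_format, OF this] have "\<forall>\<^sub>F y in at x. - ereal (-r) \<le> ?q y" .
      then show "\<forall>\<^sub>F y in at x. z < ?q y"
      proof eventually_elim
        case (elim y)
        have "z < ereal r" using w(1) r by simp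
        also have "ereal r = - ereal (- r)" by simp
        also have "\<dots> \<le> ?q y" by (rule elim)
        finally show ?case .
      qed
    qed
  qed
  also have "\<dots> \<longleftrightarrow> (\<forall>e>0. \<exists>d>0. \<forall>y. dist y x < d \<longrightarrow>
      \<phi> x + ereal (v \<bullet> (y - x) - e * norm (y - x)) \<le> \<phi> y)"
    unfolding eventually_at
  proof (intro all_cong ex_cong conj_cong refl iffI allI impI ballI)
    fix e d :: real and y
    assume H: "\<forall>xa\<in>UNIV. xa \<noteq> x \<and> dist xa x < d \<longrightarrow> - ereal e \<le> ?q xa" and y: "dist y x < d"
    show "\<phi> x + ereal (v \<bullet> (y - x) - e * norm (y - x)) \<le> \<phi> y"
      using H y quot[of y e] by (cases "y = x") auto
  next
    fix e d :: real and y
    assume H: "\<forall>y. dist y x < d \<longrightarrow> \<phi> x + ereal (v \<bullet> (y - x) - e * norm (y - x)) \<le> \<phi> y"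
      and y: "y \<noteq> x \<and> dist y x < d"
    show "- ereal e \<le> ?q y" using H y quot[of y e] by auto
  qed
  finally show ?thesis using True by (simp add: regular_subdiff_def)
qed (simp add: regular_subdiff_def)

lemma regular_imp_limiting: "v \<in> regular_subdiff \<phi> x \<Longrightarrow> v \<in> limiting_subdiff \<phi> x"
  unfolding limiting_subdiff_def mem_Collect_eq
  by (intro conjI exI[of _ "\<lambda>_. x"] exI[of _ "\<lambda>_. v"])
     (auto simp: regular_subdiff_def)

lemma regular_subdiffI_local_min:
  fixes x v :: "'a::real_inner"
  assumes "\<bar>\<phi> x\<bar> \<noteq> \<infinity>" "open U" "x \<in> U"
    and "\<And>y. y \<in> U \<Longrightarrow> \<phi> x + ereal (v \<bullet> (y - x)) \<le> \<phi> y"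
  shows "v \<in> regular_subdiff \<phi> x"
  unfolding regular_subdiff_iff
proof (intro conjI allI impI assms(1))
  fix e :: real assume e: "e > 0"
  obtain d where d: "d > 0" "ball x d \<subseteq> U" using assms(2,3) open_contains_ball by blast
  show "\<exists>d>0. \<forall>y. dist y x < d \<longrightarrow> \<phi> x + ereal (v \<bullet> (y - x) - e * norm (y - x)) \<le> \<phi> y"
  proof (intro exI[of _ d] conjI d allI impI)
    fix y assume "dist y x < d"
    then have "y \<in> U" using d by (auto simp: dist_commute)
    have "\<phi> x + ereal (v \<bullet> (y - x) - e * norm (y - x)) \<le> \<phi> x + ereal (v \<bullet> (y - x))"
      using e by (intro add_left_mono) simp
    also have "\<dots> \<le> \<phi> y" by (rule assms(4)) fact
    finally show "\<phi> x + ereal (v \<bullet> (y - x) - e * norm (y - x)) \<le> \<phi> y" .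
  qed
qed

lemma second_quot_ge_iff:
  assumes "\<bar>\<phi> x\<bar> \<noteq> \<infinity>" "t > 0"
  shows "ereal c \<le> second_quot \<phi> t x v h \<longleftrightarrow>
    \<phi> x + ereal (t * (v \<bullet> h) + c * (t\<^sup>2 / 2)) \<le> \<phi> (x + t *\<^sub>R h)"
proof -
  obtain p where p: "\<phi> x = ereal p" using assms(1) by auto
  have t: "t\<^sup>2 > 0" using assms(2) by simp
  show ?thesis unfolding second_quot_def
    using t by (cases "\<phi> (x + t *\<^sub>R h)") (auto simp: p field_simps)
qed

section \<open>Lower semicontinuity: sequences, linear tilts, attainment of minima\<close>

lemma lsc_fun_seq_le:
  assumes "lsc_fun \<phi>" "X \<longlonglongrightarrow> (x::'a::metric_space)" "Y \<longlonglongrightarrow> y" "\<And>k::nat. \<phi> (X k) \<le> Y k"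
  shows "\<phi> x \<le> y"
proof -
  have "\<phi> x \<le> Liminf (nhds x) \<phi>" using assms(1) by (simp add: lsc_fun_def)
  also have "\<dots> \<le> Liminf sequentially (\<lambda>k. \<phi> (X k))"
    unfolding le_Liminf_iff
  proof (intro allI impI)
    fix z assume "z < Liminf (nhds x) \<phi>"
    then have "\<forall>\<^sub>F y in nhds x. z < \<phi> y" 
      by (rule iffD1[OF le_Liminf_iff order_refl, rule_format])
    then show "\<forall>\<^sub>F k in sequentially. z < \<phi> (X k)"
      using assms(2) unfolding filterlim_iff by blast
  qed
  also have "\<dots> \<le> Liminf sequentially Y"
    using assms(4) by (intro Liminf_mono) simp
  also have "\<dots> = y" using assms(3) by (simp add: lim_imp_Liminf)
  finally show ?thesis .
qed

text \<open>A real \<open>r\<close> strictly between \<open>z\<close> and the tilted value leaves a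
  gap above \<open>z\<close>, and the continuous linear part stays within that gap near
  \<open>x\<close>. For \<open>z = -\<infinity>\<close> any real lower bound of
  \<open>\<phi>\<close> suffices.\<close>

lemma lsc_fun_tilt:
  fixes v :: "'a::real_inner"
  assumes "lsc_fun \<phi>"
  shows "lsc_fun (\<lambda>x. \<phi> x - ereal (v \<bullet> x))"
  unfolding lsc_fun_def
proof
  fix x
  show "\<phi> x - ereal (v \<bullet> x) \<le> Liminf (nhds x) (\<lambda>x. \<phi> x - ereal (v \<bullet> x))"
    unfolding le_Liminf_iff
  proof (intro allI impI)
    fix z assume z: "z < \<phi> x - ereal (v \<bullet> x)"
    then obtain w where w: "z < w" "w < \<phi> x - ereal (v \<bullet> x)" using dense by blast
    then show "\<forall>\<^sub>F y in nhds x. z < \<phi> y - ereal (v \<bullet> y)"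
    proof (cases w)
      case (real r)
      show ?thesis
      proof (cases z)
        case (real s)
        have rs: "s < r" using w real \<open>w = ereal r\<close> by simp
        have "ereal (r + v \<bullet> x) < \<phi> x"
          using w(2) \<open>w = ereal r\<close> by (cases "\<phi> x") auto
        then have 1: "\<forall>\<^sub>F y in nhds x. ereal (r + v \<bullet> x) < \<phi> y"
          using assms le_Liminf_iff unfolding lsc_fun_def by blast
        have "((\<lambda>y. v \<bullet> y) \<longlongrightarrow> v \<bullet> x) (nhds x)"
          by (rule tendsto_inner[OF tendsto_const filterlim_ident])
        then have 2: "\<forall>\<^sub>F y in nhds x. v \<bullet> y < v \<bullet> x + (r - s)"
          by (rule order_tendstoD) (use rs in simp)
        show ?thesis using 1 2
        proof eventually_elim
          case (elim y)
          then show ?case using real by (cases "\<phi> y") auto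
        qed
      next
        case MInf
        have "ereal (r + v \<bullet> x) < \<phi> x"
          using w(2) \<open>w = ereal r\<close> by (cases "\<phi> x") auto
        then have 1: "\<forall>\<^sub>F y in nhds x. ereal (r + v \<bullet> x) < \<phi> y"
          using assms le_Liminf_iff unfolding lsc_fun_def by blast
        then show ?thesis
        proof eventually_elim
          case (elim y)
          then show ?case using MInf by (cases "\<phi> y") auto
        qed
      qed (use w in auto)
    qed auto
  qed
qed

text \<open>The direct method in the complete order \<open>ereal\<close>: a minimizing sequence has
  a cluster point. The minimal value may be infinite, so finiteness of the minimum is a separate
  matter.\<close>

lemma lsc_fun_attains_inf:
  fixes S :: "'a::metric_space set"
  assumes "lsc_fun f" "compact S" "S \<noteq> {}"
  obtains x where "x \<in> S" "\<And>y. y \<in> S \<Longrightarrow> f x \<le> f y"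
proof -
  obtain Y where Y: "\<And>k::nat. Y k \<in> f ` S" "Y \<longlonglongrightarrow> Inf (f ` S)"
    using Inf_as_limit[of "f ` S"] assms(3) by auto
  then have "\<forall>k. \<exists>x\<in>S. f x = Y k" by (metis image_iff)
  then obtain X where X: "\<And>k. X k \<in> S" "\<And>k. f (X k) = Y k" by metis
  obtain x r where x: "x \<in> S" "strict_mono r" "(X \<circ> r) \<longlonglongrightarrow> x"
    using assms(2) X(1) unfolding compact_def by metis
  have "f x \<le> Inf (f ` S)"
    by (rule lsc_fun_seq_le[OF assms(1) x(3) LIMSEQ_subseq_LIMSEQ[OF Y(2) x(2)]]) (simp add: X)
  then show ?thesis using that[OF x(1)] by (meson INF_lower order_trans)
qed

subsection \<open>Multipliers under the qualification condition\<close>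

lemma has_derivative_fderiv:
  "F differentiable (at x) \<Longrightarrow> (F has_derivative blinfun_apply (fderiv F x)) (at x)"
  unfolding fderiv_def
  by (metis bounded_linear_Blinfun_apply frechet_derivative_works has_derivative_bounded_linear)

locale strict_decomposition =
  fixes \<phi> :: "'a::euclidean_space \<Rightarrow> ereal" and F :: "'a \<Rightarrow> 'b::euclidean_space"
    and Q :: "'b set" and xb :: 'a and lb :: 'b and U :: "'a set"
  assumes phi_finite: "\<bar>\<phi> xb\<bar> \<noteq> \<infinity>"
    and closed_Q: "closed Q" and convex_Q: "convex Q" and lb_Q: "lb \<in> Q"
    and open_U: "open U" and xb_U: "xb \<in> U" and C2: "C2_on F U"
    and phi_eq: "x \<in> U \<Longrightarrow> \<phi> x = \<phi> xb + support_fun Q (F x)"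
    and F_xb: "F xb = 0"
    and qualification: "{blinfun_apply (fderiv F xb) w - y | w y. y \<in> normal_cone Q lb} = UNIV"
begin

abbreviation D :: "'a \<Rightarrow> 'a \<Rightarrow> 'b" where "D x \<equiv> blinfun_apply (fderiv F x)"

abbreviation N :: "'b set" where "N \<equiv> normal_cone Q lb"

abbreviation vb :: 'a where "vb \<equiv> adjoint (D xb) lb"

text \<open>The first two clauses say that \<open>l\<close> is a subgradient of the support function
  at \<open>F x\<close>; the last one says that \<open>v\<close> is the image of \<open>l\<close>
  under the adjoint of \<open>D x\<close>. The existence of such an \<open>l\<close> is the
  right-hand side of the chain rule.\<close>

definition multiplier :: "'a \<Rightarrow> 'a \<Rightarrow> 'b \<Rightarrow> bool" where
  "multiplier x v l \<longleftrightarrow> l \<in> Q \<and> F x \<in> normal_cone Q l \<and> (\<forall>h. v \<bullet> h = l \<bullet> D x h)"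

lemma vb_inner: "vb \<bullet> h = lb \<bullet> D xb h"
  by (metis adjoint_works blinfun.bounded_linear_right bounded_linear.linear inner_commute)

lemma F_deriv: "x \<in> U \<Longrightarrow> (F has_derivative D x) (at x)"
  using C2 by (auto simp: C2_on_def intro: has_derivative_fderiv)

lemma fderiv_deriv:
  "x \<in> U \<Longrightarrow> (fderiv F has_derivative blinfun_apply (fderiv (fderiv F) x)) (at x)"
  using C2 by (auto simp: C2_on_def intro: has_derivative_fderiv)

lemma isCont_F: "x \<in> U \<Longrightarrow> isCont F x"
  using F_deriv has_derivative_continuous by blast

lemma isCont_fderiv: "x \<in> U \<Longrightarrow> isCont (fderiv F) x"
  using fderiv_deriv has_derivative_continuous by blast

lemma fderiv_close:
  assumes "e > 0"
  obtains W where "open W" "xb \<in> W" "W \<subseteq> U"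
    "\<And>x. x \<in> W \<Longrightarrow> norm (fderiv F x - fderiv F xb) < e"
proof -
  have "(fderiv F \<longlongrightarrow> fderiv F xb) (nhds xb)"
    using isCont_fderiv[OF xb_U] by (simp add: isCont_def tendsto_at_iff_tendsto_nhds)
  then have "\<forall>\<^sub>F x in nhds xb. dist (fderiv F x) (fderiv F xb) < e"
    using assms by (rule tendstoD)
  then obtain W where "open W" "xb \<in> W" "\<And>x. x \<in> W \<Longrightarrow> dist (fderiv F x) (fderiv F xb) < e"
    unfolding eventually_nhds by auto
  then show thesis
    using open_U xb_U by (intro that[of "W \<inter> U"]) (auto simp: dist_norm)
qed

lemma continuous_F: "continuous_on U F"
  using isCont_F continuous_at_imp_continuous_on by blast

lemma multiplier_xb: "multiplier xb vb lb"
  using lb_Q by (auto simp: multiplier_def vb_inner F_xb normal_cone_zero)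

lemma phi_multiplier:
  assumes "x \<in> U" "multiplier x v l"
  shows "\<phi> x = \<phi> xb + ereal (l \<bullet> F x)"
  using assms support_fun_normal[of "F x" Q l] by (simp add: phi_eq multiplier_def)

lemma phi_finite_multiplier: "x \<in> U \<Longrightarrow> multiplier x v l \<Longrightarrow> \<bar>\<phi> x\<bar> \<noteq> \<infinity>"
  using phi_finite by (auto simp: phi_multiplier)

text \<open>Every \<open>q \<in> Q\<close> minorizes the support function at \<open>F y\<close>,
  while \<open>l\<close> is exact at \<open>F x\<close>. The choice \<open>q = l\<close> gives the
  subgradient inequality; a \<open>q\<close> displaced from \<open>l\<close> gives the extra growth
  in transversal directions.\<close>

lemma phi_lower:
  assumes "x \<in> U" "y \<in> U" "multiplier x v l" "q \<in> Q"
  shows "\<phi> x + ereal (q \<bullet> F y - l \<bullet> F x) \<le> \<phi> y"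
proof -
  have "\<phi> x + ereal (q \<bullet> F y - l \<bullet> F x) = \<phi> xb + ereal (q \<bullet> F y)"
    using phi_finite by (cases "\<phi> xb") (auto simp: phi_multiplier[OF assms(1,3)])
  also have "\<dots> \<le> \<phi> y"
    unfolding phi_eq[OF assms(2)] by (intro add_left_mono support_fun_ge assms)
  finally show ?thesis .
qed

text \<open>A continuous selection of solutions of \<open>D xb h - n = c\<close>, \<open>n \<in> N\<close>: the qualification
  condition only has to be solved for \<open>c\<close> among the signed basis vectors.\<close>

lemma qualification_selection:
  obtains H :: "'b \<Rightarrow> 'a" and \<kappa> :: real where
    "\<kappa> > 0" "continuous_on UNIV H" "\<And>c. norm (H c) \<le> \<kappa> * norm c" "\<And>c. D xb (H c) - c \<in> N"
proof -
  have "\<exists>w. D xb w - c \<in> N" for c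
  proof -
    have "c \<in> {D xb w - y | w y. y \<in> N}" using qualification by simp
    then obtain w y where "c = D xb w - y" "y \<in> N" by auto
    then have "D xb w - c = y" by simp
    then show ?thesis using \<open>y \<in> N\<close> by metis
  qed
  then obtain W where W: "\<And>c. D xb (W c) - c \<in> N" by metis
  \<comment> \<open>Positive and negative parts of the coordinates keep all coefficients
    nonnegative, as the cone \<open>N\<close> demands, and continuous in \<open>c\<close>.\<close>
  define H where "H c = (\<Sum>b\<in>Basis. max (c \<bullet> b) 0 *\<^sub>R W b + max (- (c \<bullet> b)) 0 *\<^sub>R W (- b))" for c
  define \<kappa> where "\<kappa> = 1 + (\<Sum>b\<in>(Basis::'b set). norm (W b) + norm (W (- b)))"
  have pos: "\<kappa> > 0" unfolding \<kappa>_def by (intro add_pos_nonneg sum_nonneg) auto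
  have cont: "continuous_on UNIV H" unfolding H_def by (intro continuous_intros)
  have bound: "norm (H c) \<le> \<kappa> * norm c" for c
  proof -
    have "norm (H c) \<le> (\<Sum>b\<in>Basis. (norm (W b) + norm (W (- b))) * norm c)"
      unfolding H_def
    proof (rule sum_norm_le)
      fix b :: 'b assume b: "b \<in> Basis"
      have *: "\<bar>c \<bullet> b\<bar> \<le> norm c" by (rule Basis_le_norm) fact
      have "norm (max (c \<bullet> b) 0 *\<^sub>R W b + max (- (c \<bullet> b)) 0 *\<^sub>R W (- b))
          \<le> max (c \<bullet> b) 0 * norm (W b) + max (- (c \<bullet> b)) 0 * norm (W (- b))"
        by (rule norm_triangle_le) simp
      also have "\<dots> \<le> norm c * norm (W b) + norm c * norm (W (- b))"
        using * by (intro add_mono mult_right_mono) auto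
      finally show "norm (max (c \<bullet> b) 0 *\<^sub>R W b + max (- (c \<bullet> b)) 0 *\<^sub>R W (- b))
          \<le> (norm (W b) + norm (W (- b))) * norm c" by (simp add: algebra_simps)
    qed
    also have "\<dots> \<le> \<kappa> * norm c" 
      unfolding \<kappa>_def by (simp add: sum_distrib_right distrib_right)
    finally show ?thesis .
  qed
  have mem: "D xb (H c) - c \<in> N" for c
  proof -
    have "c = (\<Sum>b\<in>Basis. (c \<bullet> b) *\<^sub>R b)" by (simp add: euclidean_representation)
    also have "\<dots> = (\<Sum>b\<in>Basis. max (c \<bullet> b) 0 *\<^sub>R b + max (- (c \<bullet> b)) 0 *\<^sub>R (- b))"
      by (intro sum.cong refl) (auto simp: max_def)
    finally have c: "c = (\<Sum>b\<in>Basis. max (c \<bullet> b) 0 *\<^sub>R b + max (- (c \<bullet> b)) 0 *\<^sub>R (- b))" .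
    have "D xb (H c) = (\<Sum>b\<in>Basis. max (c \<bullet> b) 0 *\<^sub>R D xb (W b) + max (- (c \<bullet> b)) 0 *\<^sub>R D xb (W (- b)))"
      unfolding H_def by (simp add: blinfun.sum_right blinfun.add_right blinfun.scaleR_right)
    then have "D xb (H c) - c =
      (\<Sum>b\<in>Basis. max (c \<bullet> b) 0 *\<^sub>R D xb (W b) + max (- (c \<bullet> b)) 0 *\<^sub>R D xb (W (- b))) -
      (\<Sum>b\<in>Basis. max (c \<bullet> b) 0 *\<^sub>R b + max (- (c \<bullet> b)) 0 *\<^sub>R (- b))"
      using c by metis
    also have "\<dots> = (\<Sum>b\<in>Basis. max (c \<bullet> b) 0 *\<^sub>R (D xb (W b) - b) +
        max (- (c \<bullet> b)) 0 *\<^sub>R (D xb (W (- b)) - (- b)))"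
      unfolding sum_subtractf[symmetric] by (intro sum.cong refl) (simp add: algebra_simps)
    also have "\<dots> \<in> N"
      by (intro normal_cone_sum normal_cone_add normal_cone_scale W lb_Q) auto
    finally show ?thesis .
  qed
  show thesis by (rule that[OF pos cont bound mem])
qed

text \<open>Solving the qualification condition for \<open>c = - (l - lb)\<close> yields
  \<open>h\<close> with \<open>D xb h + (l - lb) \<in> N\<close>. Pairing this normal with
  \<open>l - lb\<close> bounds the square of \<open>norm (l - lb)\<close> by
  \<open>- ((l - lb) \<bullet> D xb h)\<close>, which only involves \<open>v - vb\<close>, the
  change of the derivative and the error \<open>e\<close>. The slack \<open>e\<close> is there for
  the approximate multipliers of the chain rule.\<close>

lemma multiplier_bound:
  obtains \<kappa> W where "\<kappa> > 0" "open W" "xb \<in> W" "W \<subseteq> U"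
    "\<And>x v l e. x \<in> W \<Longrightarrow> l \<in> Q \<Longrightarrow> (\<And>h. \<bar>v \<bullet> h - l \<bullet> D x h\<bar> \<le> e * norm h) \<Longrightarrow>
      norm (l - lb) \<le> \<kappa> * (e + norm (v - vb) + norm lb * norm (fderiv F x - fderiv F xb))"
proof -
  obtain H \<kappa> where H: "\<kappa> > 0" "\<And>c. norm (H c) \<le> \<kappa> * norm c" "\<And>c. D xb (H c) - c \<in> N"
    using qualification_selection by metis
  \<comment> \<open>With \<open>norm l \<le> n + norm lb\<close> the bound contains the unknown
    \<open>n\<close> again, multiplied by \<open>d * \<kappa>\<close>. The radius makes this factor
    at most one half, so the term is absorbed on the left at the price of doubling
    \<open>\<kappa>\<close>.\<close>
  obtain W0 where W0: "open W0" "xb \<in> W0" "W0 \<subseteq> U"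
    "\<And>x. x \<in> W0 \<Longrightarrow> norm (fderiv F x - fderiv F xb) < 1 / (2 * \<kappa>)"
    using fderiv_close[of "1 / (2 * \<kappa>)"] H(1) by auto
  have "norm (l - lb) \<le> 2 * \<kappa> * (e + norm (v - vb) + norm lb * norm (fderiv F x - fderiv F xb))"
    if x: "x \<in> W0" and l: "l \<in> Q" and v: "\<And>h. \<bar>v \<bullet> h - l \<bullet> D x h\<bar> \<le> e * norm h" for x v l e
  proof -
    define n where "n = norm (l - lb)"
    define d where "d = norm (fderiv F x - fderiv F xb)"
    have d: "d * \<kappa> \<le> 1 / 2" using W0(4)[OF x] H(1) by (simp add: d_def field_simps)
    define h where "h = H (- (l - lb))"
    have h: "norm h \<le> \<kappa> * n" using H(2)[of "-(l - lb)"] by (simp add: h_def n_def norm_minus_commute)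
    have "(D xb h - (- (l - lb))) \<bullet> (l - lb) \<le> 0"
      unfolding h_def by (rule normal_cone_le[OF H(3) l])
    then have "n\<^sup>2 \<le> - ((l - lb) \<bullet> D xb h)"
      
      by (simp add: n_def power2_norm_eq_inner inner_diff_left inner_diff_right inner_commute)
    also have "(l - lb) \<bullet> D xb h = (v - vb) \<bullet> h - (v \<bullet> h - l \<bullet> D x h)
        - l \<bullet> ((fderiv F x - fderiv F xb) h)"
      by (simp add: inner_diff_left inner_diff_right vb_inner blinfun.diff_left)
    also have "- \<dots> \<le> norm (v - vb) * norm h + e * norm h + norm l * (d * norm h)"
    proof -
      have "\<bar>(v - vb) \<bullet> h\<bar> \<le> norm (v - vb) * norm h" by (rule Cauchy_Schwarz_ineq2)
      moreover have "\<bar>l \<bullet> ((fderiv F x - fderiv F xb) h)\<bar> \<le> norm l * (d * norm h)"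
        unfolding d_def by (rule order_trans[OF Cauchy_Schwarz_ineq2])
          (intro mult_left_mono norm_blinfun norm_ge_zero)
      ultimately show ?thesis using v[of h] by linarith
    qed
    also have "\<dots> = norm h * (norm (v - vb) + e + norm l * d)" by (simp add: algebra_simps)
    also have "\<dots> \<le> norm h * (norm (v - vb) + e + (n + norm lb) * d)"
    proof -
      have "norm l \<le> n + norm lb" unfolding n_def by (metis diff_add_cancel norm_triangle_ineq)
      then show ?thesis by (intro mult_left_mono add_left_mono mult_right_mono) (auto simp: d_def)
    qed
    also have "\<dots> \<le> \<kappa> * n * (norm (v - vb) + e + (n + norm lb) * d)"
    proof (rule mult_right_mono[OF h])
      have "0 \<le> e"
      proof -
        obtain b :: 'a where "b \<in> Basis" by (rule that[OF SOME_Basis])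
        then show ?thesis using v[of b] by simp
      qed
      then show "0 \<le> norm (v - vb) + e + (n + norm lb) * d" by (simp add: n_def d_def)
    qed
    finally have "n * n \<le> n * (\<kappa> * (norm (v - vb) + e + (n + norm lb) * d))"
      by (simp add: power2_eq_square algebra_simps)
    then have "n \<le> \<kappa> * (norm (v - vb) + e + (n + norm lb) * d)" if "n \<noteq> 0"
      using that by (simp add: n_def)
    also have "\<kappa> * (norm (v - vb) + e + (n + norm lb) * d)
        = \<kappa> * (e + norm (v - vb) + norm lb * d) + n * (d * \<kappa>)" by (simp add: algebra_simps)
    also have "\<dots> \<le> \<kappa> * (e + norm (v - vb) + norm lb * d) + n * (1 / 2)"
      using d by (intro add_left_mono mult_left_mono) (auto simp: n_def)
    finally have *: "n \<le> 2 * (\<kappa> * (e + norm (v - vb) + norm lb * d))" if "n \<noteq> 0" using that by simp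
    show ?thesis
    proof (cases "n = 0")
      case True
      have "0 \<le> e"
      proof -
        obtain b :: 'a where "b \<in> Basis" by (rule that[OF SOME_Basis])
        then show ?thesis using v[of b] by simp
      qed
      then show ?thesis using True H(1) by (simp add: n_def d_def)
    next
      case False
      then show ?thesis using * by (simp add: n_def d_def)
    qed
  qed
  then show thesis
    using that[of "2 * \<kappa>" W0] H(1) W0(1-3) by auto
qed

lemma multiplier_near:
  assumes "e > 0"
  obtains W d where "open W" "xb \<in> W" "W \<subseteq> U" "d > 0"
    "\<And>x v l. x \<in> W \<Longrightarrow> dist v vb < d \<Longrightarrow> multiplier x v l \<Longrightarrow> dist l lb < e"
proof -
  obtain \<kappa> W where W: "\<kappa> > 0" "open W" "xb \<in> W" "W \<subseteq> U"
    "\<And>x v l e. x \<in> W \<Longrightarrow> l \<in> Q \<Longrightarrow> (\<And>h. \<bar>v \<bullet> h - l \<bullet> D x h\<bar> \<le> e * norm h) \<Longrightarrow>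
      norm (l - lb) \<le> \<kappa> * (e + norm (v - vb) + norm lb * norm (fderiv F x - fderiv F xb))"
    using multiplier_bound by metis
  define d where "d = e / (2 * \<kappa>)"
  have d: "d > 0" using assms W(1) by (simp add: d_def)
  have d': "d / (norm lb + 1) > 0" using d by (intro divide_pos_pos add_nonneg_pos) auto
  obtain W0 where W0: "open W0" "xb \<in> W0"
    "\<And>x. x \<in> W0 \<Longrightarrow> norm (fderiv F x - fderiv F xb) < d / (norm lb + 1)"
    using fderiv_close[OF d'] by metis
  have "dist l lb < e" if x: "x \<in> W0 \<inter> W" and v: "dist v vb < d" and m: "multiplier x v l" for x v l
  proof -
    have "norm (l - lb) \<le> \<kappa> * (0 + norm (v - vb) + norm lb * norm (fderiv F x - fderiv F xb))"
      using x m by (intro W(5)) (auto simp: multiplier_def)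
    also have "\<dots> < \<kappa> * (d + d)"
    proof -
      have "norm lb * norm (fderiv F x - fderiv F xb) \<le> (norm lb + 1) * (d / (norm lb + 1))"
        using W0(3)[of x] x by (intro mult_mono) auto
      also have "\<dots> = d"
      proof -
        have "norm lb + 1 \<noteq> 0" using norm_ge_zero[of lb] by linarith
        then show ?thesis by simp
      qed
      finally show ?thesis using v W(1) by (simp add: dist_norm)
    qed
    also have "\<dots> = e" using W(1) by (simp add: d_def)
    finally show ?thesis by (simp add: dist_norm)
  qed
  moreover have "open (W0 \<inter> W)" "xb \<in> W0 \<inter> W" "W0 \<inter> W \<subseteq> U" using W0 W by auto
  ultimately show thesis using that d by metis
qed

text \<open>The point \<open>xb + t *\<^sub>R h\<close> is corrected by \<open>H c\<close>, where
  \<open>c\<close> is a fixed point of the linearization error \<open>f\<close>. Then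
  \<open>F (xb + z c)\<close> equals \<open>t *\<^sub>R D xb h + (D xb (H c) - c)\<close>, a sum of
  two elements of \<open>N\<close>.\<close>

lemma normal_path:
  assumes h: "D xb h \<in> N" and e: "e > 0"
  shows "\<forall>\<^sub>F t in at_right 0. \<exists>x\<in>U. F x \<in> N \<and> norm (x - xb - t *\<^sub>R h) \<le> e * t"
proof -
  obtain H \<kappa> where H: "\<kappa> > 0" "continuous_on UNIV H" "\<And>c. norm (H c) \<le> \<kappa> * norm c"
    "\<And>c. D xb (H c) - c \<in> N"
    using qualification_selection by metis
  define s where "s = norm h + e"
  have s: "s > 0" using e by (simp add: s_def add_nonneg_pos)
  \<comment> \<open>Chosen so that the linearization error \<open>\<eta> * (s * t)\<close> equals
    the radius \<open>\<rho>\<close>, which makes \<open>f\<close> a self-map of the ball.\<close>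
  define \<eta> where "\<eta> = e / (\<kappa> * s)"
  have \<eta>: "\<eta> > 0" using e H(1) s by (simp add: \<eta>_def)
  obtain d1 where d1: "d1 > 0" "\<And>y. norm (y - xb) < d1 \<Longrightarrow> norm (F y - F xb - D xb (y - xb)) \<le> \<eta> * norm (y - xb)"
    using F_deriv[OF xb_U] \<eta> unfolding has_derivative_at_alt by metis
  obtain d2 where d2: "d2 > 0" "ball xb d2 \<subseteq> U" using open_U xb_U open_contains_ball by blast
  define T where "T = min d1 d2 / s"
  have T: "T > 0" using d1 d2 s by (simp add: T_def)
  have "\<exists>x\<in>U. F x \<in> N \<and> norm (x - xb - t *\<^sub>R h) \<le> e * t" if t: "0 < t" "t < T" for t
  proof -
    \<comment> \<open>On this ball the correction \<open>H c\<close> has norm at most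
      \<open>\<kappa> * \<rho> = e * t\<close>, the permitted deviation.\<close>
    define \<rho> where "\<rho> = e * t / \<kappa>"
    have \<rho>: "\<rho> > 0" using e t H(1) by (simp add: \<rho>_def)
    define z where "z c = t *\<^sub>R h + H c" for c :: 'b
    have Hc: "norm (H c) \<le> e * t" if "c \<in> cball 0 \<rho>" for c :: 'b
    proof -
      have "norm (H c) \<le> \<kappa> * norm c" by (rule H(3))
      also have "\<dots> \<le> \<kappa> * \<rho>" using that H(1) by (intro mult_left_mono) auto
      finally show ?thesis using H(1) by (simp add: \<rho>_def)
    qed
    have z: "norm (z c) \<le> s * t" if "c \<in> cball 0 \<rho>" for c :: 'b
    proof -
      have "norm (z c) \<le> norm (t *\<^sub>R h) + norm (H c)" unfolding z_def by (rule norm_triangle_ineq)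
      also have "\<dots> \<le> s * t" using Hc[OF that] t by (simp add: s_def algebra_simps)
      finally show ?thesis .
    qed
    have st: "s * t < min d1 d2" using t s by (simp add: T_def field_simps)
    have zU: "xb + z c \<in> U" if "c \<in> cball 0 \<rho>" for c :: 'b
      using z[OF that] st d2(2) by (auto simp: dist_norm subset_iff)
    define f where "f c = D xb (z c) - F (xb + z c)" for c :: 'b
    have "continuous_on (cball 0 \<rho>) H" using H(2) continuous_on_subset by blast
    then have zc: "continuous_on (cball 0 \<rho>) z" unfolding z_def by (intro continuous_intros)
    have fc: "continuous_on (cball 0 \<rho>) f"
      unfolding f_def using zU
      by (intro continuous_intros continuous_on_compose2[OF continuous_F] zc) auto
    have fm: "f \<in> cball 0 \<rho> \<rightarrow> cball 0 \<rho>"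
    proof
      fix c :: 'b assume c: "c \<in> cball 0 \<rho>"
      have "norm (F (xb + z c) - F xb - D xb (xb + z c - xb)) \<le> \<eta> * norm (xb + z c - xb)"
        using z[OF c] st by (intro d1(2)) simp
      then have "norm (f c) \<le> \<eta> * norm (z c)"
        by (simp add: f_def F_xb norm_minus_commute)
      also have "\<dots> \<le> \<eta> * (s * t)" using z[OF c] \<eta> by (intro mult_left_mono) auto
      also have "\<dots> = \<rho>" using s H(1) by (simp add: \<eta>_def \<rho>_def)
      finally show "f c \<in> cball 0 \<rho>" by simp
    qed
    obtain c where c: "c \<in> cball 0 \<rho>" "f c = c"
      using brouwer[of "cball 0 \<rho>" f] fc fm \<rho> by auto
    have "F (xb + z c) = t *\<^sub>R D xb h + (D xb (H c) - c)"
      using c(2) by (simp add: f_def z_def blinfun.add_right blinfun.scaleR_right algebra_simps)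
    also have "\<dots> \<in> N" using h t by (intro normal_cone_add normal_cone_scale H(4)) auto
    finally have "F (xb + z c) \<in> N" .
    then show ?thesis using zU[OF c(1)] Hc[OF c(1)]
      by (intro bexI[of _ "xb + z c"]) (auto simp: z_def)
  qed
  then show ?thesis unfolding eventually_at_right_field using T by auto
qed

end

subsection \<open>Strict derivatives and Moreau envelopes\<close>

text \<open>The mean value inequality for \<open>F - F' x\<close>, whose derivative is small on a
  ball around \<open>x\<close>. Both endpoints are free, as is required when base points
  move.\<close>

lemma strict_derivative:
  fixes F :: "'a::real_normed_vector \<Rightarrow> 'b::real_normed_vector"
  assumes "open U" "x \<in> U" and F': "\<And>y. y \<in> U \<Longrightarrow> (F has_derivative blinfun_apply (F' y)) (at y)"
    and "isCont F' x" and e: "e > 0"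
  obtains d where "d > 0" "ball x d \<subseteq> U"
    "\<And>y z. y \<in> ball x d \<Longrightarrow> z \<in> ball x d \<Longrightarrow> norm (F z - F y - F' x (z - y)) \<le> e * norm (z - y)"
proof -
  obtain d1 where d1: "d1 > 0" "\<And>y. dist y x < d1 \<Longrightarrow> dist (F' y) (F' x) < e"
    using assms(4) e unfolding continuous_at_eps_delta by metis
  obtain d2 where d2: "d2 > 0" "ball x d2 \<subseteq> U" using assms(1,2) open_contains_ball by blast
  define d where "d = min d1 d2"
  have dU: "ball x d \<subseteq> U" using d2 by (auto simp: d_def)
  have "norm (F z - F y - F' x (z - y)) \<le> e * norm (z - y)" if y: "y \<in> ball x d" and z: "z \<in> ball x d" for y z
  proof -
    have "norm ((F z - F' x z) - (F y - F' x y)) \<le> e * norm (z - y)"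
    proof (rule differentiable_bound[OF convex_ball _ _ z y])
      fix w assume w: "w \<in> ball x d"
      show "((\<lambda>w. F w - F' x w) has_derivative blinfun_apply (F' w - F' x)) (at w within ball x d)"
        unfolding blinfun.diff_left
      proof (rule has_derivative_diff)
        show "(F has_derivative F' w) (at w within ball x d)"
          using w dU by (intro has_derivative_at_withinI[OF F']) blast
      qed (rule bounded_linear_imp_has_derivative[OF blinfun.bounded_linear_right])
      show "onorm (blinfun_apply (F' w - F' x)) \<le> e"
        using d1(2)[of w] w by (auto simp: d_def dist_norm norm_blinfun.rep_eq[symmetric] norm_minus_commute[of x w])
    qed
    then show ?thesis by (simp add: blinfun.diff_right algebra_simps)
  qed
  then show thesis using that[of d] d1 d2 dU by (auto simp: d_def)
qed

text \<open>Completing the square turns \<open>q \<bullet> z - (norm q)\<^sup>2 / (2 * n)\<close>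
  into a constant minus \<open>(norm (q - n *\<^sub>R z))\<^sup>2 / (2 * n)\<close>, so the
  projection \<open>p\<close> maximizes it over \<open>Q\<close>. The additional term on the left
  expresses strong concavity.\<close>

lemma closest_point_moreau:
  fixes Q :: "'b::euclidean_space set"
  assumes Q: "closed Q" "convex Q" and n: "n > 0" and q: "q \<in> Q"
    and p: "p = closest_point Q (n *\<^sub>R z)"
  shows "q \<bullet> z - (norm q)\<^sup>2 / (2 * n) + (norm (q - p))\<^sup>2 / (2 * n) \<le> p \<bullet> z - (norm p)\<^sup>2 / (2 * n)"
proof -
  have "(n *\<^sub>R z - p) \<bullet> (q - p) \<le> 0"
    unfolding p using closest_point_dot[OF Q(2,1) q] by simp
  then have "n * (z \<bullet> q) - n * (z \<bullet> p) - p \<bullet> q + p \<bullet> p \<le> 0"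
    by (simp add: inner_diff_left inner_diff_right algebra_simps)
  moreover have "(norm (q - p))\<^sup>2 = (norm q)\<^sup>2 - 2 * (p \<bullet> q) + (norm p)\<^sup>2" "(norm p)\<^sup>2 = p \<bullet> p"
    unfolding power2_norm_eq_inner by (simp_all add: inner_diff_left inner_diff_right inner_commute)
  ultimately have "2 * n * (q \<bullet> z) - (norm q)\<^sup>2 + (norm (q - p))\<^sup>2 \<le> 2 * n * (p \<bullet> z) - (norm p)\<^sup>2"
    by (simp add: inner_commute)
  then have "(2 * n * (q \<bullet> z) - (norm q)\<^sup>2 + (norm (q - p))\<^sup>2) / (2 * n)
      \<le> (2 * n * (p \<bullet> z) - (norm p)\<^sup>2) / (2 * n)"
    using n by (intro divide_right_mono) auto
  then show ?thesis using n by (simp add: add_divide_distrib diff_divide_distrib)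
qed

text \<open>Young's inequality absorbs the cross term \<open>(q - p) \<bullet> (z' - z)\<close> into
  the strong concavity term. The supremum over \<open>q\<close> then reads as a quadratic upper
  model of the envelope with gradient \<open>p\<close>.\<close>

lemma closest_point_moreau_upper:
  fixes Q :: "'b::euclidean_space set"
  assumes Q: "closed Q" "convex Q" and n: "n > 0" and q: "q \<in> Q"
    and p: "p = closest_point Q (n *\<^sub>R z)"
  shows "q \<bullet> z' - (norm q)\<^sup>2 / (2 * n)
    \<le> p \<bullet> z - (norm p)\<^sup>2 / (2 * n) + p \<bullet> (z' - z) + n / 2 * (norm (z' - z))\<^sup>2"
proof -
  have "q \<bullet> z - (norm q)\<^sup>2 / (2 * n) + (norm (q - p))\<^sup>2 / (2 * n) \<le> p \<bullet> z - (norm p)\<^sup>2 / (2 * n)"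
    by (rule closest_point_moreau[OF assms])
  moreover have "(q - p) \<bullet> (z' - z) \<le> (norm (q - p))\<^sup>2 / (2 * n) + n / 2 * (norm (z' - z))\<^sup>2"
  proof -
    have "0 \<le> (norm ((q - p) - n *\<^sub>R (z' - z)))\<^sup>2" by simp
    also have "\<dots> = (norm (q - p))\<^sup>2 - 2 * n * ((q - p) \<bullet> (z' - z)) + n\<^sup>2 * (norm (z' - z))\<^sup>2"
      unfolding power2_norm_eq_inner
      by (simp add: inner_diff_left[of "q - p"] inner_diff_right[of _ "q - p"] inner_commute power2_eq_square)
    finally show ?thesis using n by (simp add: field_simps power2_eq_square)
  qed
  ultimately show ?thesis by (simp add: inner_diff_left inner_diff_right)
qed

context strict_decomposition
begin

lemma directional_derivative:
  assumes "x \<in> U"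
  shows "((\<lambda>t. (F (x + t *\<^sub>R h) - F x) /\<^sub>R t) \<longlongrightarrow> D x h) (at_right 0)"
proof -
  have "((\<lambda>t. F (x + t *\<^sub>R h)) has_derivative (\<lambda>t. D x (t *\<^sub>R h))) (at 0)"
    by (rule has_derivative_compose[of "\<lambda>t. x + t *\<^sub>R h"])
       (auto intro!: derivative_eq_intros F_deriv simp: assms)
  then have "((\<lambda>t. (F (x + t *\<^sub>R h) - F x - D x (t *\<^sub>R h)) /\<^sub>R norm t) \<longlongrightarrow> 0) (at 0)"
    by (simp add: has_derivative_at_within)
  then have "((\<lambda>t. (F (x + t *\<^sub>R h) - F x - D x (t *\<^sub>R h)) /\<^sub>R norm t) \<longlongrightarrow> 0) (at_right 0)"
    by (rule tendsto_within_subset) auto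
  moreover have "\<forall>\<^sub>F t in at_right 0. (F (x + t *\<^sub>R h) - F x - D x (t *\<^sub>R h)) /\<^sub>R norm t
      = (F (x + t *\<^sub>R h) - F x) /\<^sub>R t - D x h"
    using eventually_at_right_less
    by eventually_elim (simp add: blinfun.scaleR_right scaleR_diff_right)
  ultimately have "((\<lambda>t. (F (x + t *\<^sub>R h) - F x) /\<^sub>R t - D x h) \<longlongrightarrow> 0) (at_right 0)"
    by (rule Lim_transform_eventually)
  then show ?thesis by (simp add: LIM_zero_cancel)
qed

text \<open>The linear term sits at the moving point \<open>y\<close>, where it reproduces the
  subgradient exactly, while the quadratic term is frozen at \<open>xb\<close>. This mixture is
  legitimate because \<open>fderiv F\<close> is strictly differentiable at \<open>xb\<close>; the
  mean value inequality along the segment integrates that estimate.\<close>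

lemma second_order_expansion:
  assumes e: "e > 0"
  obtains d where "d > 0" "ball xb d \<subseteq> U"
    "\<And>y z. y \<in> ball xb d \<Longrightarrow> z \<in> ball xb d \<Longrightarrow>
      norm (F z - F y - D y (z - y) - (1 / 2) *\<^sub>R D2 F xb (z - y) (z - y)) \<le> e * (norm (z - y))\<^sup>2"
proof -
  have "isCont (fderiv (fderiv F)) xb"
    using C2 open_U xb_U by (simp add: C2_on_def continuous_on_eq_continuous_at)
  then obtain d where d: "d > 0" "ball xb d \<subseteq> U" "\<And>y z. y \<in> ball xb d \<Longrightarrow> z \<in> ball xb d \<Longrightarrow>
      norm (fderiv F z - fderiv F y - fderiv (fderiv F) xb (z - y)) \<le> e * norm (z - y)"
    using strict_derivative[OF open_U xb_U fderiv_deriv _ e] by metis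
  have "norm (F z - F y - D y (z - y) - (1 / 2) *\<^sub>R D2 F xb (z - y) (z - y)) \<le> e * (norm (z - y))\<^sup>2"
    if y: "y \<in> ball xb d" and z: "z \<in> ball xb d" for y z
  proof -
    define k where "k = z - y"
    define g where "g s = F (y + s *\<^sub>R k) - s *\<^sub>R D y k - (s\<^sup>2 / 2) *\<^sub>R D2 F xb k k" for s
    have seg: "y + s *\<^sub>R k \<in> ball xb d" if "s \<in> {0..1}" for s
    proof -
      have "(1 - s) *\<^sub>R y + s *\<^sub>R z \<in> ball xb d"
        using that by (intro convexD_alt[OF convex_ball y z]) auto
      then show ?thesis by (simp add: k_def algebra_simps)
    qed
    have "norm (g 1 - g 0) \<le> e * (norm k)\<^sup>2 * norm (1 - 0 :: real)"
    proof (rule differentiable_bound[of "{0..1}" g "\<lambda>s t. t *\<^sub>R (D (y + s *\<^sub>R k) k - D y k - s *\<^sub>R D2 F xb k k)"])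
      fix s :: real assume s: "s \<in> {0..1}"
      have 1: "((\<lambda>s. F (y + s *\<^sub>R k)) has_derivative (\<lambda>t. D (y + s *\<^sub>R k) (t *\<^sub>R k))) (at s within {0..1})"
        using seg[OF s] d(2)
        by (intro has_derivative_compose[of "\<lambda>s. y + s *\<^sub>R k" _ _ _ F "D (y + s *\<^sub>R k)"] F_deriv)
           (auto intro!: derivative_eq_intros)
      show "(g has_derivative (\<lambda>t. t *\<^sub>R (D (y + s *\<^sub>R k) k - D y k - s *\<^sub>R D2 F xb k k))) (at s within {0..1})"
        unfolding g_def
        by (rule has_derivative_eq_rhs, (rule has_derivative_diff 1)+)
           (auto intro!: derivative_eq_intros simp: fun_eq_iff blinfun.scaleR_right algebra_simps)
      have "D (y + s *\<^sub>R k) k - D y k - s *\<^sub>R D2 F xb k k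
        = (fderiv F (y + s *\<^sub>R k) - fderiv F y - fderiv (fderiv F) xb ((y + s *\<^sub>R k) - y)) k"
        by (simp add: blinfun.diff_left blinfun.scaleR_right blinfun.scaleR_left D2_def)
      also have "norm \<dots> \<le> (e * norm ((y + s *\<^sub>R k) - y)) * norm k"
        by (rule order_trans[OF norm_blinfun]) (intro mult_right_mono d(3) y seg s, simp)
      also have "\<dots> \<le> e * norm k * norm k"
        using s e by (intro mult_right_mono mult_left_mono) (auto simp: mult_left_le_one_le)
      finally have "norm (D (y + s *\<^sub>R k) k - D y k - s *\<^sub>R D2 F xb k k) \<le> e * (norm k)\<^sup>2"
        by (simp add: power2_eq_square)
      then show "onorm (\<lambda>t::real. t *\<^sub>R (D (y + s *\<^sub>R k) k - D y k - s *\<^sub>R D2 F xb k k)) \<le> e * (norm k)\<^sup>2"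
        by (intro onorm_le) (simp add: mult.commute mult_left_mono)
    qed auto
    then show ?thesis by (simp add: g_def k_def algebra_simps)
  qed
  then show thesis using that d by metis
qed

text \<open>The estimate of \<open>multiplier_bound\<close> as a predicate, so that the constant and
  the neighbourhood can be passed on together.\<close>

definition multiplier_bounded :: "real \<Rightarrow> 'a set \<Rightarrow> bool" where
  "multiplier_bounded \<kappa> W \<longleftrightarrow> (\<forall>x v l e. x \<in> W \<longrightarrow> l \<in> Q \<longrightarrow>
      (\<forall>h. \<bar>v \<bullet> h - l \<bullet> D x h\<bar> \<le> e * norm h) \<longrightarrow>
      norm (l - lb) \<le> \<kappa> * (e + norm (v - vb) + norm lb * norm (fderiv F x - fderiv F xb)))"

text \<open>The bound confines the \<open>L k\<close> to a ball, a subsequence converges, and all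
  conditions on a multiplier are closed. The errors \<open>S\<close> and \<open>E\<close> let one
  statement serve approximate as well as exact multipliers.\<close>

lemma multiplier_limit:
  assumes W: "multiplier_bounded \<kappa> W" "W \<subseteq> U" "x \<in> W" "\<And>k::nat. X k \<in> W"
    and X: "X \<longlonglongrightarrow> x" and V: "V \<longlonglongrightarrow> v" and S: "S \<longlonglongrightarrow> 0" and E: "E \<longlonglongrightarrow> 0"
    and L: "\<And>k. L k \<in> Q" "\<And>k. F (X k) - S k \<in> normal_cone Q (L k)"
      "\<And>k h. \<bar>V k \<bullet> h - L k \<bullet> D (X k) h\<bar> \<le> E k * norm h"
  shows "\<exists>l. multiplier x v l"
proof -
  have xU: "x \<in> U" using W by auto
  have dX: "(\<lambda>k. fderiv F (X k)) \<longlonglongrightarrow> fderiv F x"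
    using isCont_tendsto_compose[OF isCont_fderiv[OF xU] X] .
  have FX: "(\<lambda>k. F (X k)) \<longlonglongrightarrow> F x"
    using isCont_tendsto_compose[OF isCont_F[OF xU] X] .
  let ?B = "\<lambda>k. \<kappa> * (E k + norm (V k - vb) + norm lb * norm (fderiv F (X k) - fderiv F xb))"
  have "convergent ?B"
    unfolding convergent_def
    by (rule exI[of _ "\<kappa> * (0 + norm (v - vb) + norm lb * norm (fderiv F x - fderiv F xb))"])
       (intro tendsto_intros E V dX)
  from convergent_imp_Bseq[OF this] obtain C where C: "\<And>k. norm (?B k) \<le> C"
    unfolding Bseq_def by blast
  have "L k \<in> cball lb C" for k
  proof -
    have "norm (L k - lb) \<le> ?B k"
      using W(1)[unfolded multiplier_bounded_def, rule_format, OF W(4) L(1,3)] .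
    then show ?thesis using C[of k] by (simp add: dist_norm norm_minus_commute)
  qed
  then obtain l r where r: "strict_mono r" "(L \<circ> r) \<longlonglongrightarrow> l"
    using compact_cball[of lb C, unfolded compact_def, rule_format, of L] by auto
  have l: "l \<in> Q"
    using closed_sequentially[OF closed_Q _ r(2)] L(1) by simp
  note sub = LIMSEQ_subseq_LIMSEQ[OF _ r(1), unfolded o_def]
  have "F x \<bullet> (q - l) \<le> 0" if q: "q \<in> Q" for q
  proof (rule LIMSEQ_le_const2)
    show "(\<lambda>k. (F (X (r k)) - S (r k)) \<bullet> (q - L (r k))) \<longlonglongrightarrow> F x \<bullet> (q - l)"
    proof -
      have "(\<lambda>k. (F (X (r k)) - S (r k)) \<bullet> (q - L (r k))) \<longlonglongrightarrow> (F x - 0) \<bullet> (q - l)"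
        by (intro tendsto_intros sub[OF FX] sub[OF S] r(2)[unfolded o_def])
      then show ?thesis by simp
    qed
    show "\<exists>n. \<forall>k\<ge>n. (F (X (r k)) - S (r k)) \<bullet> (q - L (r k)) \<le> 0"
      using normal_cone_le[OF L(2) q] by blast
  qed
  then have "F x \<in> normal_cone Q l" using l by (simp add: normal_cone_def)
  moreover have "v \<bullet> h = l \<bullet> D x h" for h
  proof -
    have "\<bar>v \<bullet> h - l \<bullet> D x h\<bar> \<le> 0 * norm h"
    proof (rule LIMSEQ_le)
      show "(\<lambda>k. \<bar>V (r k) \<bullet> h - L (r k) \<bullet> D (X (r k)) h\<bar>) \<longlonglongrightarrow> \<bar>v \<bullet> h - l \<bullet> D x h\<bar>"
        by (intro tendsto_intros sub[OF V] r(2)[unfolded o_def] sub[OF dX] blinfun.tendsto)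
      show "(\<lambda>k. E (r k) * norm h) \<longlonglongrightarrow> 0 * norm h"
        by (intro tendsto_intros sub[OF E])
    qed (use L(3) in blast)
    then show ?thesis by simp
  qed
  ultimately show ?thesis using l unfolding multiplier_def by blast
qed

end

subsection \<open>The subdifferential chain rule\<close>

context strict_decomposition
begin

text \<open>Approximate multipliers come from the Moreau envelopes
  \<open>e\<^sub>n z = (\<Squnion>q\<in>Q. q \<bullet> z - (norm q)\<^sup>2 / (2 * n))\<close> of the support function: these are smooth from
  above with gradient \<open>closest_point Q (n *\<^sub>R z)\<close> and increase to the support function.\<close>

lemma approximate_multiplier:
  assumes W: "multiplier_bounded \<kappa> W" "W \<subseteq> U" "open W" "x \<in> W"
    and v: "v \<in> regular_subdiff \<phi> x" and e: "e > 0"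
  shows "\<exists>y\<in>W. \<exists>l\<in>Q. \<exists>s. dist y x < e \<and> norm s < e \<and> F y - s \<in> normal_cone Q l \<and>
    (\<forall>h. \<bar>v \<bullet> h - l \<bullet> D y h\<bar> \<le> e * norm h)"
proof -
  have xU: "x \<in> U" using W by auto
  have Q0: "Q \<noteq> {}" using lb_Q by auto
  have fin: "\<bar>\<phi> x\<bar> \<noteq> \<infinity>" using v by (simp add: regular_subdiff_def)
  have "e / 2 > 0" using e by simp
  then obtain d1 where d1: "d1 > 0"
    "\<And>y. dist y x < d1 \<Longrightarrow> \<phi> x + ereal (v \<bullet> (y - x) - e / 2 * norm (y - x)) \<le> \<phi> y"
    using v[unfolded regular_subdiff_iff] by meson
  obtain d2 where d2: "d2 > 0" "ball x d2 \<subseteq> W" using W open_contains_ball by blast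
  define d where "d = min d1 d2 / 2"
  have d: "d > 0" "d < d1" "d < d2" using d1 d2 by (auto simp: d_def)
  have BW: "cball x d \<subseteq> W" using d d2(2) by auto
  obtain s0 where s0: "support_fun Q (F x) = ereal s0"
    using fin phi_finite phi_eq[OF xU] by (cases "support_fun Q (F x)"; cases "\<phi> xb") auto
  have growth: "ereal (s0 + v \<bullet> (y - x) - e / 2 * norm (y - x)) \<le> support_fun Q (F y)"
    if "y \<in> cball x d" for y
  proof -
    have "\<phi> x + ereal (v \<bullet> (y - x) - e / 2 * norm (y - x)) \<le> \<phi> y"
      using that d by (intro d1(2)) (auto simp: dist_commute)
    moreover have "y \<in> U" using that BW W by auto
    ultimately show ?thesis
      using phi_finite by (cases "\<phi> xb"; cases "support_fun Q (F y)") (auto simp: phi_eq xU s0 algebra_simps)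
  qed
  define n where "n k = real (Suc k)" for k
  have n: "n k > 0" for k by (simp add: n_def)
  define p where "p k y = closest_point Q (n k *\<^sub>R F y)" for k y
  have pQ: "p k y \<in> Q" for k y
    unfolding p_def by (rule closest_point_in_set[OF closed_Q Q0])
  define g where "g k y = p k y \<bullet> F y - (norm (p k y))\<^sup>2 / (2 * n k)" for k y
  \<comment> \<open>The penalty \<open>e * norm (y - x)\<close> is twice the slack in
    \<open>growth\<close>. This strict excess forces the minimizers of \<open>G k\<close> to cluster
    at \<open>x\<close>.\<close>
  define G where "G k y = g k y - v \<bullet> (y - x) + e * norm (y - x)" for k y
  have cF: "continuous_on (cball x d) F"
    using continuous_F BW W by (meson continuous_on_subset order_trans)
  have cp: "continuous_on (cball x d) (p k)" for k
    unfolding p_def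
    by (rule continuous_on_compose2[OF continuous_on_closest_point[OF convex_Q closed_Q Q0, of UNIV]])
       (auto intro!: continuous_intros cF)
  have cG: "continuous_on (cball x d) (G k)" for k
    unfolding G_def g_def by (intro continuous_intros cp cF) (use n[of k] in auto)
  have "\<exists>y\<in>cball x d. \<forall>z\<in>cball x d. G k y \<le> G k z" for k
    by (rule continuous_attains_inf[OF compact_cball _ cG]) (use d in auto)
  then obtain Y where Y: "\<And>k. Y k \<in> cball x d" "\<And>k z. z \<in> cball x d \<Longrightarrow> G k (Y k) \<le> G k z"
    by metis
  have gle: "q \<bullet> F y - (norm q)\<^sup>2 / (2 * n k) \<le> g k y" if "q \<in> Q" for q k y
  proof -
    have "0 \<le> (norm (q - p k y))\<^sup>2 / (2 * n k)" using n[of k] by simp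
    then show ?thesis
      using closest_point_moreau[OF closed_Q convex_Q n that p_def[of k y]] unfolding g_def by linarith
  qed
  have gx: "g k x \<le> s0" for k
  proof -
    have "g k x \<le> p k x \<bullet> F x" unfolding g_def using n[of k] by simp
    also have "\<dots> \<le> s0" using support_fun_ge[OF pQ[of k x], of "F x"] s0 by simp
    finally show ?thesis .
  qed
  have GY: "G k (Y k) \<le> s0" for k
    using Y(2)[of x k] gx[of k] d by (simp add: G_def)
  obtain y r where y: "y \<in> cball x d" "strict_mono r" "(Y \<circ> r) \<longlonglongrightarrow> y"
    using compact_cball[of x d, unfolded compact_def, rule_format, of Y] Y(1) by auto
  have yr: "(\<lambda>k. Y (r k)) \<longlonglongrightarrow> y" using y(3) by (simp add: o_def)
  have FY: "(\<lambda>k. F (Y (r k))) \<longlonglongrightarrow> F y"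
    by (rule isCont_tendsto_compose[OF isCont_F yr]) (use y(1) BW W in blast)
  have inv_n: "(\<lambda>k. inverse (n (r k))) \<longlonglongrightarrow> 0"
    using LIMSEQ_subseq_LIMSEQ[OF LIMSEQ_inverse_real_of_nat y(2)] by (simp add: n_def o_def)
  have lim: "q \<bullet> F y - v \<bullet> (y - x) + e * norm (y - x) \<le> s0" if q: "q \<in> Q" for q
  proof (rule LIMSEQ_le_const2)
    have "(\<lambda>k. q \<bullet> F (Y (r k)) - (norm q)\<^sup>2 / 2 * inverse (n (r k)) - v \<bullet> (Y (r k) - x) + e * norm (Y (r k) - x))
      \<longlonglongrightarrow> q \<bullet> F y - (norm q)\<^sup>2 / 2 * 0 - v \<bullet> (y - x) + e * norm (y - x)"
      by (intro tendsto_intros FY yr inv_n)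
    then show "(\<lambda>k. q \<bullet> F (Y (r k)) - (norm q)\<^sup>2 / 2 * inverse (n (r k)) - v \<bullet> (Y (r k) - x) + e * norm (Y (r k) - x))
      \<longlonglongrightarrow> q \<bullet> F y - v \<bullet> (y - x) + e * norm (y - x)" by simp
    have "q \<bullet> F (Y (r k)) - (norm q)\<^sup>2 / 2 * inverse (n (r k)) - v \<bullet> (Y (r k) - x) + e * norm (Y (r k) - x) \<le> s0" for k
    proof -
      have "(norm q)\<^sup>2 / 2 * inverse (n (r k)) = (norm q)\<^sup>2 / (2 * n (r k))"
        using n[of "r k"] by (simp add: field_simps)
      then show ?thesis
        using gle[OF q, where y = "Y (r k)" and k = "r k"] GY[of "r k"] unfolding G_def by linarith
    qed
    then show "\<exists>N. \<forall>k\<ge>N. q \<bullet> F (Y (r k)) - (norm q)\<^sup>2 / 2 * inverse (n (r k)) - v \<bullet> (Y (r k) - x) + e * norm (Y (r k) - x) \<le> s0"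
      by blast
  qed
  \<comment> \<open>The limit in \<open>k\<close> was taken for a fixed \<open>q\<close>; only now
    comes the supremum over \<open>q\<close>, which recovers the support function from its
    envelopes.\<close>
  have "support_fun Q (F y) \<le> ereal (s0 + v \<bullet> (y - x) - e * norm (y - x))"
    unfolding support_fun_def using lim by (intro SUP_least) (fastforce simp: algebra_simps)
  with growth[OF y(1)] have "ereal (s0 + v \<bullet> (y - x) - e / 2 * norm (y - x)) \<le> ereal (s0 + v \<bullet> (y - x) - e * norm (y - x))"
    by (rule order_trans)
  then have "e * norm (y - x) \<le> 0" by simp
  then have yx: "y = x" using e by (simp add: mult_le_0_iff)
  \<comment> \<open>First-order optimality at an interior minimizer. The envelope is replaced by its
    quadratic upper model, whose second-order part vanishes after division by \<open>t\<close> since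
    \<open>k\<close> is fixed.\<close>
  have opt1: "v \<bullet> h - p k (Y k) \<bullet> D (Y k) h \<le> e * norm h" if int: "dist (Y k) x < d" for k h
  proof -
    let ?z = "Y k" and ?l = "p k (Y k)"
    have zU: "?z \<in> U" using Y(1) BW W by blast
    define q where "q t = (F (?z + t *\<^sub>R h) - F ?z) /\<^sub>R t" for t
    have q: "(q \<longlongrightarrow> D ?z h) (at_right 0)"
      unfolding q_def by (rule directional_derivative[OF zU])
    have "((\<lambda>t. ?l \<bullet> q t + n k / 2 * t * (norm (q t))\<^sup>2 + e * norm h) \<longlongrightarrow>
        ?l \<bullet> D ?z h + n k / 2 * 0 * (norm (D ?z h))\<^sup>2 + e * norm h) (at_right 0)"
      by (intro tendsto_intros q)
    moreover have "\<forall>\<^sub>F t in at_right 0. v \<bullet> h \<le> ?l \<bullet> q t + n k / 2 * t * (norm (q t))\<^sup>2 + e * norm h"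
    proof -
      have "((\<lambda>t. ?z + t *\<^sub>R h) \<longlongrightarrow> ?z + 0 *\<^sub>R h) (at_right 0)" by (intro tendsto_intros)
      then have "\<forall>\<^sub>F t in at_right 0. ?z + t *\<^sub>R h \<in> ball x d"
        using int by (intro topological_tendstoD) (auto simp: dist_commute)
      moreover have "\<forall>\<^sub>F t in at_right 0. (0::real) < t" by (rule eventually_at_right_less)
      ultimately show ?thesis
      proof eventually_elim
        case (elim t)
        let ?w = "?z + t *\<^sub>R h"
        have "G k ?z \<le> G k ?w" using elim by (intro Y(2)) auto
        moreover have "g k ?w \<le> g k ?z + ?l \<bullet> (F ?w - F ?z) + n k / 2 * (norm (F ?w - F ?z))\<^sup>2"
          using closest_point_moreau_upper[OF closed_Q convex_Q n pQ[of k ?w] p_def[of k ?z], of "F ?w"]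
          by (simp add: g_def)
        moreover have "norm (?w - x) \<le> norm (?z - x) + t * norm h"
        proof -
          have "norm ((?z - x) + t *\<^sub>R h) \<le> norm (?z - x) + norm (t *\<^sub>R h)" by (rule norm_triangle_ineq)
          then show ?thesis using elim by (simp add: algebra_simps)
        qed
        then have "e * norm (?w - x) \<le> e * norm (?z - x) + t * (e * norm h)"
          using e by (metis distrib_left mult.left_commute mult_left_mono less_imp_le)
        moreover have "v \<bullet> (?w - x) = v \<bullet> (?z - x) + t * (v \<bullet> h)"
          by (simp add: inner_diff_right inner_add_right)
        moreover have "F ?w - F ?z = t *\<^sub>R q t" using elim by (simp add: q_def)
        ultimately have "t * (v \<bullet> h) \<le> ?l \<bullet> (t *\<^sub>R q t) + n k / 2 * (norm (t *\<^sub>R q t))\<^sup>2 + t * (e * norm h)"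
          unfolding G_def by simp
        then have "t * (v \<bullet> h) \<le> t * (?l \<bullet> q t + n k / 2 * t * (norm (q t))\<^sup>2 + e * norm h)"
          using elim by (simp add: power2_eq_square algebra_simps)
        then show ?case using elim by simp
      qed
    qed
    ultimately have "v \<bullet> h \<le> ?l \<bullet> D ?z h + n k / 2 * 0 * (norm (D ?z h))\<^sup>2 + e * norm h"
      by (intro tendsto_lowerbound) auto
    then show ?thesis by simp
  qed
  have opt: "\<bar>v \<bullet> h - p k (Y k) \<bullet> D (Y k) h\<bar> \<le> e * norm h" if int: "dist (Y k) x < d" for k h
    using opt1[OF int, of h] opt1[OF int, of "- h"] by (simp add: blinfun.minus_right abs_le_iff)
  let ?B = "\<lambda>k. \<kappa> * (e + norm (v - vb) + norm lb * norm (fderiv F (Y (r k)) - fderiv F xb))"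
  \<comment> \<open>The projection \<open>l\<close> is a subgradient of the support function at
    \<open>F y - l /\<^sub>R n k\<close> and not at \<open>F y\<close>. The multiplier bound keeps
    \<open>l\<close> bounded, so this shift tends to zero.\<close>
  have "(\<lambda>k. (norm lb + ?B k) * inverse (n (r k))) \<longlonglongrightarrow>
      (norm lb + \<kappa> * (e + norm (v - vb) + norm lb * norm (fderiv F x - fderiv F xb))) * 0"
    using isCont_tendsto_compose[OF isCont_fderiv[OF xU] yr[unfolded yx]]
    by (intro tendsto_intros inv_n)
  then have "\<forall>\<^sub>F k in sequentially. (norm lb + ?B k) * inverse (n (r k)) < e"
    using e by (intro order_tendstoD) auto
  moreover have "\<forall>\<^sub>F k in sequentially. dist (Y (r k)) x < min d e"
    using yr[unfolded yx] d e by (intro tendstoD) auto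
  ultimately have "\<forall>\<^sub>F k in sequentially. (norm lb + ?B k) * inverse (n (r k)) < e \<and> dist (Y (r k)) x < min d e"
    by (rule eventually_conj)
  then obtain k where k: "(norm lb + ?B k) * inverse (n (r k)) < e" "dist (Y (r k)) x < min d e"
    unfolding eventually_sequentially by blast
  let ?y = "Y (r k)"
  define l where "l = p (r k) ?y"
  have yW: "?y \<in> W" using Y(1) BW by blast
  have lQ: "l \<in> Q" unfolding l_def by (rule pQ)
  have lo: "\<And>h. \<bar>v \<bullet> h - l \<bullet> D ?y h\<bar> \<le> e * norm h" using opt k(2) by (simp add: l_def)
  have "norm (l - lb) \<le> ?B k"
    by (rule W(1)[unfolded multiplier_bounded_def, rule_format, OF yW lQ lo])
  then have "norm l \<le> norm lb + ?B k" using norm_triangle_sub[of l lb] by linarith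
  then have "norm l * inverse (n (r k)) \<le> (norm lb + ?B k) * inverse (n (r k))"
    using n[of "r k"] by (intro mult_right_mono) auto
  then have "norm l * inverse (n (r k)) < e" using k(1) by linarith
  then have s: "norm (l /\<^sub>R n (r k)) < e"
    using n[of "r k"] by (simp add: mult.commute[of "norm l"])
  have "F ?y - l /\<^sub>R n (r k) \<in> normal_cone Q l"
  proof -
    have "(n (r k) *\<^sub>R F ?y - l) \<in> normal_cone Q l"
      using closest_point_dot[OF convex_Q closed_Q] lQ by (auto simp: normal_cone_def l_def p_def)
    then have "inverse (n (r k)) *\<^sub>R (n (r k) *\<^sub>R F ?y - l) \<in> normal_cone Q l"
      using n[of "r k"] by (intro normal_cone_scale) auto
    then show ?thesis using n[of "r k"] by (simp add: scaleR_diff_right)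
  qed
  moreover have "dist ?y x < e" using k(2) by simp
  ultimately show ?thesis using yW lQ s lo by blast
qed

lemma multiplier_imp_regular:
  assumes x: "x \<in> U" and m: "multiplier x v l"
  shows "v \<in> regular_subdiff \<phi> x"
  unfolding regular_subdiff_iff
proof (intro conjI allI impI)
  show "\<bar>\<phi> x\<bar> \<noteq> \<infinity>" by (rule phi_finite_multiplier[OF x m])
  fix e :: real assume e: "e > 0"
  define e' where "e' = e / (norm l + 1)"
  have l1: "norm l + 1 > 0" using norm_ge_zero[of l] by linarith
  have e': "e' > 0" using e l1 by (simp add: e'_def)
  obtain d1 where d1: "d1 > 0" "\<And>y. norm (y - x) < d1 \<Longrightarrow> norm (F y - F x - D x (y - x)) \<le> e' * norm (y - x)"
    using F_deriv[OF x] e' unfolding has_derivative_at_alt by metis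
  obtain d2 where d2: "d2 > 0" "ball x d2 \<subseteq> U" using x open_U open_contains_ball by blast
  show "\<exists>d>0. \<forall>y. dist y x < d \<longrightarrow> \<phi> x + ereal (v \<bullet> (y - x) - e * norm (y - x)) \<le> \<phi> y"
  proof (intro exI[of _ "min d1 d2"] conjI allI impI)
    fix y assume y: "dist y x < min d1 d2"
    have yU: "y \<in> U" using y d2 by (auto simp: dist_commute)
    have "\<bar>l \<bullet> (F y - F x - D x (y - x))\<bar> \<le> norm l * (e' * norm (y - x))"
      using y by (intro order_trans[OF Cauchy_Schwarz_ineq2] mult_left_mono d1(2)) (auto simp: dist_norm)
    also have "\<dots> \<le> (norm l + 1) * (e' * norm (y - x))" using e' by (intro mult_right_mono) auto
    also have "\<dots> = e * norm (y - x)" using l1 by (simp add: e'_def)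
    finally have "v \<bullet> (y - x) - e * norm (y - x) \<le> l \<bullet> F y - l \<bullet> F x"
      using m by (simp add: multiplier_def inner_diff_right[of l] abs_le_iff)
    then have "\<phi> x + ereal (v \<bullet> (y - x) - e * norm (y - x)) \<le> \<phi> x + ereal (l \<bullet> F y - l \<bullet> F x)"
      by (intro add_left_mono) simp
    also have "\<dots> \<le> \<phi> y" using m by (intro phi_lower[OF x yU m]) (simp add: multiplier_def)
    finally show "\<phi> x + ereal (v \<bullet> (y - x) - e * norm (y - x)) \<le> \<phi> y" .
  qed (use d1 d2 in auto)
qed

text \<open>Two limits: approximate multipliers with errors \<open>inverse (real (Suc k))\<close>
  become exact ones at regular subgradients, and exact ones survive along the sequences that define
  limiting subgradients. Since vectors with a multiplier are regular subgradients, both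
  subdifferentials coincide near \<open>xb\<close>.\<close>

lemma subdifferential_chain_rule:
  obtains W where "open W" "xb \<in> W" "W \<subseteq> U"
    "\<And>x v. x \<in> W \<Longrightarrow> v \<in> limiting_subdiff \<phi> x \<longleftrightarrow> (\<exists>l. multiplier x v l)"
proof -
  obtain \<kappa> W where W: "open W" "xb \<in> W" "W \<subseteq> U" "multiplier_bounded \<kappa> W"
    using multiplier_bound unfolding multiplier_bounded_def by metis
  have regular: "\<exists>l. multiplier x v l" if x: "x \<in> W" and v: "v \<in> regular_subdiff \<phi> x" for x v
  proof -
    have "\<forall>k. \<exists>y\<in>W. \<exists>l\<in>Q. \<exists>s. dist y x < inverse (real (Suc k)) \<and> norm s < inverse (real (Suc k)) \<and>
       F y - s \<in> normal_cone Q l \<and> (\<forall>h. \<bar>v \<bullet> h - l \<bullet> D y h\<bar> \<le> inverse (real (Suc k)) * norm h)"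
      by (intro allI approximate_multiplier[OF W(4,3,1) x v]) simp
    then obtain Y L S where Y: "\<And>k. Y k \<in> W" "\<And>k. L k \<in> Q"
      "\<And>k. dist (Y k) x < inverse (real (Suc k))" "\<And>k. norm (S k) < inverse (real (Suc k))"
      "\<And>k. F (Y k) - S k \<in> normal_cone Q (L k)"
      "\<And>k h. \<bar>v \<bullet> h - L k \<bullet> D (Y k) h\<bar> \<le> inverse (real (Suc k)) * norm h"
      by metis
    have "Y \<longlonglongrightarrow> x"
      using Y(3) by (intro metric_tendsto_imp_tendsto[OF LIMSEQ_inverse_real_of_nat])
        (auto intro!: always_eventually simp: less_imp_le)
    moreover have "S \<longlonglongrightarrow> 0"
      using Y(4) by (intro metric_tendsto_imp_tendsto[OF LIMSEQ_inverse_real_of_nat])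
        (auto intro!: always_eventually simp: less_imp_le)
    ultimately show ?thesis
      using multiplier_limit[OF W(4,3) x Y(1) _ tendsto_const _ LIMSEQ_inverse_real_of_nat Y(2,5,6)] by blast
  qed
  have "v \<in> limiting_subdiff \<phi> x \<longleftrightarrow> (\<exists>l. multiplier x v l)" if x: "x \<in> W" for x v
  proof
    assume "\<exists>l. multiplier x v l"
    then show "v \<in> limiting_subdiff \<phi> x"
      using x W(3) by (auto intro!: regular_imp_limiting multiplier_imp_regular)
  next
    assume "v \<in> limiting_subdiff \<phi> x"
    then obtain X V where X: "X \<longlonglongrightarrow> x" "\<And>k. V k \<in> regular_subdiff \<phi> (X k)" "V \<longlonglongrightarrow> v"
      unfolding limiting_subdiff_def by auto
    have "\<forall>\<^sub>F k in sequentially. X k \<in> W" using X(1) W(1) x by (rule topological_tendstoD)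
    then obtain k0 where k0: "\<And>k. X (k + k0) \<in> W"
      unfolding eventually_sequentially by (metis le_add2)
    have "\<exists>l. multiplier (X (k + k0)) (V (k + k0)) l" for k
      by (rule regular[OF k0 X(2)])
    then obtain L where L: "\<And>k. multiplier (X (k + k0)) (V (k + k0)) (L k)" by metis
    show "\<exists>l. multiplier x v l"
    proof (rule multiplier_limit[OF W(4,3) x k0])
      show "(\<lambda>k. X (k + k0)) \<longlonglongrightarrow> x" "(\<lambda>k. V (k + k0)) \<longlonglongrightarrow> v"
        by (rule LIMSEQ_ignore_initial_segment, rule X)+
      show "(\<lambda>_. 0) \<longlonglongrightarrow> (0::'b)" "(\<lambda>_. 0) \<longlonglongrightarrow> (0::real)" by (rule tendsto_const)+
    qed (use L in \<open>auto simp: multiplier_def\<close>)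
  qed
  then show thesis using that W by metis
qed

end

subsection \<open>The critical cone and its affine hull\<close>

lemma tangent_cone_inner_le:
  assumes "w \<in> tangent_cone Q l" "n \<in> normal_cone Q l"
  shows "n \<bullet> w \<le> 0"
proof -
  obtain T W where T: "\<And>k::nat. T k > (0::real)" "W \<longlonglongrightarrow> w" "\<And>k. l + T k *\<^sub>R W k \<in> Q"
    using assms(1) unfolding tangent_cone_def by auto
  have "n \<bullet> W k \<le> 0" for k
  proof -
    have "T k * (n \<bullet> W k) \<le> 0" using normal_cone_le[OF assms(2) T(3)[of k]] by simp
    then show ?thesis using T(1)[of k] by (simp add: mult_le_0_iff)
  qed
  then show ?thesis
    by (intro LIMSEQ_le_const2[OF tendsto_inner[OF tendsto_const T(2)]]) auto
qed

lemma lineality_inner_eq_0: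
  assumes "w \<in> lineality (tangent_cone Q l)" "n \<in> normal_cone Q l"
  shows "w \<bullet> n = 0"
proof -
  have "w \<in> tangent_cone Q l" "- w \<in> tangent_cone Q l"
    using assms(1) by (auto simp: lineality_def)
  from this[THEN tangent_cone_inner_le[OF _ assms(2)]]
  show ?thesis by (simp add: inner_commute)
qed

text \<open>A bipolar argument: if \<open>z\<close> were outside the closure of the cone generated
  by \<open>Q - l\<close>, the negative of a separating functional would be a normal with positive
  value at \<open>z\<close>. Elements of the cone are then scaled back into \<open>Q\<close> by
  convexity.\<close>

lemma polar_normal_cone_subset_tangent_cone:
  fixes Q :: "'b::euclidean_space set"
  assumes Q: "convex Q" "l \<in> Q" and z: "\<And>n. n \<in> normal_cone Q l \<Longrightarrow> z \<bullet> n \<le> 0"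
  shows "z \<in> tangent_cone Q l"
proof -
  define K where "K = cone hull ((\<lambda>q. q - l) ` Q)"
  have K: "K = {c *\<^sub>R (q - l) | c q. 0 \<le> c \<and> q \<in> Q}"
    unfolding K_def cone_hull_expl by auto
  have convK: "convex K" unfolding K_def by (intro convex_cone_hull convex_translation_subtract Q)
  have zK: "z \<in> closure K"
  proof (rule ccontr)
    assume "z \<notin> closure K"
    then obtain a b where ab: "a \<bullet> z < b" "\<And>x. x \<in> closure K \<Longrightarrow> b < a \<bullet> x"
      using separating_hyperplane_closed_point[OF convex_closure[OF convK] closed_closure] by blast
    have b: "b < 0" using ab(2)[of 0] Q(2) closure_subset[of K] by (fastforce simp: K)
    have "- a \<bullet> (q - l) \<le> 0" if q: "q \<in> Q" for q
    proof (rule ccontr)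
      assume "\<not> - a \<bullet> (q - l) \<le> 0"
      then have neg: "a \<bullet> (q - l) < 0" by simp
      define c where "c = b / (a \<bullet> (q - l))"
      have "c \<ge> 0" using b neg by (simp add: c_def divide_nonpos_neg)
      then have "c *\<^sub>R (q - l) \<in> closure K" using q closure_subset[of K] by (auto simp: K)
      then have "b < a \<bullet> (c *\<^sub>R (q - l))" by (rule ab(2))
      then show False using neg by (simp add: c_def)
    qed
    then have "- a \<in> normal_cone Q l" using Q(2) by (simp add: normal_cone_def)
    then have "z \<bullet> (- a) \<le> 0" by (rule z)
    then show False using ab(1) b by (simp add: inner_commute)
  qed
  then obtain W where W: "\<And>k. W k \<in> K" "W \<longlonglongrightarrow> z" unfolding closure_sequential by auto
  have "\<forall>k. \<exists>c q. W k = c *\<^sub>R (q - l) \<and> 0 \<le> c \<and> q \<in> Q" using W(1) unfolding K by blast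
  then obtain c q where cq: "\<And>k. W k = c k *\<^sub>R (q k - l)" "\<And>k. 0 \<le> c k" "\<And>k. q k \<in> Q" by metis
  \<comment> \<open>The first factor sends the step sizes to zero; the second one keeps
    \<open>T k * c k\<close> at most 1, so that \<open>l + T k *\<^sub>R W k\<close> is a convex
    combination of \<open>l\<close> and \<open>q k\<close>.\<close>
  define T where "T k = inverse (real (Suc k)) * inverse (c k + 1)" for k
  have inv: "0 < inverse (c k + 1)" "inverse (c k + 1) \<le> 1" "c k * inverse (c k + 1) \<le> 1" for k
    using cq(2)[of k] by (auto simp: field_simps)
  have Tpos: "T k > 0" for k using inv(1)[of k] by (simp add: T_def)
  have "T \<longlonglongrightarrow> 0"
  proof (rule tendsto_sandwich[OF _ _ tendsto_const LIMSEQ_inverse_real_of_nat])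
    show "\<forall>\<^sub>F k in sequentially. 0 \<le> T k" using Tpos by (simp add: less_imp_le)
    show "\<forall>\<^sub>F k in sequentially. T k \<le> inverse (real (Suc k))"
      unfolding T_def using inv by (intro always_eventually allI mult_left_le) (auto simp: less_imp_le)
  qed
  moreover have "l + T k *\<^sub>R W k \<in> Q" for k
  proof -
    have "T k * c k = inverse (real (Suc k)) * (c k * inverse (c k + 1))" by (simp add: T_def)
    also have "\<dots> \<le> 1 * 1" using inv[of k] cq(2)[of k] by (intro mult_mono) (auto simp: field_simps)
    finally have u: "T k * c k \<le> 1" by simp
    have "(1 - T k * c k) *\<^sub>R l + (T k * c k) *\<^sub>R q k \<in> Q"
      using Q cq(2,3)[of k] u Tpos[of k] by (intro convexD_alt) (auto simp: less_imp_le)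
    then show ?thesis by (simp add: cq(1) algebra_simps)
  qed
  ultimately show ?thesis
    unfolding tangent_cone_def using W(2) Tpos by auto
qed

lemma subspace_cone_differences:
  fixes C :: "'a::real_vector set"
  assumes "0 \<in> C" "\<And>x y. x \<in> C \<Longrightarrow> y \<in> C \<Longrightarrow> x + y \<in> C"
    "\<And>x c. x \<in> C \<Longrightarrow> 0 \<le> (c::real) \<Longrightarrow> c *\<^sub>R x \<in> C"
  shows "subspace {x - y | x y. x \<in> C \<and> y \<in> C}"
  unfolding subspace_def
proof (intro conjI allI ballI)
  show "0 \<in> {x - y | x y. x \<in> C \<and> y \<in> C}" using assms(1) by force
next
  fix u v assume "u \<in> {x - y | x y. x \<in> C \<and> y \<in> C}" "v \<in> {x - y | x y. x \<in> C \<and> y \<in> C}"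
  then obtain a b c d where *: "u = a - b" "v = c - d" "a \<in> C" "b \<in> C" "c \<in> C" "d \<in> C" by blast
  then have "u + v = (a + c) - (b + d)" "a + c \<in> C" "b + d \<in> C" using assms(2) by auto
  then show "u + v \<in> {x - y | x y. x \<in> C \<and> y \<in> C}" by blast
next
  fix c :: real and u assume "u \<in> {x - y | x y. x \<in> C \<and> y \<in> C}"
  then obtain a b where *: "u = a - b" "a \<in> C" "b \<in> C" by blast
  show "c *\<^sub>R u \<in> {x - y | x y. x \<in> C \<and> y \<in> C}"
  proof (cases "0 \<le> c")
    case True
    then have "c *\<^sub>R u = c *\<^sub>R a - c *\<^sub>R b" "c *\<^sub>R a \<in> C" "c *\<^sub>R b \<in> C"
      using * assms(3) by (auto simp: scaleR_diff_right)
    then show ?thesis by blast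
  next
    case False
    then have "c *\<^sub>R u = (- c) *\<^sub>R b - (- c) *\<^sub>R a" "(- c) *\<^sub>R a \<in> C" "(- c) *\<^sub>R b \<in> C"
      using * assms(3)[of _ "- c"] by (auto simp: scaleR_diff_right)
    then show ?thesis by blast
  qed
qed

text \<open>Differences of normals form a subspace. The residual \<open>z\<close> of
  \<open>y\<close> orthogonal to it annihilates all normals, so \<open>z\<close> and
  \<open>- z\<close> are tangent. Then \<open>z\<close> lies in the lineality space,
  \<open>z \<bullet> y = 0\<close>, and hence \<open>z = 0\<close>.\<close>

lemma orthogonal_lineality_normal_differences:
  fixes Q :: "'b::euclidean_space set"
  assumes Q: "convex Q" "l \<in> Q"
    and y: "\<And>w. w \<in> lineality (tangent_cone Q l) \<Longrightarrow> w \<bullet> y = 0"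
  shows "\<exists>m n. m \<in> normal_cone Q l \<and> n \<in> normal_cone Q l \<and> y = m - n"
proof -
  let ?M = "{x - y | x y. x \<in> normal_cone Q l \<and> y \<in> normal_cone Q l}"
  have M: "subspace ?M"
    by (rule subspace_cone_differences) (auto intro: normal_cone_zero normal_cone_add normal_cone_scale Q)
  obtain u z where uz: "u \<in> span ?M" "\<And>w. w \<in> span ?M \<Longrightarrow> orthogonal z w" "y = u + z"
    by (rule orthogonal_subspace_decomp_exists[of ?M y]) blast
  have zn: "z \<bullet> n = 0" if "n \<in> normal_cone Q l" for n
  proof -
    have "n - 0 \<in> ?M" using that normal_cone_zero[OF Q(2)] by blast
    from uz(2)[OF span_base[OF this]] show ?thesis by (simp add: orthogonal_def)
  qed
  have "z \<in> tangent_cone Q l" "- z \<in> tangent_cone Q l"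
    using zn by (auto intro!: polar_normal_cone_subset_tangent_cone Q)
  then have "z \<in> lineality (tangent_cone Q l)"
    unfolding lineality_def by (metis IntI image_eqI minus_minus)
  then have "z \<bullet> y = 0" by (rule y)
  moreover have "z \<bullet> u = 0" using uz(1,2) by (simp add: orthogonal_def)
  ultimately have "z = 0" using uz(3) by (simp add: inner_add_right)
  then have "y \<in> ?M" using uz(1,3) M by (simp add: span_eq_iff[THEN iffD2])
  then show ?thesis by blast
qed

context strict_decomposition
begin

section \<open>First-order behaviour at the reference point\<close>

lemma F_quotient_tendsto:
  "((\<lambda>(t, h'). F (xb + t *\<^sub>R h') /\<^sub>R t) \<longlongrightarrow> D xb h) (at_right 0 \<times>\<^sub>F nhds h)"
proof -
  let ?P = "at_right (0::real) \<times>\<^sub>F nhds h"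
  \<comment> \<open>At \<open>z = 0\<close> division by zero gives the value 0, so \<open>R\<close>
    tends to 0 over full neighbourhoods; the increments \<open>fst p *\<^sub>R snd p\<close> may
    vanish.\<close>
  define R where "R z = norm (F (xb + z) - F xb - D xb z) / norm z" for z
  have "R \<midarrow>0\<rightarrow> 0"
    using F_deriv[OF xb_U] unfolding has_derivative_at R_def by blast
  moreover have "R 0 = 0" by (simp add: R_def)
  ultimately have R: "(R \<longlongrightarrow> 0) (nhds 0)" using tendsto_at_iff_tendsto_nhds[of R 0] by simp
  have t: "((\<lambda>p. fst p) \<longlongrightarrow> 0) ?P"
    by (rule filterlim_mono[OF filterlim_fst at_within_le_nhds order_refl])
  have h': "((\<lambda>p. snd p) \<longlongrightarrow> h) ?P" by (rule filterlim_snd)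
  have pos: "\<forall>\<^sub>F p in ?P. fst p > 0"
    using filterlim_fst eventually_at_right_less unfolding filterlim_iff by blast
  have z: "((\<lambda>p. fst p *\<^sub>R snd p) \<longlongrightarrow> 0) ?P" using tendsto_scaleR[OF t h'] by simp
  have "((\<lambda>p. R (fst p *\<^sub>R snd p) * norm (snd p)) \<longlongrightarrow> 0 * norm h) ?P"
    by (intro tendsto_mult tendsto_norm h' filterlim_compose[OF R z])
  moreover have "\<forall>\<^sub>F p in ?P. R (fst p *\<^sub>R snd p) * norm (snd p)
      = norm (F (xb + fst p *\<^sub>R snd p) /\<^sub>R fst p - D xb (snd p))"
    using pos
  proof eventually_elim
    case (elim p)
    have "norm (F (xb + fst p *\<^sub>R snd p) /\<^sub>R fst p - D xb (snd p))
      = norm (F (xb + fst p *\<^sub>R snd p) - D xb (fst p *\<^sub>R snd p)) / fst p"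
    proof -
      have "F (xb + fst p *\<^sub>R snd p) /\<^sub>R fst p - D xb (snd p)
        = (F (xb + fst p *\<^sub>R snd p) - D xb (fst p *\<^sub>R snd p)) /\<^sub>R fst p"
        using elim by (simp add: blinfun.scaleR_right scaleR_diff_right)
      then show ?thesis using elim by (simp add: divide_inverse mult.commute)
    qed
    then show ?case using elim F_xb by (auto simp: R_def blinfun.zero_right)
  qed
  ultimately have "((\<lambda>p. norm (F (xb + fst p *\<^sub>R snd p) /\<^sub>R fst p - D xb (snd p))) \<longlongrightarrow> 0 * norm h) ?P"
    by (rule Lim_transform_eventually)
  then have "((\<lambda>p. F (xb + fst p *\<^sub>R snd p) /\<^sub>R fst p - D xb (snd p)) \<longlongrightarrow> 0) ?P"
    by (simp add: tendsto_norm_zero_iff)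
  moreover have "((\<lambda>p. D xb (snd p)) \<longlongrightarrow> D xb h) ?P" by (intro blinfun.tendsto tendsto_const h')
  ultimately have "((\<lambda>p. (F (xb + fst p *\<^sub>R snd p) /\<^sub>R fst p - D xb (snd p)) + D xb (snd p)) \<longlongrightarrow> 0 + D xb h) ?P"
    by (rule tendsto_add)
  then show ?thesis by (simp add: case_prod_unfold)
qed

lemma inner_F_quotient_tendsto:
  "((\<lambda>(t, h'). (q \<bullet> F (xb + t *\<^sub>R h')) / t) \<longlongrightarrow> q \<bullet> D xb h) (at_right 0 \<times>\<^sub>F nhds h)"
  using tendsto_inner[OF tendsto_const F_quotient_tendsto, of q h]
  by (simp add: case_prod_unfold divide_inverse mult.commute)

lemma eventually_add_mem_U:
  "\<forall>\<^sub>F (t, h') in at_right 0 \<times>\<^sub>F nhds h. 0 < t \<and> xb + t *\<^sub>R h' \<in> U"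
proof -
  let ?P = "at_right (0::real) \<times>\<^sub>F nhds h"
  have t: "((\<lambda>p. fst p) \<longlongrightarrow> 0) ?P"
    by (rule filterlim_mono[OF filterlim_fst at_within_le_nhds order_refl])
  have h': "((\<lambda>p. snd p) \<longlongrightarrow> h) ?P" by (rule filterlim_snd)
  have pos: "\<forall>\<^sub>F p in ?P. fst p > 0"
    using filterlim_fst eventually_at_right_less unfolding filterlim_iff by blast
  have "((\<lambda>p. xb + fst p *\<^sub>R snd p) \<longlongrightarrow> xb + 0 *\<^sub>R h) ?P" by (intro tendsto_intros t h')
  then have "\<forall>\<^sub>F p in ?P. xb + fst p *\<^sub>R snd p \<in> U"
    using open_U xb_U by (intro topological_tendstoD) auto
  with pos have "\<forall>\<^sub>F p in ?P. 0 < fst p \<and> xb + fst p *\<^sub>R snd p \<in> U" by (rule eventually_conj)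
  then show ?thesis by (simp add: case_prod_unfold)
qed

lemma subderiv_ge:
  assumes q: "q \<in> Q"
  shows "ereal (q \<bullet> D xb h) \<le> subderiv \<phi> xb h"
  unfolding subderiv_def le_Liminf_iff
proof (intro allI impI)
  fix y :: ereal assume y: "y < ereal (q \<bullet> D xb h)"
  have "((\<lambda>p. ereal (case p of (t, h') \<Rightarrow> (q \<bullet> F (xb + t *\<^sub>R h')) / t)) \<longlongrightarrow> ereal (q \<bullet> D xb h))
      (at_right 0 \<times>\<^sub>F nhds h)"
    by (intro tendsto_ereal inner_F_quotient_tendsto)
  from order_tendstoD(1)[OF this y] eventually_add_mem_U[of h]
  show "\<forall>\<^sub>F p in at_right 0 \<times>\<^sub>F nhds h. y < (case p of (t, h') \<Rightarrow> (\<phi> (xb + t *\<^sub>R h') - \<phi> xb) / ereal t)"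
  proof eventually_elim
    case (elim p)
    obtain t h' where p: "p = (t, h')" by (cases p)
    have t: "0 < t" and U: "xb + t *\<^sub>R h' \<in> U" using elim p by auto
    have "ereal (q \<bullet> F (xb + t *\<^sub>R h')) \<le> support_fun Q (F (xb + t *\<^sub>R h'))" by (rule support_fun_ge[OF q])
    then have "ereal ((q \<bullet> F (xb + t *\<^sub>R h')) / t) \<le> (\<phi> (xb + t *\<^sub>R h') - \<phi> xb) / ereal t"
      unfolding phi_eq[OF U] using t phi_finite
      by (cases "\<phi> xb"; cases "support_fun Q (F (xb + t *\<^sub>R h'))") (auto simp: divide_right_mono)
    then show ?case using elim(1) p by (auto intro: less_le_trans)
  qed
qed

text \<open>The subderivative dominates \<open>q \<bullet> D xb h\<close> for every
  \<open>q \<in> Q\<close>, so criticality makes \<open>lb\<close> maximal among them. Conversely,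
  \<open>normal_path\<close> supplies points approached in direction \<open>h\<close> at which
  \<open>\<phi>\<close> equals \<open>\<phi> xb + lb \<bullet> F x\<close>, and these attain the
  lower bound.\<close>

lemma critical_cone_eq: "critical_cone \<phi> xb vb = {h. D xb h \<in> N}"
proof (intro set_eqI iffI; unfold mem_Collect_eq)
  fix h assume "h \<in> critical_cone \<phi> xb vb"
  then have "subderiv \<phi> xb h = ereal (lb \<bullet> D xb h)" by (simp add: critical_cone_def vb_inner)
  then have "support_fun Q (D xb h) \<le> ereal (lb \<bullet> D xb h)"
    unfolding support_fun_def using subderiv_ge[of _ h] by (intro SUP_least) simp
  then show "D xb h \<in> N" by (rule normal_coneI_support_fun[OF lb_Q])
next
  fix h assume h: "D xb h \<in> N"
  have "subderiv \<phi> xb h \<le> ereal (lb \<bullet> D xb h)"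
  proof (rule ccontr)
    assume "\<not> subderiv \<phi> xb h \<le> ereal (lb \<bullet> D xb h)"
    then have "ereal (lb \<bullet> D xb h) < Liminf (at_right 0 \<times>\<^sub>F nhds h) (\<lambda>(t, h'). (\<phi> (xb + t *\<^sub>R h') - \<phi> xb) / ereal t)"
      by (simp add: subderiv_def)
    then obtain y where y: "ereal (lb \<bullet> D xb h) < y"
      and yL: "y < Liminf (at_right 0 \<times>\<^sub>F nhds h) (\<lambda>(t, h'). (\<phi> (xb + t *\<^sub>R h') - \<phi> xb) / ereal t)"
      using dense by blast
    have ev: "\<forall>\<^sub>F p in at_right 0 \<times>\<^sub>F nhds h. y < (case p of (t, h') \<Rightarrow> (\<phi> (xb + t *\<^sub>R h') - \<phi> xb) / ereal t)"
      by (rule iffD1[OF le_Liminf_iff order_refl, rule_format, OF yL])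
    have "((\<lambda>p. ereal (case p of (t, h') \<Rightarrow> (lb \<bullet> F (xb + t *\<^sub>R h')) / t)) \<longlongrightarrow> ereal (lb \<bullet> D xb h))
        (at_right 0 \<times>\<^sub>F nhds h)"
      by (intro tendsto_ereal inner_F_quotient_tendsto)
    from order_tendstoD(2)[OF this y] ev
    have "\<forall>\<^sub>F p in at_right 0 \<times>\<^sub>F nhds h. (case p of (t, h') \<Rightarrow>
        ereal ((lb \<bullet> F (xb + t *\<^sub>R h')) / t) < (\<phi> (xb + t *\<^sub>R h') - \<phi> xb) / ereal t)"
      by eventually_elim (auto intro: less_trans)
    then obtain P R where PR: "eventually P (at_right 0)" "eventually R (nhds h)"
      "\<And>t h'. P t \<Longrightarrow> R h' \<Longrightarrow> ereal ((lb \<bullet> F (xb + t *\<^sub>R h')) / t) < (\<phi> (xb + t *\<^sub>R h') - \<phi> xb) / ereal t"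
      unfolding eventually_prod_filter by auto
    obtain e where e: "e > 0" "\<And>h'. dist h' h < e \<Longrightarrow> R h'" using PR(2) unfolding eventually_nhds_metric by auto
    have "\<forall>\<^sub>F t in at_right 0. \<exists>x\<in>U. F x \<in> N \<and> norm (x - xb - t *\<^sub>R h) \<le> e / 2 * t"
      using e by (intro normal_path[OF h]) auto
    with PR(1) eventually_at_right_less[of "0::real"]
    have "\<forall>\<^sub>F t in at_right (0::real). False"
    proof eventually_elim
      case (elim t)
      then obtain x where x: "x \<in> U" "F x \<in> N" "norm (x - xb - t *\<^sub>R h) \<le> e / 2 * t" by auto
      define h' where "h' = (x - xb) /\<^sub>R t"
      have xe: "xb + t *\<^sub>R h' = x" using elim by (simp add: h'_def)
      have "norm (t *\<^sub>R (h' - h)) \<le> e / 2 * t"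
        using x(3) elim by (simp add: h'_def scaleR_diff_right)
      then have "dist h' h < e" using elim e by (simp add: dist_norm)
      then have "ereal ((lb \<bullet> F x) / t) < (\<phi> x - \<phi> xb) / ereal t"
        using PR(3)[OF elim(1) e(2), of h'] by (simp add: xe)
      then show False
        using phi_finite elim by (cases "\<phi> xb") (auto simp: phi_eq[OF x(1)] support_fun_normal[OF x(2)])
    qed
    then show False by simp
  qed
  then show "h \<in> critical_cone \<phi> xb vb"
    using subderiv_ge[OF lb_Q, of h] by (simp add: critical_cone_def vb_inner antisym)
qed

lemma affine_hull_critical_cone:
  "affine hull (critical_cone \<phi> xb vb) = {h - k | h k. D xb h \<in> N \<and> D xb k \<in> N}"
proof -
  let ?C = "{h. D xb h \<in> N}"
  have C0: "0 \<in> ?C" using lb_Q by (simp add: blinfun.zero_right normal_cone_zero)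
  have sub: "subspace {h - k | h k. h \<in> ?C \<and> k \<in> ?C}"
    by (rule subspace_cone_differences)
       (use C0 in \<open>auto simp: blinfun.add_right blinfun.scaleR_right intro: normal_cone_add normal_cone_scale\<close>)
  have hull: "affine hull ?C = span ?C" by (intro affine_hull_span_0 hull_inc C0)
  have "span ?C = {h - k | h k. h \<in> ?C \<and> k \<in> ?C}"
  proof
    show "span ?C \<subseteq> {h - k | h k. h \<in> ?C \<and> k \<in> ?C}"
      by (rule span_minimal[OF _ sub]) (use C0 in force)
    show "{h - k | h k. h \<in> ?C \<and> k \<in> ?C} \<subseteq> span ?C"
      by (auto intro!: span_diff intro: span_base)
  qed
  then show ?thesis by (simp add: critical_cone_eq hull)
qed

text \<open>The qualification condition lifts the decomposition of \<open>D xb h\<close> into normals to a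
  decomposition of \<open>h\<close> into critical directions.\<close>

lemma mem_affine_hull_critical_cone:
  assumes "\<And>w. w \<in> lineality (tangent_cone Q lb) \<Longrightarrow> w \<bullet> D xb h = 0"
  shows "h \<in> affine hull (critical_cone \<phi> xb vb)"
proof -
  obtain m n where mn: "m \<in> N" "n \<in> N" "D xb h = m - n"
    using orthogonal_lineality_normal_differences[OF convex_Q lb_Q assms] by blast
  have "n \<in> {D xb w - y | w y. y \<in> N}" using qualification by simp
  then obtain k y where k: "n = D xb k - y" "y \<in> N" by auto
  have 1: "D xb k \<in> N" using normal_cone_add[OF mn(2) k(2)] k(1) by simp
  have "D xb (h + k) = m + y" using mn(3) k(1) by (simp add: blinfun.add_right)
  then have 2: "D xb (h + k) \<in> N" using normal_cone_add[OF mn(1) k(2)] by simp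
  have "h = (h + k) - k" by simp
  then show ?thesis unfolding affine_hull_critical_cone using 1 2 by blast
qed

end

subsection \<open>Uniform growth and strong metric regularity\<close>

definition uniform_growth :: "('a::real_inner \<Rightarrow> ereal) \<Rightarrow> 'a \<Rightarrow> 'a \<Rightarrow> bool" where
  "uniform_growth \<phi> x0 v0 \<longleftrightarrow>
    (\<exists>U V \<sigma>. open U \<and> x0 \<in> U \<and> open V \<and> v0 \<in> V \<and> \<sigma> > 0 \<and>
        (\<forall>(x, v) \<in> gph (limiting_subdiff \<phi>) \<inter> (U \<times> V). \<forall>x'\<in>U.
          \<phi> x' \<ge> \<phi> x + ereal (v \<bullet> (x' - x)) + ereal (\<sigma> / 2 * (norm (x - x'))\<^sup>2)))"

text \<open>A minimizer of the tilted function over the closed ball cannot lie on the sphere, where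
  the values exceed the one at the centre. In the interior it is a free local minimizer, so
  \<open>v\<close> is a subgradient there.\<close>

lemma tilted_minimizer:
  fixes v :: "'a::euclidean_space"
  assumes "lsc_fun \<phi>" and e: "e > 0" and fin: "\<bar>\<phi> x0\<bar> \<noteq> \<infinity>"
    and low: "\<And>y. y \<in> cball x0 e \<Longrightarrow> \<phi> y \<noteq> - \<infinity>"
    and bd: "\<And>y. y \<in> sphere x0 e \<Longrightarrow> \<phi> x0 - ereal (v \<bullet> x0) < \<phi> y - ereal (v \<bullet> y)"
  obtains x where "x \<in> ball x0 e" "v \<in> limiting_subdiff \<phi> x"
    "\<And>y. y \<in> cball x0 e \<Longrightarrow> \<phi> x + ereal (v \<bullet> (y - x)) \<le> \<phi> y"
proof -
  obtain x where x: "x \<in> cball x0 e"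
    "\<And>y. y \<in> cball x0 e \<Longrightarrow> \<phi> x - ereal (v \<bullet> x) \<le> \<phi> y - ereal (v \<bullet> y)"
    using lsc_fun_attains_inf[OF lsc_fun_tilt[OF assms(1)], of "cball x0 e" v] e by auto
  have le: "\<phi> x - ereal (v \<bullet> x) \<le> \<phi> x0 - ereal (v \<bullet> x0)" using x(2)[of x0] e by simp
  have finx: "\<bar>\<phi> x\<bar> \<noteq> \<infinity>" using le low[OF x(1)] fin by (cases "\<phi> x"; cases "\<phi> x0") auto
  have "x \<notin> sphere x0 e" using bd[of x] le by auto
  then have xb: "x \<in> ball x0 e" using x(1) by auto
  have growth: "\<phi> x + ereal (v \<bullet> (y - x)) \<le> \<phi> y" if "y \<in> cball x0 e" for y
    using x(2)[OF that] finx by (cases "\<phi> x"; cases "\<phi> y") (auto simp: inner_diff_right)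
  have "v \<in> regular_subdiff \<phi> x"
    by (rule regular_subdiffI_local_min[of \<phi> x "ball x0 e"]) (use finx xb growth in auto)
  then show thesis using that[OF xb _ growth] regular_imp_limiting by blast
qed

text \<open>Existence of solutions comes from minimizing tilts, the growth at \<open>x0\<close>
  controlling the boundary. Adding the growth inequalities of two graph points gives strong
  monotonicity with modulus \<open>\<sigma>\<close>, hence uniqueness and the Lipschitz constant
  \<open>1 / \<sigma>\<close>.\<close>

lemma uniform_growth_imp_strongly_metrically_regular:
  fixes \<phi> :: "'a::euclidean_space \<Rightarrow> ereal"
  assumes "lsc_fun \<phi>" and v0: "v0 \<in> limiting_subdiff \<phi> x0" and "uniform_growth \<phi> x0 v0"
  shows "strongly_metrically_regular (limiting_subdiff \<phi>) x0 v0 \<and>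
    local_minimizer (\<lambda>x. \<phi> x - ereal (v0 \<bullet> x)) x0"
proof -
  obtain U V \<sigma> where UV: "open U" "x0 \<in> U" "open V" "v0 \<in> V" "\<sigma> > 0"
    and growth: "\<And>x v x'. x \<in> U \<Longrightarrow> v \<in> V \<Longrightarrow> v \<in> limiting_subdiff \<phi> x \<Longrightarrow> x' \<in> U \<Longrightarrow>
      \<phi> x + ereal (v \<bullet> (x' - x)) + ereal (\<sigma> / 2 * (norm (x - x'))\<^sup>2) \<le> \<phi> x'"
    using assms(3) unfolding uniform_growth_def gph_def by fast
  have fin: "\<bar>\<phi> x\<bar> \<noteq> \<infinity>" if "v \<in> limiting_subdiff \<phi> x" for x v
    using that by (simp add: limiting_subdiff_def)
  obtain e where e: "e > 0" "cball x0 e \<subseteq> U" using UV open_contains_cball by blast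
  obtain r0 where r0: "r0 > 0" "ball v0 r0 \<subseteq> V" using UV open_contains_ball by blast
  \<comment> \<open>For \<open>norm (v - v0)\<close> below \<open>\<sigma> / 2 * e\<close> the tilt
    changes values on the sphere of radius \<open>e\<close> by less than the growth
    \<open>\<sigma> / 2 * e\<^sup>2\<close>.\<close>
  define r where "r = min r0 (\<sigma> / 2 * e)"
  have r: "r > 0" "ball v0 r \<subseteq> V" using r0 e UV(5) by (auto simp: r_def)
  have g0: "\<phi> x0 + ereal (v0 \<bullet> (y - x0)) + ereal (\<sigma> / 2 * (norm (x0 - y))\<^sup>2) \<le> \<phi> y" if "y \<in> U" for y
    using growth[OF UV(2,4) v0 that] .
  have "\<exists>x\<in>ball x0 e. v \<in> limiting_subdiff \<phi> x" if v: "v \<in> ball v0 r" for v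
  proof (rule tilted_minimizer[OF assms(1) e(1) fin[OF v0]])
    show "\<phi> y \<noteq> - \<infinity>" if "y \<in> cball x0 e" for y
      using g0[of y] that e(2) fin[OF v0] by (cases "\<phi> x0") auto
    show "\<phi> x0 - ereal (v \<bullet> x0) < \<phi> y - ereal (v \<bullet> y)" if y: "y \<in> sphere x0 e" for y
    proof -
      have n: "norm (y - x0) = e" using y by (simp add: dist_norm norm_minus_commute)
      have "(v - v0) \<bullet> (y - x0) \<le> norm (v - v0) * e"
        using norm_cauchy_schwarz[of "v - v0" "y - x0"] n by simp
      also have "\<dots> < \<sigma> / 2 * e * e"
        using v e(1) by (intro mult_strict_right_mono) (auto simp: r_def dist_norm norm_minus_commute)
      finally have *: "(v - v0) \<bullet> (y - x0) < \<sigma> / 2 * e\<^sup>2" by (simp add: power2_eq_square)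
      have "y \<in> U" using y e(2) by auto
      from g0[OF this] show ?thesis
        using * n fin[OF v0]
        by (cases "\<phi> x0"; cases "\<phi> y") (auto simp: inner_diff_left inner_diff_right norm_minus_commute)
    qed
  qed blast
  then obtain g where g: "\<And>v. v \<in> ball v0 r \<Longrightarrow> g v \<in> ball x0 e \<and> v \<in> limiting_subdiff \<phi> (g v)"
    by metis
  have mono: "\<sigma> * (norm (x - x'))\<^sup>2 \<le> (v - v') \<bullet> (x - x')"
    if "x \<in> ball x0 e" "x' \<in> ball x0 e" "v \<in> ball v0 r" "v' \<in> ball v0 r"
      "v \<in> limiting_subdiff \<phi> x" "v' \<in> limiting_subdiff \<phi> x'" for x x' v v'
  proof -
    have U: "x \<in> U" "x' \<in> U" "v \<in> V" "v' \<in> V" using that e r by auto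
    have 1: "\<phi> x + ereal (v \<bullet> (x' - x)) + ereal (\<sigma> / 2 * (norm (x - x'))\<^sup>2) \<le> \<phi> x'"
      by (rule growth[OF U(1,3) that(5) U(2)])
    have 2: "\<phi> x' + ereal (v' \<bullet> (x - x')) + ereal (\<sigma> / 2 * (norm (x' - x))\<^sup>2) \<le> \<phi> x"
      by (rule growth[OF U(2,4) that(6) U(1)])
    show ?thesis
      using 1 2 fin[OF that(5)] fin[OF that(6)]
      by (cases "\<phi> x"; cases "\<phi> x'")
         (auto simp: inner_diff_left inner_diff_right norm_minus_commute[of x' x])
  qed
  have lip: "(1 / \<sigma>)-lipschitz_on (ball v0 r) g"
  proof (rule lipschitz_onI)
    fix v v' assume v: "v \<in> ball v0 r" "v' \<in> ball v0 r"
    let ?d = "norm (g v - g v')"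
    have "\<sigma> * ?d\<^sup>2 \<le> (v - v') \<bullet> (g v - g v')" using g v by (intro mono) auto
    also have "\<dots> \<le> norm (v - v') * ?d" by (rule norm_cauchy_schwarz)
    finally have "?d * (\<sigma> * ?d) \<le> ?d * norm (v - v')" by (simp add: power2_eq_square algebra_simps)
    then have "\<sigma> * ?d \<le> norm (v - v')" by (cases "?d = 0") auto
    then show "dist (g v) (g v') \<le> 1 / \<sigma> * dist v v'"
      using UV(5) by (simp add: dist_norm field_simps)
  qed (use UV(5) in simp)
  have single: "{x \<in> ball x0 e. v \<in> limiting_subdiff \<phi> x} = {g v}" if v: "v \<in> ball v0 r" for v
  proof -
    have "x = g v" if "x \<in> ball x0 e" "v \<in> limiting_subdiff \<phi> x" for x
      using mono[of x "g v" v v] g[OF v] that v UV(5) by (simp add: mult_le_0_iff)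
    then show ?thesis using g[OF v] by auto
  qed
  have "strongly_metrically_regular (limiting_subdiff \<phi>) x0 v0"
    unfolding strongly_metrically_regular_def
    using v0 lip single e(1) r(1)
    by (intro conjI exI[of _ "ball x0 e"] exI[of _ "ball v0 r"] exI[of _ g] exI[of _ "1 / \<sigma>"]) auto
  moreover have "local_minimizer (\<lambda>x. \<phi> x - ereal (v0 \<bullet> x)) x0"
    unfolding local_minimizer_def
  proof (intro exI[of _ U] conjI ballI UV)
    fix y assume "y \<in> U"
    have "0 \<le> \<sigma> / 2 * (norm (x0 - y))\<^sup>2" using UV(5) by simp
    then show "\<phi> x0 - ereal (v0 \<bullet> x0) \<le> \<phi> y - ereal (v0 \<bullet> y)"
      using g0[OF \<open>y \<in> U\<close>] fin[OF v0]
      by (cases "\<phi> x0"; cases "\<phi> y") (auto simp: inner_diff_right)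
  qed
  ultimately show ?thesis ..
qed

text \<open>The converse: for \<open>v\<close> near \<open>v0\<close> the localization \<open>g v\<close> minimizes \<open>\<phi> - v\<close> over a fixed
  ball, so the value function \<open>m v = \<phi> (g v) - v \<bullet> g v\<close> satisfies
  \<open>m v' \<ge> m v - (v' - v) \<bullet> g v - L * (norm (v' - v))\<^sup>2\<close>; the growth of \<open>\<phi>\<close> at \<open>g v\<close> in the
  direction of \<open>x'\<close> follows with \<open>v' = v + s (x' - g v)\<close> for a small multiple \<open>s\<close>.\<close>

lemma strongly_metrically_regular_imp_uniform_growth:
  fixes \<phi> :: "'a::euclidean_space \<Rightarrow> ereal"
  assumes "lsc_fun \<phi>" and "strongly_metrically_regular (limiting_subdiff \<phi>) x0 v0"
    and "local_minimizer (\<lambda>x. \<phi> x - ereal (v0 \<bullet> x)) x0"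
  shows "uniform_growth \<phi> x0 v0"
proof -
  have v0: "v0 \<in> limiting_subdiff \<phi> x0"
    using assms(2) by (simp add: strongly_metrically_regular_def)
  obtain U V g L0 where UV: "open U" "x0 \<in> U" "open V" "v0 \<in> V" and lip0: "L0-lipschitz_on V g"
    and g: "\<And>v. v \<in> V \<Longrightarrow> {x \<in> U. v \<in> limiting_subdiff \<phi> x} = {g v}"
    using assms(2) unfolding strongly_metrically_regular_def by auto
  obtain U1 where U1: "open U1" "x0 \<in> U1"
    "\<And>y. y \<in> U1 \<Longrightarrow> \<phi> x0 - ereal (v0 \<bullet> x0) \<le> \<phi> y - ereal (v0 \<bullet> y)"
    using assms(3) unfolding local_minimizer_def by auto
  have fin: "\<bar>\<phi> x\<bar> \<noteq> \<infinity>" if "v \<in> limiting_subdiff \<phi> x" for x v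
    using that by (simp add: limiting_subdiff_def)
  obtain p0 where p0: "\<phi> x0 = ereal p0" using fin[OF v0] by auto
  define L where "L = L0 + 1"
  have L0: "L0 \<ge> 0" using lip0 by (rule lipschitz_on_nonneg)
  have L: "L > 0" "\<And>v v'. v \<in> V \<Longrightarrow> v' \<in> V \<Longrightarrow> norm (g v - g v') \<le> L * norm (v - v')"
  proof -
    show "L > 0" using L0 by (simp add: L_def)
    fix v v' assume "v \<in> V" "v' \<in> V"
    then have "norm (g v - g v') \<le> L0 * norm (v - v')" using lipschitz_onD[OF lip0] by (simp add: dist_norm)
    also have "\<dots> \<le> L * norm (v - v')" by (intro mult_right_mono) (auto simp: L_def)
    finally show "norm (g v - g v') \<le> L * norm (v - v')" .
  qed
  obtain e where e: "e > 0" "cball x0 e \<subseteq> U \<inter> U1"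
    using UV U1 open_contains_cball[of "U \<inter> U1"] by blast
  let ?f = "\<lambda>y. \<phi> y - ereal (v0 \<bullet> y)"
  have low: "\<phi> y \<noteq> - \<infinity>" if "y \<in> U1" for y
    using U1(3)[OF that] by (auto simp: p0)
  \<comment> \<open>A point of the sphere with no larger value would be a second local minimizer of
    the tilted function in \<open>U\<close>, against the single-valued localization.\<close>
  have strict: "?f x0 < ?f y" if y: "y \<in> sphere x0 e" for y
  proof (rule ccontr)
    assume "\<not> ?f x0 < ?f y"
    then have le: "?f y \<le> ?f x0" by simp
    have yU: "y \<in> U" "y \<in> U1" using y e(2) by auto
    have finy: "\<bar>\<phi> y\<bar> \<noteq> \<infinity>" using le low[OF yU(2)] p0 by (cases "\<phi> y") auto
    have "v0 \<in> regular_subdiff \<phi> y"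
    proof (rule regular_subdiffI_local_min[of \<phi> y, OF finy U1(1) yU(2)])
      fix z assume "z \<in> U1"
      then have "?f y \<le> ?f z" using U1(3) le by (blast intro: order_trans)
      then show "\<phi> y + ereal (v0 \<bullet> (z - y)) \<le> \<phi> z"
        using finy by (cases "\<phi> y"; cases "\<phi> z") (auto simp: inner_diff_right)
    qed
    then have "y \<in> {x \<in> U. v0 \<in> limiting_subdiff \<phi> x}" using yU regular_imp_limiting by auto
    moreover have "x0 \<in> {x \<in> U. v0 \<in> limiting_subdiff \<phi> x}" using UV v0 by auto
    ultimately have "y = x0" using g[OF UV(4)] by auto
    then show False using y e(1) by simp
  qed
  obtain \<eta> where \<eta>: "\<eta> > 0" "\<And>y. y \<in> sphere x0 e \<Longrightarrow> ?f x0 + ereal \<eta> \<le> ?f y"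
  proof (cases "sphere x0 e = {}")
    case True
    then show thesis using that[of 1] by auto
  next
    case False
    then obtain y0 where y0: "y0 \<in> sphere x0 e" "\<And>y. y \<in> sphere x0 e \<Longrightarrow> ?f y0 \<le> ?f y"
      using lsc_fun_attains_inf[OF lsc_fun_tilt[OF assms(1)] compact_sphere] by blast
    obtain w where w: "?f x0 < ereal w" "ereal w < ?f y0" using strict[OF y0(1)] ereal_dense2 by blast
    show thesis
    proof (rule that[of "w - (p0 - v0 \<bullet> x0)"])
      show "0 < w - (p0 - v0 \<bullet> x0)" using w(1) by (simp add: p0)
      show "?f x0 + ereal (w - (p0 - v0 \<bullet> x0)) \<le> ?f y" if "y \<in> sphere x0 e" for y
        using w(2) y0(2)[OF that] by (simp add: p0)
    qed
  qed
  obtain r0 where r0: "r0 > 0" "ball v0 r0 \<subseteq> V" using UV open_contains_ball by blast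
  \<comment> \<open>Tilts smaller than \<open>\<eta> / e\<close> change values on the sphere by less
    than the gap \<open>\<eta>\<close>.\<close>
  define r where "r = min r0 (\<eta> / e)"
  have "ball v0 r \<subseteq> ball v0 r0" unfolding r_def by (intro subset_ball) simp
  with r0(2) have r: "r > 0" "ball v0 r \<subseteq> V" "r * e \<le> \<eta>"
    using r0(1) e(1) \<eta>(1) by (auto simp: r_def min_def field_simps)
  have min: "g v \<in> ball x0 e \<and> (\<forall>y\<in>cball x0 e. \<phi> (g v) + ereal (v \<bullet> (y - g v)) \<le> \<phi> y)"
    if v: "v \<in> ball v0 r" for v
  proof (rule tilted_minimizer[OF assms(1) e(1) fin[OF v0]])
    show "\<phi> y \<noteq> - \<infinity>" if "y \<in> cball x0 e" for y using low that e(2) by auto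
    show "\<phi> x0 - ereal (v \<bullet> x0) < \<phi> y - ereal (v \<bullet> y)" if y: "y \<in> sphere x0 e" for y
    proof -
      have n: "norm (y - x0) = e" using y by (simp add: dist_norm norm_minus_commute)
      have "(v - v0) \<bullet> (y - x0) \<le> norm (v - v0) * e"
        using norm_cauchy_schwarz[of "v - v0" "y - x0"] n by simp
      also have "\<dots> < r * e"
        using v e(1) by (intro mult_strict_right_mono) (auto simp: dist_norm norm_minus_commute)
      finally have "(v - v0) \<bullet> (y - x0) < \<eta>" using r(3) by simp
      then show ?thesis
        using \<eta>(2)[OF y] by (cases "\<phi> y") (auto simp: p0 inner_diff_left inner_diff_right)
    qed
  next
    fix x assume x: "x \<in> ball x0 e" "v \<in> limiting_subdiff \<phi> x"
      "\<And>y. y \<in> cball x0 e \<Longrightarrow> \<phi> x + ereal (v \<bullet> (y - x)) \<le> \<phi> y"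
    then have "x \<in> {x \<in> U. v \<in> limiting_subdiff \<phi> x}" using e(2) by auto
    moreover have "v \<in> V" using v r(2) by blast
    ultimately have "x = g v" using g by blast
    then show ?thesis using x by auto
  qed
  \<comment> \<open>The Lipschitz bound then gives \<open>norm (x - y) \<le> norm d / 2\<close>, so
    at least half of \<open>(norm d)\<^sup>2\<close> survives in
    \<open>d \<bullet> (x' - y)\<close>; \<open>s\<close> becomes the growth modulus.\<close>
  define s where "s = 1 / (2 * L)"
  have s: "s > 0" "L * s = 1 / 2" using L(1) by (auto simp: s_def)
  \<comment> \<open>Two points of this ball are less than \<open>2 * \<rho>\<close> apart, so the
    shift from \<open>v\<close> to \<open>v'\<close> is below \<open>r / 2\<close> and
    \<open>v'\<close> stays in the ball of radius \<open>r\<close>.\<close>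
  define \<rho> where "\<rho> = Min {e, r / (4 * s)}"
  have \<rho>: "\<rho> > 0" "\<rho> \<le> e" "2 * s * \<rho> \<le> r / 2"
  proof -
    show "\<rho> > 0" "\<rho> \<le> e" using e(1) r(1) s(1) by (auto simp: \<rho>_def)
    have "\<rho> \<le> r / (4 * s)" by (simp add: \<rho>_def)
    then show "2 * s * \<rho> \<le> r / 2" using s(1) by (simp add: field_simps)
  qed
  have growth: "\<phi> x + ereal (v \<bullet> (x' - x)) + ereal (s / 2 * (norm (x - x'))\<^sup>2) \<le> \<phi> x'"
    if x: "x \<in> ball x0 \<rho>" and v: "v \<in> ball v0 (r / 2)" and xv: "v \<in> limiting_subdiff \<phi> x"
      and x': "x' \<in> ball x0 \<rho>" for x v x'
  proof -
    have vr: "v \<in> ball v0 r" using v r(1) by auto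
    have vV: "v \<in> V" using vr r(2) by blast
    have "x \<in> cball x0 e" using x \<rho>(2) by auto
    then have "x \<in> {x \<in> U. v \<in> limiting_subdiff \<phi> x}" using xv e(2) by auto
    then have xg: "x = g v" using g[OF vV] by auto
    define d where "d = x' - x"
    define v' where "v' = v + s *\<^sub>R d"
    have "norm d < 2 * \<rho>"
      using x x' norm_triangle_ineq4[of "x' - x0" "x - x0"]
      by (simp add: d_def dist_norm norm_minus_commute)
    then have "s * norm d < s * (2 * \<rho>)" using s(1) by (intro mult_strict_left_mono) auto
    then have sd: "s * norm d < r / 2" using \<rho>(3) by simp
    have v'r: "v' \<in> ball v0 r"
    proof -
      have "norm (v' - v0) \<le> norm (v - v0) + norm (s *\<^sub>R d)"
        unfolding v'_def by (metis add_diff_eq add.commute add_diff_cancel_left' diff_add_eq norm_triangle_ineq)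
      also have "\<dots> < r / 2 + r / 2"
        using v sd s(1) by (intro add_strict_mono) (auto simp: dist_norm norm_minus_commute)
      finally show ?thesis by (simp add: dist_norm norm_minus_commute)
    qed
    have v'V: "v' \<in> V" using v'r r(2) by blast
    define y where "y = g v'"
    have yU: "y \<in> cball x0 e" using min[OF v'r] by (auto simp: y_def)
    have 1: "\<phi> y + ereal (v' \<bullet> (x' - y)) \<le> \<phi> x'"
      using min[OF v'r] x' \<rho>(2) by (auto simp: y_def)
    have 2: "\<phi> x + ereal (v \<bullet> (y - x)) \<le> \<phi> y"
      using min[OF vr] yU by (auto simp: xg)
    have "norm (x - y) \<le> L * norm (v - v')" unfolding xg y_def by (rule L(2)[OF vV v'V])
    then have "norm (x - y) \<le> L * (s * norm d)" using s(1) by (simp add: v'_def)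
    also have "\<dots> = norm d / 2" using s(2) by (simp flip: mult.assoc)
    finally have xy: "norm (x - y) \<le> norm d / 2" .
    have "- (d \<bullet> (x - y)) \<le> norm d * (norm d / 2)"
      using norm_cauchy_schwarz[of "- d" "x - y"] mult_left_mono[OF xy, of "norm d"] by simp
    moreover have "d \<bullet> (x' - y) = d \<bullet> d + d \<bullet> (x - y)" by (simp add: d_def inner_diff_right)
    ultimately have "(norm d)\<^sup>2 / 2 \<le> d \<bullet> (x' - y)"
      by (simp add: dot_square_norm power2_eq_square)
    then have "s * ((norm d)\<^sup>2 / 2) \<le> s * (d \<bullet> (x' - y))" using s(1) by (intro mult_left_mono) auto
    then have "v \<bullet> (x' - x) + s / 2 * (norm (x - x'))\<^sup>2 \<le> v \<bullet> (y - x) + v' \<bullet> (x' - y)"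
      by (simp add: v'_def d_def inner_diff_right inner_add_left norm_minus_commute[of x x'] algebra_simps)
    then have "\<phi> x + ereal (v \<bullet> (x' - x)) + ereal (s / 2 * (norm (x - x'))\<^sup>2)
        \<le> \<phi> x + ereal (v \<bullet> (y - x)) + ereal (v' \<bullet> (x' - y))"
      using fin[OF xv] by (cases "\<phi> x") auto
    also have "\<dots> \<le> \<phi> y + ereal (v' \<bullet> (x' - y))" by (intro add_right_mono 2)
    also have "\<dots> \<le> \<phi> x'" by (rule 1)
    finally show ?thesis .
  qed
  show ?thesis
    unfolding uniform_growth_def
    by (intro exI[of _ "ball x0 \<rho>"] exI[of _ "ball v0 (r / 2)"] exI[of _ s] conjI)
       (use \<rho>(1) r(1) s(1) growth in \<open>auto simp: gph_def\<close>)
qed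

subsection \<open>Second-order growth\<close>

lemma eventually_inf_nhds_gph:
  fixes x0 :: "'a::metric_space" and v0 :: "'b::metric_space"
  shows "eventually P (inf (nhds (x0, v0)) (principal (gph S))) \<longleftrightarrow>
    (\<exists>e>0. \<forall>x v. dist x x0 < e \<longrightarrow> dist v v0 < e \<longrightarrow> v \<in> S x \<longrightarrow> P (x, v))"
  unfolding eventually_inf_principal eventually_nhds_metric
proof safe
  fix e :: real assume e: "e > 0" "\<forall>p. dist p (x0, v0) < e \<longrightarrow> p \<in> gph S \<longrightarrow> P p"
  show "\<exists>e>0. \<forall>x v. dist x x0 < e \<longrightarrow> dist v v0 < e \<longrightarrow> v \<in> S x \<longrightarrow> P (x, v)"
  proof (intro exI[of _ "e / 2"] conjI allI impI)
    fix x v assume *: "dist x x0 < e / 2" "dist v v0 < e / 2" "v \<in> S x"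
    have "dist (x, v) (x0, v0) \<le> dist x x0 + dist v v0"
      unfolding dist_Pair_Pair by (rule sqrt_sum_squares_le_sum) auto
    then show "P (x, v)" using * e(2) by (auto simp: gph_def)
  qed (use e in simp)
next
  fix e :: real assume e: "e > 0" "\<forall>x v. dist x x0 < e \<longrightarrow> dist v v0 < e \<longrightarrow> v \<in> S x \<longrightarrow> P (x, v)"
  show "\<exists>d>0. \<forall>p. dist p (x0, v0) < d \<longrightarrow> p \<in> gph S \<longrightarrow> P p"
  proof (intro exI[of _ e] conjI allI impI)
    fix p assume *: "dist p (x0, v0) < e" "p \<in> gph S"
    obtain x v where p: "p = (x, v)" by (cases p)
    have "dist x x0 < e" "dist v v0 < e"
      using dist_fst_le[of p "(x0, v0)"] dist_snd_le[of p "(x0, v0)"] *(1) p by auto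
    then show "P p" using e(2) *(2) p by (auto simp: gph_def)
  qed (use e in simp)
qed

lemma step_in_ball:
  fixes x0 h :: "'a::real_normed_vector"
  assumes d: "d > 0"
  obtains e where "e > 0" "\<And>t h' x. 0 < t \<Longrightarrow> t < e \<Longrightarrow> dist h' h < e \<Longrightarrow> dist x x0 < e \<Longrightarrow>
    x \<in> ball x0 d \<and> x + t *\<^sub>R h' \<in> ball x0 d"
proof -
  have h2: "norm h + 2 > 0" using norm_ge_zero[of h] by linarith
  define e where "e = min 1 (d / (norm h + 2))"
  have e: "e > 0" using d h2 by (simp add: e_def)
  have e1: "e \<le> 1" unfolding e_def by (rule min.cobounded1)
  have "e \<le> d / (norm h + 2)" unfolding e_def by (rule min.cobounded2)
  then have ed: "e * (norm h + 2) \<le> d" using h2 by (simp add: pos_le_divide_eq)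
  show thesis
  proof (rule that[OF e])
    fix t h' x assume *: "0 < t" "t < e" "dist h' h < e" "dist x x0 < e"
    have nh: "norm h' \<le> norm h + 1" using *(3) e1 norm_triangle_sub[of h' h] by (simp add: dist_norm)
    have "e * 1 \<le> e * (norm h + 2)" using e by (intro mult_left_mono) auto
    then have x: "x \<in> ball x0 d" using *(4) ed by (simp add: dist_commute)
    have "norm (x + t *\<^sub>R h' - x0) \<le> norm (x - x0) + norm (t *\<^sub>R h')"
      by (metis add_diff_eq add.commute diff_add_eq norm_triangle_ineq)
    also have "\<dots> < e + e * (norm h + 1)"
      using *(1,2,4) nh e by (intro add_less_le_mono) (auto simp: dist_norm intro: mult_mono)
    also have "\<dots> \<le> d" using ed by (simp add: algebra_simps)
    finally show "x \<in> ball x0 d \<and> x + t *\<^sub>R h' \<in> ball x0 d"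
      using x by (simp add: dist_norm norm_minus_commute)
  qed
qed

context strict_decomposition
begin

text \<open>The inequality \<open>second_quot \<ge> c\<close> multiplied out, with subgradients
  represented by multipliers and one radius \<open>e\<close> for all four limits of the strict
  second subderivative.\<close>

definition second_order_growth :: "'a \<Rightarrow> real \<Rightarrow> real \<Rightarrow> bool" where
  "second_order_growth h c e \<longleftrightarrow> (\<forall>t h' x v l. 0 < t \<longrightarrow> t < e \<longrightarrow> dist h' h < e \<longrightarrow>
     dist x xb < e \<longrightarrow> dist v vb < e \<longrightarrow> multiplier x v l \<longrightarrow>
     \<phi> x + ereal (t * (v \<bullet> h') + c * (t\<^sup>2 / 2)) \<le> \<phi> (x + t *\<^sub>R h'))"

lemma subdifferential_near:
  obtains d where "d > 0" "ball xb d \<subseteq> U"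
    "\<And>x v. dist x xb < d \<Longrightarrow> v \<in> limiting_subdiff \<phi> x \<longleftrightarrow> (\<exists>l. multiplier x v l)"
proof -
  obtain W where W: "open W" "xb \<in> W" "W \<subseteq> U"
    "\<And>x v. x \<in> W \<Longrightarrow> v \<in> limiting_subdiff \<phi> x \<longleftrightarrow> (\<exists>l. multiplier x v l)"
    by (rule subdifferential_chain_rule) blast
  obtain d where d: "d > 0" "ball xb d \<subseteq> W" using W open_contains_ball by blast
  show thesis
  proof (rule that[OF d(1)])
    show "ball xb d \<subseteq> U" using d W by blast
    fix x v assume "dist x xb < d"
    then have "x \<in> W" using d(2) by (auto simp: dist_commute)
    then show "v \<in> limiting_subdiff \<phi> x \<longleftrightarrow> (\<exists>l. multiplier x v l)" by (rule W(4))
  qed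
qed

lemma vb_limiting: "vb \<in> limiting_subdiff \<phi> xb"
  by (rule regular_imp_limiting multiplier_imp_regular[OF xb_U multiplier_xb])+

lemma multiplier_near_ball:
  assumes "e > 0"
  obtains d where "d > 0" "\<And>x v l. dist x xb < d \<Longrightarrow> dist v vb < d \<Longrightarrow> multiplier x v l \<Longrightarrow> dist l lb < e"
proof -
  obtain W d where W: "open W" "xb \<in> W" "d > 0"
    "\<And>x v l. x \<in> W \<Longrightarrow> dist v vb < d \<Longrightarrow> multiplier x v l \<Longrightarrow> dist l lb < e"
    by (rule multiplier_near[OF assms]) blast
  obtain r where r: "r > 0" "ball xb r \<subseteq> W" using W open_contains_ball by blast
  show thesis
  proof (rule that[of "min d r"])
    fix x v l assume *: "dist x xb < min d r" "dist v vb < min d r" "multiplier x v l"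
    then have "x \<in> W" using r(2) by (auto simp: dist_commute)
    then show "dist l lb < e" using W(4)[OF _ _ *(3)] *(2) by simp
  qed (use W r in auto)
qed

lemma isCont_F_xb_ball:
  assumes "e > 0"
  obtains d where "d > 0" "\<And>x. dist x xb < d \<Longrightarrow> norm (F x) < e"
  using isCont_F[OF xb_U] assms unfolding continuous_at_eps_delta
  by (auto simp: F_xb dist_norm)

text \<open>Attentive convergence is automatic: \<open>\<phi> x = \<phi> xb + l \<bullet> F x\<close> with bounded multipliers \<open>l\<close>.\<close>

lemma attentive_gph_filter_eq:
  "attentive_gph_filter \<phi> xb vb = inf (nhds (xb, vb)) (principal (gph (limiting_subdiff \<phi>)))"
proof -
  let ?G = "inf (nhds (xb, vb)) (principal (gph (limiting_subdiff \<phi>)))"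
  let ?f = "\<lambda>p. real_of_ereal (\<phi> (fst p))"
  obtain p0 where p0: "\<phi> xb = ereal p0" using phi_finite by auto
  obtain d1 where d1: "d1 > 0" "ball xb d1 \<subseteq> U"
    "\<And>x v. dist x xb < d1 \<Longrightarrow> v \<in> limiting_subdiff \<phi> x \<longleftrightarrow> (\<exists>l. multiplier x v l)"
    by (rule subdifferential_near) blast
  obtain d2 where d2: "d2 > 0" "\<And>x v l. dist x xb < d2 \<Longrightarrow> dist v vb < d2 \<Longrightarrow> multiplier x v l \<Longrightarrow> dist l lb < 1"
    by (rule multiplier_near_ball[OF zero_less_one]) blast
  have lb1: "norm lb + 1 > 0" using norm_ge_zero[of lb] by linarith
  have val: "\<exists>l. \<phi> x = ereal (p0 + l \<bullet> F x) \<and> norm l \<le> norm lb + 1"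
    if near: "dist x xb < min d1 d2" "dist v vb < min d1 d2" "v \<in> limiting_subdiff \<phi> x" for x v
  proof -
    obtain l where l: "multiplier x v l" using near d1(3)[of x v] by auto
    have "x \<in> U" using near d1(2) by (auto simp: dist_commute)
    then have "\<phi> x = ereal (p0 + l \<bullet> F x)" using l p0 by (simp add: phi_multiplier)
    moreover have "norm l \<le> norm lb + 1"
      using d2(2)[OF _ _ l] near norm_triangle_sub[of l lb] by (simp add: dist_norm)
    ultimately show ?thesis by blast
  qed
  have "filterlim (\<lambda>(x, v). \<phi> x) (nhds (\<phi> xb)) ?G"
    unfolding p0
  proof (rule Lim_transform_eventually)
    show "((\<lambda>p. ereal (?f p)) \<longlongrightarrow> ereal p0) ?G"
    proof (intro tendsto_ereal tendstoI)
      fix e :: real assume e: "e > 0"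
      obtain d3 where d3: "d3 > 0" "\<And>x. dist x xb < d3 \<Longrightarrow> norm (F x) < e / (norm lb + 1)"
        using isCont_F_xb_ball[of "e / (norm lb + 1)"] e lb1 by auto
      show "\<forall>\<^sub>F p in ?G. dist (?f p) p0 < e"
        unfolding eventually_inf_nhds_gph
      proof (intro exI[of _ "min d3 (min d1 d2)"] conjI allI impI)
        fix x v assume *: "dist x xb < min d3 (min d1 d2)" "dist v vb < min d3 (min d1 d2)" "v \<in> limiting_subdiff \<phi> x"
        then obtain l where l: "\<phi> x = ereal (p0 + l \<bullet> F x)" "norm l \<le> norm lb + 1"
          using val[of x v] by auto
        have "\<bar>l \<bullet> F x\<bar> \<le> norm l * norm (F x)" by (rule Cauchy_Schwarz_ineq2)
        also have "\<dots> \<le> (norm lb + 1) * norm (F x)" using l(2) by (intro mult_right_mono) auto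
        also have "\<dots> < (norm lb + 1) * (e / (norm lb + 1))"
          using d3(2)[of x] * lb1 by (intro mult_strict_left_mono) auto
        also have "\<dots> = e" using lb1 by simp
        finally show "dist (?f (x, v)) p0 < e" by (simp add: l(1) dist_real_def)
      qed (use d1 d2 d3 in auto)
    qed
    show "\<forall>\<^sub>F p in ?G. ereal (?f p) = (case p of (x, v) \<Rightarrow> \<phi> x)"
      unfolding eventually_inf_nhds_gph
    proof (intro exI[of _ "min d1 d2"] conjI allI impI)
      fix x v assume *: "dist x xb < min d1 d2" "dist v vb < min d1 d2" "v \<in> limiting_subdiff \<phi> x"
      then show "ereal (?f (x, v)) = (case (x, v) of (x, v) \<Rightarrow> \<phi> x)"
        using val[of x v] by auto
    qed (use d1 d2 in auto)
  qed
  then have "?G \<le> filtercomap (\<lambda>(x, v). \<phi> x) (nhds (\<phi> xb))"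
    by (simp add: filterlim_iff_le_filtercomap)
  then have "inf (filtercomap (\<lambda>(x, v). \<phi> x) (nhds (\<phi> xb))) ?G = ?G" by (simp add: inf_absorb2)
  then show ?thesis unfolding attentive_gph_filter_def by (simp add: inf_left_commute)
qed

text \<open>A positive lower limit leaves room for a real \<open>c\<close> below it, and the product
  filter unpacks to a common radius. The chain rule exchanges subgradients for vectors with a
  multiplier.\<close>

lemma strict_second_subderiv_pos_iff:
  "strict_second_subderiv \<phi> xb vb h > 0 \<longleftrightarrow> (\<exists>c>0. \<exists>e>0. second_order_growth h c e)"
proof
  obtain d where d: "d > 0" "ball xb d \<subseteq> U"
    "\<And>x v. dist x xb < d \<Longrightarrow> v \<in> limiting_subdiff \<phi> x \<longleftrightarrow> (\<exists>l. multiplier x v l)"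
    by (rule subdifferential_near) blast
  let ?G = "inf (nhds (xb, vb)) (principal (gph (limiting_subdiff \<phi>)))"
  let ?q = "\<lambda>(t, h', x, v). second_quot \<phi> t x v h'"
  let ?F = "at_right 0 \<times>\<^sub>F (nhds h \<times>\<^sub>F ?G)"
  have L: "strict_second_subderiv \<phi> xb vb h = Liminf ?F ?q"
    by (simp add: strict_second_subderiv_def attentive_gph_filter_eq)
  show "\<exists>c>0. \<exists>e>0. second_order_growth h c e" if "strict_second_subderiv \<phi> xb vb h > 0"
  proof -
    from that obtain c where c: "0 < ereal c" "ereal c < Liminf ?F ?q"
      unfolding L using ereal_dense2 by blast
    have "\<forall>\<^sub>F p in ?F. ereal c < ?q p"
      by (rule iffD1[OF le_Liminf_iff order_refl, rule_format, OF c(2)])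
    then obtain Pt Pr where P: "eventually Pt (at_right 0)" "eventually Pr (nhds h \<times>\<^sub>F ?G)"
      "\<And>t r. Pt t \<Longrightarrow> Pr r \<Longrightarrow> ereal c < ?q (t, r)"
      unfolding eventually_prod_filter[of _ "at_right 0"] by auto
    from P(2) obtain Ph Pg where R: "eventually Ph (nhds h)" "eventually Pg ?G"
      "\<And>h' r. Ph h' \<Longrightarrow> Pg r \<Longrightarrow> Pr (h', r)"
      unfolding eventually_prod_filter by auto
    obtain e1 where e1: "e1 > 0" "\<And>t. 0 < t \<Longrightarrow> t < e1 \<Longrightarrow> Pt t"
      using P(1) unfolding eventually_at_right_field by auto
    obtain e2 where e2: "e2 > 0" "\<And>h'. dist h' h < e2 \<Longrightarrow> Ph h'"
      using R(1) unfolding eventually_nhds_metric by auto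
    obtain e3 where e3: "e3 > 0"
      "\<And>x v. dist x xb < e3 \<Longrightarrow> dist v vb < e3 \<Longrightarrow> v \<in> limiting_subdiff \<phi> x \<Longrightarrow> Pg (x, v)"
      using R(2) unfolding eventually_inf_nhds_gph by blast
    have "second_order_growth h c (min (min e1 e2) (min e3 d))"
      unfolding second_order_growth_def
    proof (intro allI impI)
      fix t h' x v l
      assume *: "0 < t" "t < min (min e1 e2) (min e3 d)" "dist h' h < min (min e1 e2) (min e3 d)"
        "dist x xb < min (min e1 e2) (min e3 d)" "dist v vb < min (min e1 e2) (min e3 d)" "multiplier x v l"
      have "v \<in> limiting_subdiff \<phi> x" using d(3) * by auto
      then have "ereal c < ?q (t, h', x, v)" using * by (intro P(3) R(3) e1 e2 e3) auto
      then have "ereal c \<le> second_quot \<phi> t x v h'" by simp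
      moreover have "\<bar>\<phi> x\<bar> \<noteq> \<infinity>"
        using d(2) * by (intro phi_finite_multiplier[of x v l]) (auto simp: dist_commute)
      ultimately show "\<phi> x + ereal (t * (v \<bullet> h') + c * (t\<^sup>2 / 2)) \<le> \<phi> (x + t *\<^sub>R h')"
        using *(1) by (simp add: second_quot_ge_iff)
    qed
    then show ?thesis using c(1) e1(1) e2(1) e3(1) d(1) by (intro exI[of _ c] exI[of _ "min (min e1 e2) (min e3 d)"] conjI) auto
  qed
  show "strict_second_subderiv \<phi> xb vb h > 0" if "\<exists>c>0. \<exists>e>0. second_order_growth h c e"
  proof -
    from that obtain c e where c: "c > 0" "e > 0" "second_order_growth h c e" by blast
    have G: "\<forall>\<^sub>F p in ?G. (case p of (x, v) \<Rightarrow> dist x xb < min e d \<and> dist v vb < e \<and> v \<in> limiting_subdiff \<phi> x)"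
      unfolding eventually_inf_nhds_gph using c(2) d(1) by (intro exI[of _ "min e d"]) auto
    have H: "\<forall>\<^sub>F h' in nhds h. dist h' h < e" unfolding eventually_nhds_metric using c(2) by auto
    have T: "\<forall>\<^sub>F t in at_right 0. 0 < t \<and> t < e" unfolding eventually_at_right_field using c(2) by auto
    have "\<forall>\<^sub>F p in ?F. ereal c \<le> ?q p"
      using eventually_prodI[OF T eventually_prodI[OF H G]]
    proof eventually_elim
      case (elim p)
      obtain t h' x v where p: "p = (t, h', x, v)" by (cases p)
      have *: "0 < t" "t < e" "dist h' h < e" "dist x xb < e" "dist x xb < d" "dist v vb < e"
        "v \<in> limiting_subdiff \<phi> x" using elim by (auto simp: p)
      obtain l where l: "multiplier x v l" using d(3) * by auto
      have "\<phi> x + ereal (t * (v \<bullet> h') + c * (t\<^sup>2 / 2)) \<le> \<phi> (x + t *\<^sub>R h')"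
        using c(3) * l unfolding second_order_growth_def by blast
      moreover have "\<bar>\<phi> x\<bar> \<noteq> \<infinity>"
        using d(2) * l by (intro phi_finite_multiplier[of x v l]) (auto simp: dist_commute)
      ultimately show ?case using *(1) by (simp add: p second_quot_ge_iff)
    qed
    then have "ereal c \<le> Liminf ?F ?q" by (rule Liminf_bounded)
    moreover have "0 < ereal c" using c(1) by simp
    ultimately show ?thesis unfolding L by (rule less_le_trans[rotated])
  qed
qed

section \<open>The curvature term and second-order growth\<close>

lemma second_order_uniform:
  assumes \<epsilon>: "\<epsilon> > 0"
  obtains e where "e > 0" "\<And>t h' x l. 0 < t \<Longrightarrow> t < e \<Longrightarrow> dist h' h < e \<Longrightarrow> dist x xb < e \<Longrightarrow> dist l lb < e \<Longrightarrow>
    x \<in> U \<and> x + t *\<^sub>R h' \<in> U \<and>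
    \<bar>l \<bullet> (F (x + t *\<^sub>R h') - F x) - t * (l \<bullet> D x h') - (lb \<bullet> D2 F xb h h) * (t\<^sup>2 / 2)\<bar> \<le> \<epsilon> * (t\<^sup>2 / 2)"
proof -
  \<comment> \<open>\<open>B\<close> bounds \<open>norm l\<close> times the square of
    \<open>norm h'\<close> near the reference data. With the remainder constant
    \<open>\<epsilon> / (4 * B)\<close> the Taylor error uses half of the tolerance; the other half
    covers the variation of \<open>l \<bullet> D2 F xb h' h'\<close> in
    \<open>(l, h')\<close>.\<close>
  define B where "B = (norm lb + 1) * (norm h + 1)\<^sup>2"
  have lb1: "norm lb + 1 > 0" "norm h + 1 > 0" using norm_ge_zero[of lb] norm_ge_zero[of h] by linarith+
  then have B: "B > 0" by (simp add: B_def)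
  have "((\<lambda>p. fst p \<bullet> D2 F xb (snd p) (snd p)) \<longlongrightarrow> fst (lb, h) \<bullet> D2 F xb (snd (lb, h)) (snd (lb, h))) (nhds (lb, h))"
    unfolding D2_def by (intro tendsto_inner blinfun.tendsto tendsto_const tendsto_fst tendsto_snd filterlim_ident)
  then have "\<forall>\<^sub>F p in nhds (lb, h). dist (fst p \<bullet> D2 F xb (snd p) (snd p)) (lb \<bullet> D2 F xb h h) < \<epsilon> / 2"
    using \<epsilon> by (auto dest!: tendstoD[where e = "\<epsilon> / 2"])
  then obtain e0 where e0: "e0 > 0" "\<And>p. dist p (lb, h) < e0 \<Longrightarrow>
      dist (fst p \<bullet> D2 F xb (snd p) (snd p)) (lb \<bullet> D2 F xb h h) < \<epsilon> / 2"
    unfolding eventually_nhds_metric by auto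
  obtain d where d: "d > 0" "ball xb d \<subseteq> U"
    "\<And>y z. y \<in> ball xb d \<Longrightarrow> z \<in> ball xb d \<Longrightarrow>
      norm (F z - F y - D y (z - y) - (1 / 2) *\<^sub>R D2 F xb (z - y) (z - y)) \<le> \<epsilon> / (4 * B) * (norm (z - y))\<^sup>2"
    using second_order_expansion[of "\<epsilon> / (4 * B)"] \<epsilon> B by auto
  obtain e1 where e1: "e1 > 0" "\<And>t h' x. 0 < t \<Longrightarrow> t < e1 \<Longrightarrow> dist h' h < e1 \<Longrightarrow> dist x xb < e1 \<Longrightarrow>
    x \<in> ball xb d \<and> x + t *\<^sub>R h' \<in> ball xb d"
    by (rule step_in_ball[OF d(1)]) blast
  define e where "e = min (e0 / 2) (min 1 e1)"
  have e: "e > 0" using e0(1) e1(1) by (simp add: e_def)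
  have e_le: "e \<le> e0 / 2" "e \<le> 1" "e \<le> e1" unfolding e_def by linarith+
  show thesis
  proof (rule that[OF e])
    fix t h' x l assume *: "0 < t" "t < e" "dist h' h < e" "dist x xb < e" "dist l lb < e"
    have nh: "norm h' \<le> norm h + 1" using *(3) e_le(2) norm_triangle_sub[of h' h] by (simp add: dist_norm)
    have nl: "norm l \<le> norm lb + 1" using *(5) e_le(2) norm_triangle_sub[of l lb] by (simp add: dist_norm)
    have x: "x \<in> ball xb d" and x': "x + t *\<^sub>R h' \<in> ball xb d"
      using e1(2)[of t h' x] * e_le(3) by auto
    define \<rho> where "\<rho> = F (x + t *\<^sub>R h') - F x - D x (t *\<^sub>R h') - (1 / 2) *\<^sub>R D2 F xb (t *\<^sub>R h') (t *\<^sub>R h')"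
    have "norm \<rho> \<le> \<epsilon> / (4 * B) * (norm (t *\<^sub>R h'))\<^sup>2" using d(3)[OF x x'] by (simp add: \<rho>_def)
    then have "\<bar>l \<bullet> \<rho>\<bar> \<le> norm l * (\<epsilon> / (4 * B) * (norm (t *\<^sub>R h'))\<^sup>2)"
      by (intro order_trans[OF Cauchy_Schwarz_ineq2] mult_left_mono) auto
    also have "\<dots> \<le> (norm lb + 1) * (\<epsilon> / (4 * B) * (t\<^sup>2 * (norm h + 1)\<^sup>2))"
      using nl nh \<epsilon> B by (intro mult_mono) (auto simp: power_mult_distrib intro!: mult_left_mono power_mono)
    also have "\<dots> = \<epsilon> / 2 * (t\<^sup>2 / 2)" using B by (simp add: B_def field_simps)
    finally have 1: "\<bar>l \<bullet> \<rho>\<bar> \<le> \<epsilon> / 2 * (t\<^sup>2 / 2)" .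
    have "dist (l, h') (lb, h) \<le> dist l lb + dist h' h"
      unfolding dist_Pair_Pair by (rule sqrt_sum_squares_le_sum) auto
    then have "dist (l, h') (lb, h) < e0" using * e_le(1) by linarith
    then have "\<bar>l \<bullet> D2 F xb h' h' - lb \<bullet> D2 F xb h h\<bar> \<le> \<epsilon> / 2"
      using e0(2)[of "(l, h')"] by (simp add: dist_real_def)
    then have 2: "\<bar>l \<bullet> D2 F xb h' h' - lb \<bullet> D2 F xb h h\<bar> * (t\<^sup>2 / 2) \<le> \<epsilon> / 2 * (t\<^sup>2 / 2)"
      by (rule mult_right_mono) simp
    have "l \<bullet> (F (x + t *\<^sub>R h') - F x) - t * (l \<bullet> D x h') - (lb \<bullet> D2 F xb h h) * (t\<^sup>2 / 2)
      = l \<bullet> \<rho> + (l \<bullet> D2 F xb h' h' - lb \<bullet> D2 F xb h h) * (t\<^sup>2 / 2)"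
      by (simp add: \<rho>_def D2_def blinfun.scaleR_right blinfun.scaleR_left inner_diff_right
          power2_eq_square algebra_simps)
    also have "\<bar>\<dots>\<bar> \<le> \<bar>l \<bullet> \<rho>\<bar> + \<bar>l \<bullet> D2 F xb h' h' - lb \<bullet> D2 F xb h h\<bar> * (t\<^sup>2 / 2)"
      by (rule order_trans[OF abs_triangle_ineq]) (simp add: abs_mult)
    also have "\<dots> \<le> \<epsilon> / 2 * (t\<^sup>2 / 2) + \<epsilon> / 2 * (t\<^sup>2 / 2)" by (rule add_mono[OF 1 2])
    also have "\<dots> = \<epsilon> * (t\<^sup>2 / 2)" by simp
    finally show "x \<in> U \<and> x + t *\<^sub>R h' \<in> U \<and>
      \<bar>l \<bullet> (F (x + t *\<^sub>R h') - F x) - t * (l \<bullet> D x h') - (lb \<bullet> D2 F xb h h) * (t\<^sup>2 / 2)\<bar> \<le> \<epsilon> * (t\<^sup>2 / 2)"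
      using x x' d(2) by blast
  qed
qed

lemma multiplier_second_order:
  assumes \<epsilon>: "\<epsilon> > 0"
  obtains e where "e > 0" "\<And>t h' x v l. 0 < t \<Longrightarrow> t < e \<Longrightarrow> dist h' h < e \<Longrightarrow> dist x xb < e \<Longrightarrow>
    dist v vb < e \<Longrightarrow> multiplier x v l \<Longrightarrow> x \<in> U \<and> x + t *\<^sub>R h' \<in> U \<and>
    t * (v \<bullet> h') + (lb \<bullet> D2 F xb h h - \<epsilon>) * (t\<^sup>2 / 2) \<le> l \<bullet> (F (x + t *\<^sub>R h') - F x)"
proof -
  obtain e1 where e1: "e1 > 0" "\<And>t h' x l. 0 < t \<Longrightarrow> t < e1 \<Longrightarrow> dist h' h < e1 \<Longrightarrow> dist x xb < e1 \<Longrightarrow> dist l lb < e1 \<Longrightarrow>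
    x \<in> U \<and> x + t *\<^sub>R h' \<in> U \<and>
    \<bar>l \<bullet> (F (x + t *\<^sub>R h') - F x) - t * (l \<bullet> D x h') - (lb \<bullet> D2 F xb h h) * (t\<^sup>2 / 2)\<bar> \<le> \<epsilon> * (t\<^sup>2 / 2)"
    by (rule second_order_uniform[OF \<epsilon>, of h]) blast
  obtain e2 where e2: "e2 > 0" "\<And>x v l. dist x xb < e2 \<Longrightarrow> dist v vb < e2 \<Longrightarrow> multiplier x v l \<Longrightarrow> dist l lb < e1"
    by (rule multiplier_near_ball[OF e1(1)]) blast
  show thesis
  proof (rule that[of "min e1 e2"])
    fix t h' x v l
    assume *: "0 < t" "t < min e1 e2" "dist h' h < min e1 e2" "dist x xb < min e1 e2"
      "dist v vb < min e1 e2" and l: "multiplier x v l"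
    have "dist l lb < e1" using * by (intro e2(2)[OF _ _ l]) auto
    then have **: "x \<in> U \<and> x + t *\<^sub>R h' \<in> U \<and>
      \<bar>l \<bullet> (F (x + t *\<^sub>R h') - F x) - t * (l \<bullet> D x h') - (lb \<bullet> D2 F xb h h) * (t\<^sup>2 / 2)\<bar> \<le> \<epsilon> * (t\<^sup>2 / 2)"
      using * by (intro e1(2)) auto
    then have "\<bar>l \<bullet> (F (x + t *\<^sub>R h') - F x) - t * (v \<bullet> h') - (lb \<bullet> D2 F xb h h) * (t\<^sup>2 / 2)\<bar> \<le> \<epsilon> * (t\<^sup>2 / 2)"
      using l by (simp add: multiplier_def)
    then have "t * (v \<bullet> h') + (lb \<bullet> D2 F xb h h - \<epsilon>) * (t\<^sup>2 / 2) \<le> l \<bullet> (F (x + t *\<^sub>R h') - F x)"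
      unfolding left_diff_distrib by linarith
    with ** show "x \<in> U \<and> x + t *\<^sub>R h' \<in> U \<and>
      t * (v \<bullet> h') + (lb \<bullet> D2 F xb h h - \<epsilon>) * (t\<^sup>2 / 2) \<le> l \<bullet> (F (x + t *\<^sub>R h') - F x)"
      by blast
  qed (use e1 e2 in auto)
qed

text \<open>Testing the support function at the new point with the old multiplier \<open>l\<close>
  leaves the curvature term alone; the tolerance is the whole gap to \<open>c\<close>.\<close>

lemma curvature_imp_second_order_growth:
  assumes "c < lb \<bullet> D2 F xb h h"
  shows "\<exists>e>0. second_order_growth h c e"
proof -
  have pos: "lb \<bullet> D2 F xb h h - c > 0" using assms by simp
  obtain e where e: "e > 0" "\<And>t h' x v l. 0 < t \<Longrightarrow> t < e \<Longrightarrow> dist h' h < e \<Longrightarrow> dist x xb < e \<Longrightarrow>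
    dist v vb < e \<Longrightarrow> multiplier x v l \<Longrightarrow> x \<in> U \<and> x + t *\<^sub>R h' \<in> U \<and>
    t * (v \<bullet> h') + (lb \<bullet> D2 F xb h h - (lb \<bullet> D2 F xb h h - c)) * (t\<^sup>2 / 2) \<le> l \<bullet> (F (x + t *\<^sub>R h') - F x)"
    by (rule multiplier_second_order[OF pos, of h]) blast
  have "second_order_growth h c e"
    unfolding second_order_growth_def
  proof (intro allI impI)
    fix t h' x v l
    assume *: "0 < t" "t < e" "dist h' h < e" "dist x xb < e" "dist v vb < e" and l: "multiplier x v l"
    have **: "x \<in> U" "x + t *\<^sub>R h' \<in> U"
      "t * (v \<bullet> h') + c * (t\<^sup>2 / 2) \<le> l \<bullet> F (x + t *\<^sub>R h') - l \<bullet> F x"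
      using e(2)[OF * l] by (auto simp: inner_diff_right)
    have "\<phi> x + ereal (t * (v \<bullet> h') + c * (t\<^sup>2 / 2)) \<le> \<phi> x + ereal (l \<bullet> F (x + t *\<^sub>R h') - l \<bullet> F x)"
      using **(3) by (intro add_left_mono) simp
    also have "\<dots> \<le> \<phi> (x + t *\<^sub>R h')"
      using l by (intro phi_lower[OF **(1,2) l]) (simp add: multiplier_def)
    finally show "\<phi> x + ereal (t * (v \<bullet> h') + c * (t\<^sup>2 / 2)) \<le> \<phi> (x + t *\<^sub>R h')" .
  qed
  then show ?thesis using e(1) by blast
qed

text \<open>Points with \<open>F x \<in> N\<close> keep \<open>lb\<close> as a multiplier. Their
  subgradients \<open>adjoint (D x) lb\<close> must be close to \<open>vb\<close> to enter the
  strict second subderivative.\<close>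

lemma vb_close:
  assumes "e > 0"
  obtains d where "d > 0" "\<And>x. dist x xb < d \<Longrightarrow> x \<in> U \<and> dist (adjoint (D x) lb) vb < e"
proof -
  have lb1: "norm lb + 1 > 0" using norm_ge_zero[of lb] by linarith
  have pos: "e / (norm lb + 1) > 0" using assms lb1 by simp
  obtain W where W: "open W" "xb \<in> W" "W \<subseteq> U"
    "\<And>x. x \<in> W \<Longrightarrow> norm (fderiv F x - fderiv F xb) < e / (norm lb + 1)"
    by (rule fderiv_close[OF pos]) blast
  obtain d where d: "d > 0" "ball xb d \<subseteq> W" using W open_contains_ball by blast
  show thesis
  proof (rule that[OF d(1)])
    fix x assume "dist x xb < d"
    then have x: "x \<in> W" using d(2) by (auto simp: dist_commute)
    define w where "w = adjoint (D x) lb - vb"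
    have "norm w * norm w = w \<bullet> w" by (simp add: dot_square_norm power2_eq_square)
    also have "\<dots> = lb \<bullet> ((fderiv F x - fderiv F xb) w)"
    proof -
      have "adjoint (D x) lb \<bullet> w = lb \<bullet> D x w"
        by (metis adjoint_works blinfun.bounded_linear_right bounded_linear.linear inner_commute)
      then show ?thesis 
        by (subst (1) w_def) (simp add: inner_diff_left vb_inner blinfun.diff_left inner_diff_right)
    qed
    also have "\<dots> \<le> norm lb * (norm (fderiv F x - fderiv F xb) * norm w)"
      by (rule order_trans[OF norm_cauchy_schwarz mult_left_mono[OF norm_blinfun norm_ge_zero]])
    finally have "norm w \<le> norm lb * norm (fderiv F x - fderiv F xb)"
      by (cases "norm w = 0") (auto simp: mult_ac)
    also have "\<dots> \<le> (norm lb + 1) * norm (fderiv F x - fderiv F xb)" by (intro mult_right_mono) auto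
    also have "\<dots> < (norm lb + 1) * (e / (norm lb + 1))"
      using W(4)[OF x] lb1 by (intro mult_strict_left_mono)
    also have "\<dots> = e" using lb1 by simp
    finally show "x \<in> U \<and> dist (adjoint (D x) lb) vb < e" using x W(3) by (auto simp: w_def dist_norm)
  qed
qed

text \<open>Write \<open>h = h1 - h2\<close> with critical directions and follow both normal paths.
  The base point \<open>x2\<close> has multiplier \<open>lb\<close>, and \<open>F x1 \<in> N\<close>
  makes \<open>\<phi> x1 - \<phi> x2\<close> equal to \<open>lb \<bullet> (F x1 - F x2)\<close>: the
  nonnegative support part vanishes, and the growth inequality bounds the curvature itself.\<close>

lemma second_order_growth_imp_curvature:
  assumes h: "h \<in> affine hull (critical_cone \<phi> xb vb)" and e: "e > 0" and g: "second_order_growth h c e"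
  shows "c \<le> lb \<bullet> D2 F xb h h"
proof (rule ccontr)
  assume "\<not> c \<le> lb \<bullet> D2 F xb h h"
  then have pos: "(c - lb \<bullet> D2 F xb h h) / 2 > 0" (is "?\<epsilon> > 0") by simp
  obtain h1 h2 where h12: "h = h1 - h2" "D xb h1 \<in> N" "D xb h2 \<in> N"
    using h unfolding affine_hull_critical_cone by blast
  obtain e1 where e1: "e1 > 0" "\<And>t h' x l. 0 < t \<Longrightarrow> t < e1 \<Longrightarrow> dist h' h < e1 \<Longrightarrow> dist x xb < e1 \<Longrightarrow> dist l lb < e1 \<Longrightarrow>
    x \<in> U \<and> x + t *\<^sub>R h' \<in> U \<and>
    \<bar>l \<bullet> (F (x + t *\<^sub>R h') - F x) - t * (l \<bullet> D x h') - (lb \<bullet> D2 F xb h h) * (t\<^sup>2 / 2)\<bar> \<le> ?\<epsilon> * (t\<^sup>2 / 2)"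
    by (rule second_order_uniform[OF pos, of h]) blast
  obtain e2 where e2: "e2 > 0" "\<And>x. dist x xb < e2 \<Longrightarrow> x \<in> U \<and> dist (adjoint (D x) lb) vb < e"
    by (rule vb_close[OF e]) blast
  define r where "r = min e (min e1 e2)"
  have r: "r > 0" using e e1 e2 by (simp add: r_def)
  \<comment> \<open>For \<open>t < T\<close> the base point \<open>x2\<close>, at distance at most
    \<open>t * (norm h2 + r / 3)\<close> from \<open>xb\<close>, stays within
    \<open>r\<close>.\<close>
  define T where "T = r / (norm h2 + r + 1)"
  have hr: "norm h2 + r + 1 > 0" using r norm_ge_zero[of h2] by linarith
  have T: "T > 0" using r hr by (simp add: T_def)
  \<comment> \<open>The deviations of the two paths add up to at most \<open>2 * r / 3\<close>,
    which is still less than \<open>r\<close>.\<close>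
  have r3: "r / 3 > 0" using r by simp
  have "\<forall>\<^sub>F t in at_right 0. (0::real) < t \<and> t < min r T"
    unfolding eventually_at_right_field using r T by (intro exI[of _ "min r T"]) auto
  with normal_path[OF h12(2) r3] normal_path[OF h12(3) r3]
  have "\<forall>\<^sub>F t in at_right (0::real). False"
  proof eventually_elim
    case (elim t)
    then have t: "0 < t" "t < r" "t < T" by auto
    obtain x1 where x1: "x1 \<in> U" "F x1 \<in> N" "norm (x1 - xb - t *\<^sub>R h1) \<le> r / 3 * t" using elim by auto
    obtain x2 where x2: "x2 \<in> U" "F x2 \<in> N" "norm (x2 - xb - t *\<^sub>R h2) \<le> r / 3 * t" using elim by auto
    define h' where "h' = (x1 - x2) /\<^sub>R t"
    have x1e: "x2 + t *\<^sub>R h' = x1" using t by (simp add: h'_def)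
    have "t *\<^sub>R (h' - h) = (x1 - xb - t *\<^sub>R h1) - (x2 - xb - t *\<^sub>R h2)"
      using t by (simp add: h'_def h12(1) algebra_simps)
    also have "norm \<dots> \<le> r / 3 * t + r / 3 * t"
      using norm_triangle_ineq4[of "x1 - xb - t *\<^sub>R h1" "x2 - xb - t *\<^sub>R h2"] x1(3) x2(3) by linarith
    finally have "norm (t *\<^sub>R (h' - h)) \<le> r / 3 * t + r / 3 * t" .
    then have "t * norm (h' - h) \<le> r / 3 * t + r / 3 * t" using t by simp
    then have "t * norm (h' - h) \<le> t * (2 * r / 3)" by (simp add: algebra_simps)
    then have h'r: "dist h' h < r" using t r by (simp add: dist_norm)
    have "norm (x2 - xb) \<le> norm (x2 - xb - t *\<^sub>R h2) + norm (t *\<^sub>R h2)"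
      by (metis diff_add_cancel norm_triangle_ineq)
    also have "\<dots> \<le> r / 3 * t + t * norm h2" using x2(3) t by simp
    also have "\<dots> \<le> t * (norm h2 + r + 1)" using t r by (simp add: algebra_simps)
    also have "\<dots> < r" using t(3) hr by (simp add: T_def field_simps)
    finally have x2r: "dist x2 xb < r" by (simp add: dist_norm)
    define v where "v = adjoint (D x2) lb"
    have vin: "v \<bullet> k = lb \<bullet> D x2 k" for k
      unfolding v_def
      by (metis adjoint_works blinfun.bounded_linear_right bounded_linear.linear inner_commute)
    have m: "multiplier x2 v lb" using lb_Q x2(2) vin by (simp add: multiplier_def)
    have ve: "dist v vb < e" unfolding v_def using e2(2)[of x2] x2r by (simp add: r_def)
    have G: "\<phi> x2 + ereal (t * (v \<bullet> h') + c * (t\<^sup>2 / 2)) \<le> \<phi> (x2 + t *\<^sub>R h')"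
      using g t h'r x2r ve m unfolding second_order_growth_def r_def by (metis min_less_iff_conj)
    have "t * (v \<bullet> h') + c * (t\<^sup>2 / 2) \<le> lb \<bullet> (F x1 - F x2)"
      using G phi_finite unfolding x1e
      by (cases "\<phi> xb")
         (auto simp: phi_eq[OF x1(1)] phi_eq[OF x2(1)] support_fun_normal[OF x1(2)] support_fun_normal[OF x2(2)] inner_diff_right)
    moreover have "\<bar>lb \<bullet> (F (x2 + t *\<^sub>R h') - F x2) - t * (lb \<bullet> D x2 h') - (lb \<bullet> D2 F xb h h) * (t\<^sup>2 / 2)\<bar> \<le> ?\<epsilon> * (t\<^sup>2 / 2)"
      using e1(2)[of t h' x2 lb] t h'r x2r e1(1) by (simp add: r_def)
    ultimately have "c * (t\<^sup>2 / 2) \<le> (lb \<bullet> D2 F xb h h) * (t\<^sup>2 / 2) + ?\<epsilon> * (t\<^sup>2 / 2)"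
      unfolding x1e vin by linarith
    also have "\<dots> = (lb \<bullet> D2 F xb h h + ?\<epsilon>) * (t\<^sup>2 / 2)" by (simp only: distrib_right)
    finally have "c \<le> lb \<bullet> D2 F xb h h + ?\<epsilon>"
      by (rule mult_right_le_imp_le) (use t in simp)
    then show False using pos by (simp add: field_simps)
  qed
  then show False by simp
qed

text \<open>Growth at \<open>h\<close> already covers all directions in a ball around
  \<open>h\<close>, so finitely many balls cover the unit sphere. An increment \<open>x' - x\<close>
  is \<open>t\<close> times a unit vector, and the smallest constants of the cover serve for all
  increments.\<close>

lemma second_order_growth_imp_uniform_growth:
  assumes "\<And>h. h \<noteq> 0 \<Longrightarrow> \<exists>c>0. \<exists>e>0. second_order_growth h c e"
  shows "uniform_growth \<phi> xb vb"
proof -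
  obtain d where d: "d > 0" "ball xb d \<subseteq> U"
    "\<And>x v. dist x xb < d \<Longrightarrow> v \<in> limiting_subdiff \<phi> x \<longleftrightarrow> (\<exists>l. multiplier x v l)"
    by (rule subdifferential_near) blast
  have "\<forall>h\<in>sphere 0 1. \<exists>c e. c > 0 \<and> e > 0 \<and> second_order_growth h c e"
  proof
    fix h :: 'a assume "h \<in> sphere 0 1"
    then have "h \<noteq> 0" by auto
    then show "\<exists>c e. c > 0 \<and> e > 0 \<and> second_order_growth h c e" using assms by blast
  qed
  then obtain c e where ce: "\<And>h. h \<in> sphere 0 1 \<Longrightarrow> c h > 0 \<and> e h > 0 \<and> second_order_growth h (c h) (e h)"
    by metis
  have cover: "sphere 0 1 \<subseteq> (\<Union>h\<in>sphere 0 1. ball h (e h))" using ce by force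
  obtain T where T: "T \<subseteq> sphere 0 1" "finite T" "sphere 0 1 \<subseteq> (\<Union>h\<in>T. ball h (e h))"
    using compactE_image[OF compact_sphere _ cover] open_ball by metis
  define \<sigma> where "\<sigma> = Min (insert 1 (c ` T))"
  define r where "r = Min (insert d (e ` T))"
  have \<sigma>: "\<sigma> > 0" "\<And>h. h \<in> T \<Longrightarrow> \<sigma> \<le> c h"
    using T(1,2) ce by (auto simp: \<sigma>_def)
  have r: "r > 0" "r \<le> d" "\<And>h. h \<in> T \<Longrightarrow> r \<le> e h"
    using T(1,2) ce d(1) by (auto simp: r_def)
  have growth: "\<phi> x + ereal (v \<bullet> (x' - x)) + ereal (\<sigma> / 2 * (norm (x - x'))\<^sup>2) \<le> \<phi> x'"
    if x: "x \<in> ball xb (r / 2)" and v: "v \<in> ball vb r" and xv: "v \<in> limiting_subdiff \<phi> x"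
      and x': "x' \<in> ball xb (r / 2)" for x v x'
  proof (cases "x' = x")
    case True
    then show ?thesis by simp
  next
    case False
    have "dist x xb < d" using x r by (simp add: dist_commute)
    then obtain l where l: "multiplier x v l" using d(3) xv by blast
    define t where "t = norm (x' - x)"
    have t: "t > 0" using False by (simp add: t_def)
    have tr: "t < r"
      using x x' norm_triangle_ineq4[of "x' - xb" "x - xb"]
      by (simp add: t_def dist_norm norm_minus_commute)
    define k where "k = (x' - x) /\<^sub>R t"
    have "k \<in> sphere 0 1" using t by (simp add: k_def t_def)
    then obtain h where h: "h \<in> T" "k \<in> ball h (e h)" using T(3) by blast
    have xk: "x + t *\<^sub>R k = x'" using t by (simp add: k_def)
    have "second_order_growth h (c h) (e h)" using ce h(1) T(1) by blast
    moreover have "t < e h" "dist k h < e h" "dist x xb < e h" "dist v vb < e h"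
      using tr r(1) r(3)[OF h(1)] h(2) x v by (auto simp: dist_commute)
    ultimately have G: "\<phi> x + ereal (t * (v \<bullet> k) + c h * (t\<^sup>2 / 2)) \<le> \<phi> x'"
      using t l xk unfolding second_order_growth_def by metis
    have "v \<bullet> (x' - x) = t * (v \<bullet> k)" using t by (simp add: k_def)
    moreover have "\<sigma> / 2 * (norm (x - x'))\<^sup>2 \<le> c h * (t\<^sup>2 / 2)"
      using mult_right_mono[OF \<sigma>(2)[OF h(1)], of "t\<^sup>2 / 2"] by (simp add: t_def norm_minus_commute)
    ultimately have "\<phi> x + ereal (v \<bullet> (x' - x)) + ereal (\<sigma> / 2 * (norm (x - x'))\<^sup>2)
        \<le> \<phi> x + ereal (t * (v \<bullet> k) + c h * (t\<^sup>2 / 2))"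
      by (cases "\<phi> x") auto
    then show ?thesis using G by (rule order_trans)
  qed
  show ?thesis
    unfolding uniform_growth_def
    by (intro exI[of _ "ball xb (r / 2)"] exI[of _ "ball vb r"] exI[of _ \<sigma>] conjI)
       (use r(1) \<sigma>(1) growth in \<open>auto simp: gph_def\<close>)
qed

lemma uniform_growth_imp_second_order_growth:
  assumes "uniform_growth \<phi> xb vb" "h \<noteq> 0"
  shows "\<exists>c>0. \<exists>e>0. second_order_growth h c e"
proof -
  obtain A V \<sigma> where A: "open A" "xb \<in> A" "open V" "vb \<in> V" "\<sigma> > 0"
    and growth: "\<And>x v x'. x \<in> A \<Longrightarrow> v \<in> V \<Longrightarrow> v \<in> limiting_subdiff \<phi> x \<Longrightarrow> x' \<in> A \<Longrightarrow>
      \<phi> x + ereal (v \<bullet> (x' - x)) + ereal (\<sigma> / 2 * (norm (x - x'))\<^sup>2) \<le> \<phi> x'"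
    using assms(1) unfolding uniform_growth_def gph_def by fast
  obtain a where a: "a > 0" "ball xb a \<subseteq> A" using A open_contains_ball by blast
  obtain b where b: "b > 0" "ball vb b \<subseteq> V" using A open_contains_ball by blast
  obtain d where d: "d > 0" "ball xb d \<subseteq> U" using open_U xb_U open_contains_ball by blast
  obtain e1 where e1: "e1 > 0" "\<And>t h' x. 0 < t \<Longrightarrow> t < e1 \<Longrightarrow> dist h' h < e1 \<Longrightarrow> dist x xb < e1 \<Longrightarrow>
    x \<in> ball xb (min a d) \<and> x + t *\<^sub>R h' \<in> ball xb (min a d)"
    by (rule step_in_ball[of "min a d"]) (use a d in auto)
  \<comment> \<open>The bound \<open>norm h / 2\<close> keeps \<open>norm h'\<close> at least
    \<open>norm h / 2\<close>, whence the constant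
    \<open>\<sigma> * (norm h)\<^sup>2 / 4\<close>.\<close>
  define e where "e = min (norm h / 2) (min b e1)"
  have h: "norm h > 0" using assms(2) by simp
  have e: "e > 0" using h b(1) e1(1) by (simp add: e_def)
  have e_le: "e \<le> norm h / 2" "e \<le> b" "e \<le> e1" unfolding e_def by linarith+
  have "second_order_growth h (\<sigma> * (norm h)\<^sup>2 / 4) e"
    unfolding second_order_growth_def
  proof (intro allI impI)
    fix t h' x v l
    assume *: "0 < t" "t < e" "dist h' h < e" "dist x xb < e" "dist v vb < e" and l: "multiplier x v l"
    have mem: "x \<in> ball xb (min a d) \<and> x + t *\<^sub>R h' \<in> ball xb (min a d)"
      using * e_le(3) by (intro e1(2)) auto
    have x: "x \<in> A" and x': "x + t *\<^sub>R h' \<in> A" and "x \<in> U" using mem a(2) d(2) by auto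
    then have S: "v \<in> limiting_subdiff \<phi> x"
      using l by (intro regular_imp_limiting multiplier_imp_regular)
    have nh': "norm h / 2 \<le> norm h'"
      using *(3) e_le(1) norm_triangle_sub[of h h'] by (simp add: dist_norm norm_minus_commute)
    have v: "v \<in> V" using *(5) e_le(2) b(2) by (auto simp: dist_commute)
    have "(norm h / 2)\<^sup>2 \<le> (norm h')\<^sup>2" using nh' by (intro power_mono) auto
    then have "\<sigma> * (t\<^sup>2 / 2) * (norm h / 2)\<^sup>2 \<le> \<sigma> * (t\<^sup>2 / 2) * (norm h')\<^sup>2"
      using A(5) by (intro mult_left_mono) auto
    then have "\<sigma> * (norm h)\<^sup>2 / 4 * (t\<^sup>2 / 2) \<le> \<sigma> / 2 * (norm (x - (x + t *\<^sub>R h')))\<^sup>2"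
      by (simp add: power_mult_distrib power_divide algebra_simps)
    then have "\<phi> x + ereal (t * (v \<bullet> h') + \<sigma> * (norm h)\<^sup>2 / 4 * (t\<^sup>2 / 2))
        \<le> \<phi> x + ereal (v \<bullet> ((x + t *\<^sub>R h') - x)) + ereal (\<sigma> / 2 * (norm (x - (x + t *\<^sub>R h')))\<^sup>2)"
      by (cases "\<phi> x") auto
    also have "\<dots> \<le> \<phi> (x + t *\<^sub>R h')" by (rule growth[OF x v S x'])
    finally show "\<phi> x + ereal (t * (v \<bullet> h') + \<sigma> * (norm h)\<^sup>2 / 4 * (t\<^sup>2 / 2)) \<le> \<phi> (x + t *\<^sub>R h')" .
  qed
  moreover have "\<sigma> * (norm h)\<^sup>2 / 4 > 0" using A(5) h by simp
  ultimately show ?thesis using e by blast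
qed

end

subsection \<open>Tangent paths and the main result\<close>

text \<open>The inner limit of the subspaces \<open>S l\<close> carries \<open>w\<close> to some
  \<open>y \<in> S l\<close> for \<open>l\<close> near \<open>l0\<close>; a contradiction argument
  turns the sequential limit into one radius. After normalization the path constants apply, common
  to all these \<open>l\<close>.\<close>

lemma UTP_uniform_direction:
  fixes Q :: "'b::euclidean_space set"
  assumes utp: "UTP_property Q l0" and w: "w \<in> lineality (tangent_cone Q l0)" and a: "w \<bullet> z > 0"
  obtains \<beta> \<delta> M r where "\<beta> > 0" "\<delta> > 0" "M > 0" "r > 0"
    "\<And>l. l \<in> Q \<Longrightarrow> dist l l0 < r \<Longrightarrow> \<exists>u. norm u = 1 \<and> u \<in> lineality (tangent_cone Q l) \<and> \<beta> \<le> u \<bullet> z \<and>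
      (\<forall>t. 0 \<le> t \<longrightarrow> t \<le> \<delta> \<longrightarrow> (\<exists>s. norm s \<le> M \<and> l + t *\<^sub>R u + (t\<^sup>2 / 2) *\<^sub>R s \<in> Q))"
proof -
  obtain \<delta> M V S where \<delta>: "\<delta> > 0" "M > 0" "open V" "l0 \<in> V"
    and S: "\<forall>l\<in>Q \<inter> V. subspace (S l) \<and> S l \<subseteq> lineality (tangent_cone Q l)"
    and pk: "pk_converges S (Q \<inter> V) l0 (lineality (tangent_cone Q l0))"
    and path: "\<forall>l\<in>Q \<inter> V. \<forall>v\<in>S l. norm v = 1 \<longrightarrow> (\<exists>\<xi> s. continuous_on {0..\<delta>} \<xi> \<and>
        (\<forall>t\<in>{0..\<delta>}. \<xi> t \<in> Q \<and> \<xi> t = l + t *\<^sub>R v + (t\<^sup>2 / 2) *\<^sub>R s t \<and> norm (s t) \<le> M))"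
    using utp unfolding UTP_property_def by (elim exE conjE) (rule that; assumption)
  note S = S[rule_format] and path = path[rule_format]
  \<comment> \<open>A lower bound for \<open>y \<bullet> z / norm y\<close> when
    \<open>y \<bullet> z\<close> exceeds half of \<open>w \<bullet> z\<close> and
    \<open>norm y\<close> is below \<open>norm w + 1\<close>.\<close>
  define \<beta> where "\<beta> = w \<bullet> z / 2 / (norm w + 1)"
  have w1: "norm w + 1 > 0" using norm_ge_zero[of w] by linarith
  have \<beta>: "\<beta> > 0" using a w1 by (simp add: \<beta>_def)
  have "\<exists>r>0. \<forall>l\<in>Q \<inter> V. dist l l0 < r \<longrightarrow> (\<exists>y\<in>S l. w \<bullet> z / 2 < y \<bullet> z \<and> norm y < norm w + 1)"
  proof (rule ccontr)
    assume neg: "\<not> ?thesis"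
    have "\<forall>k. \<exists>l\<in>Q \<inter> V. dist l l0 < inverse (real (Suc k)) \<and> \<not> (\<exists>y\<in>S l. w \<bullet> z / 2 < y \<bullet> z \<and> norm y < norm w + 1)"
    proof
      fix k
      have "inverse (real (Suc k)) > 0" by simp
      then show "\<exists>l\<in>Q \<inter> V. dist l l0 < inverse (real (Suc k)) \<and> \<not> (\<exists>y\<in>S l. w \<bullet> z / 2 < y \<bullet> z \<and> norm y < norm w + 1)"
        using neg by blast
    qed
    then obtain X where X: "\<And>k. X k \<in> Q \<inter> V" "\<And>k. dist (X k) l0 < inverse (real (Suc k))"
      "\<And>k y. y \<in> S (X k) \<Longrightarrow> \<not> (w \<bullet> z / 2 < y \<bullet> z \<and> norm y < norm w + 1)"
      by metis
    have "X \<longlonglongrightarrow> l0"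
      using X(2) by (intro metric_tendsto_imp_tendsto[OF LIMSEQ_inverse_real_of_nat])
        (auto intro!: always_eventually simp: less_imp_le)
    moreover have "w \<in> pk_liminf S (Q \<inter> V) l0" using pk w by (simp add: pk_converges_def)
    ultimately obtain Y where Y: "\<forall>\<^sub>F k in sequentially. Y k \<in> S (X k)" "Y \<longlonglongrightarrow> w"
      unfolding pk_liminf_def using X(1) by blast
    have "\<forall>\<^sub>F k in sequentially. w \<bullet> z / 2 < Y k \<bullet> z"
      using a by (intro order_tendstoD(1)[OF tendsto_inner[OF Y(2) tendsto_const]]) simp
    moreover have "\<forall>\<^sub>F k in sequentially. norm (Y k) < norm w + 1"
      by (intro order_tendstoD(2)[OF tendsto_norm[OF Y(2)]]) simp
    moreover note Y(1)
    ultimately have "\<forall>\<^sub>F k in sequentially. False"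
      by eventually_elim (use X(3) in blast)
    then show False by simp
  qed
  then obtain r1 where r1: "r1 > 0" "\<And>l. l \<in> Q \<inter> V \<Longrightarrow> dist l l0 < r1 \<Longrightarrow>
      \<exists>y\<in>S l. w \<bullet> z / 2 < y \<bullet> z \<and> norm y < norm w + 1" by blast
  obtain r2 where r2: "r2 > 0" "ball l0 r2 \<subseteq> V" using \<delta>(3,4) open_contains_ball by blast
  show thesis
  proof (rule that[OF \<beta> \<delta>(1,2)])
    show "min r1 r2 > 0" using r1 r2 by simp
    fix l assume l: "l \<in> Q" "dist l l0 < min r1 r2"
    have lV: "l \<in> Q \<inter> V" using l r2(2) by (auto simp: dist_commute)
    obtain y where y: "y \<in> S l" "w \<bullet> z / 2 < y \<bullet> z" "norm y < norm w + 1"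
      using r1(2)[OF lV] l by auto
    have "y \<bullet> z > 0" using y(2) a by simp
    then have ny: "norm y > 0" by auto
    define u where "u = y /\<^sub>R norm y"
    have u: "norm u = 1" "u \<in> S l" using ny y(1) S[OF lV] by (auto simp: u_def subspace_scale)
    have "\<beta> \<le> y \<bullet> z / norm y"
      unfolding \<beta>_def using y(2,3) a ny by (intro frac_le) auto
    then have "\<beta> \<le> u \<bullet> z" by (simp add: u_def divide_inverse mult.commute)
    moreover obtain \<xi> s where "\<forall>t\<in>{0..\<delta>}. \<xi> t \<in> Q \<and> \<xi> t = l + t *\<^sub>R u + (t\<^sup>2 / 2) *\<^sub>R s t \<and> norm (s t) \<le> M"
      using path[OF lV u(2,1)] by blast
    then have "\<forall>t. 0 \<le> t \<longrightarrow> t \<le> \<delta> \<longrightarrow> (\<exists>s. norm s \<le> M \<and> l + t *\<^sub>R u + (t\<^sup>2 / 2) *\<^sub>R s \<in> Q)"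
      by (metis atLeastAtMost_iff)
    ultimately show "\<exists>u. norm u = 1 \<and> u \<in> lineality (tangent_cone Q l) \<and> \<beta> \<le> u \<bullet> z \<and>
      (\<forall>t. 0 \<le> t \<longrightarrow> t \<le> \<delta> \<longrightarrow> (\<exists>s. norm s \<le> M \<and> l + t *\<^sub>R u + (t\<^sup>2 / 2) *\<^sub>R s \<in> Q))"
      using u S[OF lV] by blast
  qed
qed

context strict_decomposition
begin

text \<open>Strict differentiability gives all nearby base points the same linear part
  \<open>t *\<^sub>R D xb h\<close>. The smallness of \<open>F (x + t *\<^sub>R h')\<close> serves
  to control the second-order part of a tangent path.\<close>

lemma first_order_uniform:
  assumes \<epsilon>: "\<epsilon> > 0"
  obtains e where "e > 0" "\<And>t h' x. 0 < t \<Longrightarrow> t < e \<Longrightarrow> dist h' h < e \<Longrightarrow> dist x xb < e \<Longrightarrow>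
    norm (F (x + t *\<^sub>R h') - F x - t *\<^sub>R D xb h) \<le> \<epsilon> * t \<and> norm (F (x + t *\<^sub>R h')) \<le> \<epsilon>"
proof -
  define A where "A = norm (fderiv F xb)"
  have pos: "norm h + 1 > 0" "A + 1 > 0" using norm_ge_zero[of h] norm_ge_zero[of "fderiv F xb"] unfolding A_def by linarith+
  have \<epsilon>1: "\<epsilon> / (2 * (norm h + 1)) > 0" using \<epsilon> pos by simp
  obtain d1 where d1: "d1 > 0" "ball xb d1 \<subseteq> U" "\<And>y z. y \<in> ball xb d1 \<Longrightarrow> z \<in> ball xb d1 \<Longrightarrow>
      norm (F z - F y - D xb (z - y)) \<le> \<epsilon> / (2 * (norm h + 1)) * norm (z - y)"
    using strict_derivative[OF open_U xb_U F_deriv isCont_fderiv[OF xb_U] \<epsilon>1] by metis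
  obtain d2 where d2: "d2 > 0" "\<And>x. dist x xb < d2 \<Longrightarrow> norm (F x) < \<epsilon>"
    by (rule isCont_F_xb_ball[OF \<epsilon>]) blast
  obtain e1 where e1: "e1 > 0" "\<And>t h' x. 0 < t \<Longrightarrow> t < e1 \<Longrightarrow> dist h' h < e1 \<Longrightarrow> dist x xb < e1 \<Longrightarrow>
    x \<in> ball xb (min d1 d2) \<and> x + t *\<^sub>R h' \<in> ball xb (min d1 d2)"
    by (rule step_in_ball[of "min d1 d2"]) (use d1 d2 in auto)
  define e where "e = min e1 (min 1 (\<epsilon> / (2 * (A + 1))))"
  have e: "e > 0" using e1(1) \<epsilon> pos by (simp add: e_def)
  have e_le: "e \<le> e1" "e \<le> 1" "e \<le> \<epsilon> / (2 * (A + 1))" unfolding e_def by linarith+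
  show thesis
  proof (rule that[OF e])
    fix t h' x assume *: "0 < t" "t < e" "dist h' h < e" "dist x xb < e"
    have nh: "norm h' \<le> norm h + 1" using *(3) e_le(2) norm_triangle_sub[of h' h] by (simp add: dist_norm)
    have mem: "x \<in> ball xb (min d1 d2) \<and> x + t *\<^sub>R h' \<in> ball xb (min d1 d2)"
      using * e_le(1) by (intro e1(2)) auto
    have "norm (F (x + t *\<^sub>R h') - F x - D xb (t *\<^sub>R h')) \<le> \<epsilon> / (2 * (norm h + 1)) * (t * norm h')"
      using d1(3)[of x "x + t *\<^sub>R h'"] mem *(1) by simp
    also have "\<dots> \<le> \<epsilon> / (2 * (norm h + 1)) * (t * (norm h + 1))"
      using nh \<epsilon>1 *(1) by (intro mult_left_mono) auto
    also have "\<dots> = \<epsilon> / 2 * t"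
    proof -
      have "\<epsilon> / (2 * n) * (t * n) = \<epsilon> / 2 * t" if "n > 0" for n :: real using that by simp
      then show ?thesis using pos(1) .
    qed
    finally have 1: "norm (F (x + t *\<^sub>R h') - F x - D xb (t *\<^sub>R h')) \<le> \<epsilon> / 2 * t" .
    have "norm (D xb (h' - h)) \<le> A * norm (h' - h)" unfolding A_def by (rule norm_blinfun)
    also have "\<dots> \<le> (A + 1) * (\<epsilon> / (2 * (A + 1)))"
      using *(3) e_le(3) pos by (intro mult_mono) (auto simp: dist_norm)
    also have "\<dots> = \<epsilon> / 2"
    proof -
      have "n * (\<epsilon> / (2 * n)) = \<epsilon> / 2" if "n > 0" for n :: real using that by simp
      then show ?thesis using pos(2) .
    qed
    finally have "t * norm (D xb (h' - h)) \<le> t * (\<epsilon> / 2)" using *(1) by (intro mult_left_mono) auto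
    then have 2: "norm (t *\<^sub>R D xb (h' - h)) \<le> \<epsilon> / 2 * t" using *(1) by (simp add: mult.commute)
    have "F (x + t *\<^sub>R h') - F x - t *\<^sub>R D xb h
        = (F (x + t *\<^sub>R h') - F x - D xb (t *\<^sub>R h')) + t *\<^sub>R D xb (h' - h)"
      by (simp add: blinfun.scaleR_right blinfun.diff_right scaleR_diff_right)
    also have "norm \<dots> \<le> \<epsilon> / 2 * t + \<epsilon> / 2 * t" by (rule norm_triangle_mono[OF 1 2])
    also have "\<dots> = \<epsilon> * t" by simp
    finally have "norm (F (x + t *\<^sub>R h') - F x - t *\<^sub>R D xb h) \<le> \<epsilon> * t" .
    moreover have "norm (F (x + t *\<^sub>R h')) \<le> \<epsilon>" using d2(2) mem by (simp add: dist_commute less_imp_le)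
    ultimately show "norm (F (x + t *\<^sub>R h') - F x - t *\<^sub>R D xb h) \<le> \<epsilon> * t \<and> norm (F (x + t *\<^sub>R h')) \<le> \<epsilon>" ..
  qed
qed

text \<open>If \<open>D xb h\<close> is not orthogonal to the lineality space, moving the multiplier \<open>l\<close> a distance
  \<open>K * t\<close> inside \<open>Q\<close> gains a multiple of \<open>K * t\<^sup>2\<close>, which dominates the bounded curvature term for
  large \<open>K\<close>; the bound on the second-order part of the tangent path keeps the loss at \<open>o(t\<^sup>2)\<close>.\<close>

lemma transversal_second_order_growth:
  assumes utp: "UTP_property Q lb" and w: "w \<in> lineality (tangent_cone Q lb)" and a: "w \<bullet> D xb h > 0"
  shows "\<exists>e>0. second_order_growth h 1 e"
proof -
  obtain \<beta> \<delta> M r where *: "\<beta> > 0" "\<delta> > 0" "M > 0" "r > 0"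
    and dir: "\<And>l. l \<in> Q \<Longrightarrow> dist l lb < r \<Longrightarrow> \<exists>u. norm u = 1 \<and> u \<in> lineality (tangent_cone Q l) \<and> \<beta> \<le> u \<bullet> D xb h \<and>
      (\<forall>t. 0 \<le> t \<longrightarrow> t \<le> \<delta> \<longrightarrow> (\<exists>s. norm s \<le> M \<and> l + t *\<^sub>R u + (t\<^sup>2 / 2) *\<^sub>R s \<in> Q))"
    by (rule UTP_uniform_direction[OF utp w a]) blast
  define q where "q = lb \<bullet> D2 F xb h h"
  \<comment> \<open>With \<open>\<beta> / 2 * t \<le> u \<bullet> F (x + t *\<^sub>R h')\<close> the
    displacement \<open>K * t\<close> gains \<open>(\<bar>q\<bar> + 4) * (t\<^sup>2 / 2)\<close>.
    This outweighs the curvature \<open>q - 1\<close>, the path loss 1 and the growth 1 to be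
    shown.\<close>
  define K where "K = (\<bar>q\<bar> + 4) / \<beta>"
  have K: "K > 0" using *(1) by (simp add: K_def add_nonneg_pos)
  \<comment> \<open>The first entry preserves half of the slope \<open>\<beta>\<close>; the second
    one limits the loss from the second-order part of the path to
    \<open>t\<^sup>2 / 2\<close>.\<close>
  define \<epsilon> where "\<epsilon> = min (\<beta> / 2) (1 / (K\<^sup>2 * M))"
  have \<epsilon>: "\<epsilon> > 0" using *(1,3) K by (simp add: \<epsilon>_def)
  have "\<epsilon> \<le> 1 / (K\<^sup>2 * M)" unfolding \<epsilon>_def by (rule min.cobounded2)
  then have \<epsilon>M: "K\<^sup>2 * M * \<epsilon> \<le> 1" using *(3) K by (simp add: field_simps)
  obtain e1 where e1: "e1 > 0" "\<And>t h' x. 0 < t \<Longrightarrow> t < e1 \<Longrightarrow> dist h' h < e1 \<Longrightarrow> dist x xb < e1 \<Longrightarrow>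
    norm (F (x + t *\<^sub>R h') - F x - t *\<^sub>R D xb h) \<le> \<epsilon> * t \<and> norm (F (x + t *\<^sub>R h')) \<le> \<epsilon>"
    by (rule first_order_uniform[OF \<epsilon>, of h]) blast
  obtain e2 where e2: "e2 > 0" "\<And>t h' x v l. 0 < t \<Longrightarrow> t < e2 \<Longrightarrow> dist h' h < e2 \<Longrightarrow> dist x xb < e2 \<Longrightarrow>
    dist v vb < e2 \<Longrightarrow> multiplier x v l \<Longrightarrow> x \<in> U \<and> x + t *\<^sub>R h' \<in> U \<and>
    t * (v \<bullet> h') + (q - 1) * (t\<^sup>2 / 2) \<le> l \<bullet> (F (x + t *\<^sub>R h') - F x)"
    unfolding q_def by (rule multiplier_second_order[OF zero_less_one, of h]) blast
  obtain e3 where e3: "e3 > 0" "\<And>x v l. dist x xb < e3 \<Longrightarrow> dist v vb < e3 \<Longrightarrow> multiplier x v l \<Longrightarrow> dist l lb < r"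
    by (rule multiplier_near_ball[OF *(4)]) blast
  define e where "e = min (min e1 e2) (min e3 (\<delta> / K))"
  have e: "e > 0" using e1 e2 e3 *(2) K by (simp add: e_def)
  have e_le: "e \<le> e1" "e \<le> e2" "e \<le> e3" "e \<le> \<delta> / K" unfolding e_def by linarith+
  have "second_order_growth h 1 e"
    unfolding second_order_growth_def
  proof (intro allI impI)
    fix t h' x v l
    assume t: "0 < t" "t < e" and h': "dist h' h < e" and x: "dist x xb < e" and v: "dist v vb < e"
      and l: "multiplier x v l"
    let ?z = "F (x + t *\<^sub>R h')"
    have lQ: "l \<in> Q" "F x \<in> normal_cone Q l" using l by (auto simp: multiplier_def)
    have "dist l lb < r" using x v e_le(3) by (intro e3(2)[OF _ _ l]) auto
    then obtain u where u: "norm u = 1" "u \<in> lineality (tangent_cone Q l)" "\<beta> \<le> u \<bullet> D xb h"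
      and path: "\<And>t. 0 \<le> t \<Longrightarrow> t \<le> \<delta> \<Longrightarrow> \<exists>s. norm s \<le> M \<and> l + t *\<^sub>R u + (t\<^sup>2 / 2) *\<^sub>R s \<in> Q"
      using dir[OF lQ(1)] by blast
    have Kt: "0 \<le> K * t" "K * t \<le> \<delta>"
    proof -
      have "t \<le> \<delta> / K" using t(2) e_le(4) by linarith
      then show "K * t \<le> \<delta>" using K by (simp add: field_simps)
    qed (use K t in simp)
    obtain s where s: "norm s \<le> M" "l + (K * t) *\<^sub>R u + ((K * t)\<^sup>2 / 2) *\<^sub>R s \<in> Q"
      using path[OF Kt] by blast
    have F1: "norm (?z - F x - t *\<^sub>R D xb h) \<le> \<epsilon> * t" "norm ?z \<le> \<epsilon>"
      using e1(2)[of t h' x] t h' x e_le(1) by auto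
    have U: "x \<in> U" "x + t *\<^sub>R h' \<in> U"
      and curv: "t * (v \<bullet> h') + (q - 1) * (t\<^sup>2 / 2) \<le> l \<bullet> (?z - F x)"
      using e2(2)[OF _ _ _ _ _ l, of t h'] t h' x v e_le(2) by auto
    have "- (u \<bullet> (?z - F x - t *\<^sub>R D xb h)) \<le> \<epsilon> * t"
      using Cauchy_Schwarz_ineq2[of u "?z - F x - t *\<^sub>R D xb h"] F1(1) u(1) by simp
    moreover have "\<epsilon> * t \<le> \<beta> / 2 * t" using t(1) by (intro mult_right_mono) (auto simp: \<epsilon>_def)
    moreover have "\<beta> * t \<le> (u \<bullet> D xb h) * t" using u(3) t(1) by (intro mult_right_mono) auto
    \<comment> \<open>Here \<open>u\<close> must belong to the lineality space at \<open>l\<close>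
      itself: \<open>F x\<close> is normal at \<open>l\<close>, so
      \<open>u \<bullet> F (x + t *\<^sub>R h')\<close> is the increment alone and grows linearly in
      \<open>t\<close>.\<close>
    moreover have "u \<bullet> F x = 0" by (rule lineality_inner_eq_0[OF u(2) lQ(2)])
    ultimately have uz: "\<beta> / 2 * t \<le> u \<bullet> ?z" by (simp add: inner_diff_right mult.commute)
    have "K * t * (\<beta> / 2 * t) \<le> K * t * (u \<bullet> ?z)" using uz Kt(1) by (intro mult_left_mono)
    moreover have "K * t * (\<beta> / 2 * t) = (\<bar>q\<bar> + 4) * (t\<^sup>2 / 2)"
      using *(1) by (simp add: K_def power2_eq_square)
    ultimately have gain: "(\<bar>q\<bar> + 4) * (t\<^sup>2 / 2) \<le> K * t * (u \<bullet> ?z)" by simp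
    have "\<bar>s \<bullet> ?z\<bar> \<le> norm s * norm ?z" by (rule Cauchy_Schwarz_ineq2)
    also have "\<dots> \<le> M * \<epsilon>" using s(1) F1(2) *(3) by (intro mult_mono) auto
    finally have "K\<^sup>2 * \<bar>s \<bullet> ?z\<bar> \<le> K\<^sup>2 * (M * \<epsilon>)" by (intro mult_left_mono) auto
    then have "K\<^sup>2 * \<bar>s \<bullet> ?z\<bar> \<le> 1" using \<epsilon>M by (simp add: mult.assoc)
    then have "(t\<^sup>2 / 2) * (K\<^sup>2 * \<bar>s \<bullet> ?z\<bar>) \<le> (t\<^sup>2 / 2) * 1" by (intro mult_left_mono) auto
    moreover have "- ((K * t)\<^sup>2 / 2 * (s \<bullet> ?z)) \<le> (t\<^sup>2 / 2) * (K\<^sup>2 * \<bar>s \<bullet> ?z\<bar>)"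
    proof -
      have "- ((K * t)\<^sup>2 / 2 * (s \<bullet> ?z)) = (t\<^sup>2 / 2 * K\<^sup>2) * (- (s \<bullet> ?z))"
        by (simp add: power_mult_distrib)
      also have "\<dots> \<le> (t\<^sup>2 / 2 * K\<^sup>2) * \<bar>s \<bullet> ?z\<bar>" by (intro mult_left_mono) auto
      finally show ?thesis by (simp add: mult.assoc)
    qed
    ultimately have loss: "- (t\<^sup>2 / 2) \<le> (K * t)\<^sup>2 / 2 * (s \<bullet> ?z)" by linarith
    have "1 * (t\<^sup>2 / 2) \<le> (q - 1 + (\<bar>q\<bar> + 4) - 1) * (t\<^sup>2 / 2)" by (intro mult_right_mono) auto
    also have "\<dots> = (q - 1) * (t\<^sup>2 / 2) + (\<bar>q\<bar> + 4) * (t\<^sup>2 / 2) - t\<^sup>2 / 2" by (simp add: field_simps)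
    finally have "t * (v \<bullet> h') + 1 * (t\<^sup>2 / 2) \<le> (l + (K * t) *\<^sub>R u + ((K * t)\<^sup>2 / 2) *\<^sub>R s) \<bullet> ?z - l \<bullet> F x"
      using curv gain loss unfolding inner_add_left inner_scaleR_left inner_diff_right by linarith
    then have "\<phi> x + ereal (t * (v \<bullet> h') + 1 * (t\<^sup>2 / 2))
        \<le> \<phi> x + ereal ((l + (K * t) *\<^sub>R u + ((K * t)\<^sup>2 / 2) *\<^sub>R s) \<bullet> ?z - l \<bullet> F x)"
      by (intro add_left_mono) simp
    also have "\<dots> \<le> \<phi> (x + t *\<^sub>R h')" by (rule phi_lower[OF U l s(2)])
    finally show "\<phi> x + ereal (t * (v \<bullet> h') + 1 * (t\<^sup>2 / 2)) \<le> \<phi> (x + t *\<^sub>R h')" .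
  qed
  then show ?thesis using e by blast
qed

lemma strict_second_subderiv_pos_iff_curvature:
  assumes utp: "UTP_property Q lb"
  shows "(\<forall>h. h \<noteq> 0 \<longrightarrow> strict_second_subderiv \<phi> xb vb h > 0) \<longleftrightarrow>
    (\<forall>h \<in> affine hull (critical_cone \<phi> xb vb) - {0}. lb \<bullet> D2 F xb h h > 0)"
proof
  assume "\<forall>h. h \<noteq> 0 \<longrightarrow> strict_second_subderiv \<phi> xb vb h > 0"
  then show "\<forall>h \<in> affine hull (critical_cone \<phi> xb vb) - {0}. lb \<bullet> D2 F xb h h > 0"
    unfolding strict_second_subderiv_pos_iff
    using second_order_growth_imp_curvature by (blast intro: less_le_trans)
next
  assume pos: "\<forall>h \<in> affine hull (critical_cone \<phi> xb vb) - {0}. lb \<bullet> D2 F xb h h > 0"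
  show "\<forall>h. h \<noteq> 0 \<longrightarrow> strict_second_subderiv \<phi> xb vb h > 0"
    unfolding strict_second_subderiv_pos_iff
  proof (intro allI impI)
    fix h :: 'a assume h: "h \<noteq> 0"
    show "\<exists>c>0. \<exists>e>0. second_order_growth h c e"
    proof (cases "h \<in> affine hull (critical_cone \<phi> xb vb)")
      case True
      then have "0 < lb \<bullet> D2 F xb h h" using pos h by blast
      then obtain c where "0 < c" "c < lb \<bullet> D2 F xb h h" using dense by blast
      then show ?thesis using curvature_imp_second_order_growth by blast
    next
      case False
      then obtain w where w: "w \<in> lineality (tangent_cone Q lb)" "w \<bullet> D xb h \<noteq> 0"
        using mem_affine_hull_critical_cone by blast
      then have "- w \<in> lineality (tangent_cone Q lb)" by (auto simp: lineality_def)
      then obtain w' where "w' \<in> lineality (tangent_cone Q lb)" "w' \<bullet> D xb h > 0"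
        using w by (metis inner_minus_left linorder_neqE_linordered_idom neg_0_less_iff_less)
      then show ?thesis using transversal_second_order_growth[OF utp] zero_less_one by blast
    qed
  qed
qed

lemma strict_second_subderiv_pos_iff_uniform_growth:
  "(\<forall>h. h \<noteq> 0 \<longrightarrow> strict_second_subderiv \<phi> xb vb h > 0) \<longleftrightarrow> uniform_growth \<phi> xb vb"
  unfolding strict_second_subderiv_pos_iff
  using second_order_growth_imp_uniform_growth uniform_growth_imp_second_order_growth by blast

end

theorem theorem3p24:
  fixes \<phi> :: "real ^ 'n \<Rightarrow> ereal"
    and F :: "real ^ 'n \<Rightarrow> real ^ 'm"
    and Q :: "(real ^ 'm) set"
    and xb vb :: "real ^ 'n"
    and lb :: "real ^ 'm"
  assumes "proper_fun \<phi>"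
    and "lsc_fun \<phi>"
    and "C2_strictly_u_decomposable \<phi> xb Q F lb"
    and "vb = adjoint (blinfun_apply (fderiv F xb)) lb"
  shows
    "((\<forall>h. h \<noteq> 0 \<longrightarrow> strict_second_subderiv \<phi> xb vb h > 0) \<longleftrightarrow>
      (\<forall>h \<in> affine hull (critical_cone \<phi> xb vb) - {0}. lb \<bullet> D2 F xb h h > 0))
   \<and> ((\<forall>h. h \<noteq> 0 \<longrightarrow> strict_second_subderiv \<phi> xb vb h > 0) \<longleftrightarrow>
      (\<exists>U V \<sigma>. open U \<and> xb \<in> U \<and> open V \<and> vb \<in> V \<and> \<sigma> > 0 \<and>
        (\<forall>(x, v) \<in> gph (limiting_subdiff \<phi>) \<inter> (U \<times> V). \<forall>x'\<in>U.
          \<phi> x' \<ge> \<phi> x + ereal (v \<bullet> (x' - x)) + ereal (\<sigma> / 2 * (norm (x - x'))\<^sup>2))))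
   \<and> ((\<forall>h. h \<noteq> 0 \<longrightarrow> strict_second_subderiv \<phi> xb vb h > 0) \<longleftrightarrow>
      (strongly_metrically_regular (limiting_subdiff \<phi>) xb vb \<and>
       local_minimizer (\<lambda>x. \<phi> x - ereal (vb \<bullet> x)) xb))"
proof -
  have dec: "C2_strictly_decomposable \<phi> xb Q F lb" and utp: "UTP_property Q lb"
    using assms(3) by (auto simp: C2_strictly_u_decomposable_def)
  have "C2_decomposable \<phi> xb Q F" and l: "lb \<in> Q"
    and cq: "{blinfun_apply (fderiv F xb) w - y | w y. y \<in> normal_cone Q lb} = UNIV"
    using dec by (simp_all add: C2_strictly_decomposable_def)
  note dec' = this(1)[unfolded C2_decomposable_def]
  have fin: "\<bar>\<phi> xb\<bar> \<noteq> \<infinity>" using dec' by (elim conjE)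
  have Q: "closed Q" using dec' by (elim conjE)
  have Q': "convex Q" using dec' by (elim conjE)
  have F0: "F xb = 0" using dec' by (elim conjE)
  have "\<exists>U. open U \<and> xb \<in> U \<and> C2_on F U \<and> (\<forall>x\<in>U. \<phi> x = \<phi> xb + support_fun Q (F x))"
    using dec' by (elim conjE)
  then obtain U where U: "open U" "xb \<in> U" "C2_on F U"
    "\<And>x. x \<in> U \<Longrightarrow> \<phi> x = \<phi> xb + support_fun Q (F x)" by blast
  interpret strict_decomposition \<phi> F Q xb lb U
    by (rule strict_decomposition.intro[OF fin Q Q' l U F0 cq])
  show ?thesis
    unfolding uniform_growth_def[symmetric]
  proof (intro conjI)
    show "(\<forall>h. h \<noteq> 0 \<longrightarrow> strict_second_subderiv \<phi> xb vb h > 0) \<longleftrightarrow>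
      (\<forall>h \<in> affine hull (critical_cone \<phi> xb vb) - {0}. lb \<bullet> D2 F xb h h > 0)"
      unfolding assms(4) by (rule strict_second_subderiv_pos_iff_curvature[OF utp])
    show "(\<forall>h. h \<noteq> 0 \<longrightarrow> strict_second_subderiv \<phi> xb vb h > 0) \<longleftrightarrow> uniform_growth \<phi> xb vb"
      unfolding assms(4) by (rule strict_second_subderiv_pos_iff_uniform_growth)
    show "(\<forall>h. h \<noteq> 0 \<longrightarrow> strict_second_subderiv \<phi> xb vb h > 0) \<longleftrightarrow>
      (strongly_metrically_regular (limiting_subdiff \<phi>) xb vb \<and>
       local_minimizer (\<lambda>x. \<phi> x - ereal (vb \<bullet> x)) xb)"
      unfolding assms(4) strict_second_subderiv_pos_iff_uniform_growth
      by (intro iffI uniform_growth_imp_strongly_metrically_regular[OF assms(2) vb_limiting],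
          assumption, elim conjE, rule strongly_metrically_regular_imp_uniform_growth[OF assms(2)])
  qed
qed

end
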